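(* Let $(g,f)$ be a homogeneous pair of degree $\alpha\in\mathbb{R}-\{0\}$ on a manifold $M$ with a free $\mathbb{R}_{>0}$-action $m$. Let $l>0$, let $M_l=f^{-1}(l)\subset M$ and let $g_l$ be the pullback of $g$ to $M_l$. The geodesic $\gamma:(-\epsilon,\epsilon)\to M$ with initial position $x_0\in M_l\subset M$ and initial velocity $A\in T_{x_0}M$ with respect to the pseudo-Riemannian metric $f^\beta g$, where $\beta\in\mathbb{R}$, is given as follows. - When $\beta\ne-1$, $$\gamma(t)=m\left(\mu(\beta,t)^{\frac{1}{\alpha(\beta+1)}},\ \hat y_l\left(\int_0^t\frac{d\tau}{\mu(\beta,\tau)}\right)\right),$$ where $$\mu(\beta,t)=1+\frac{df(A)}{l}(\beta+1)t+\frac{\alpha}{4l}g(A,A)(\beta+1)^2t^2$$ and $\hat y_l(s)$ is the geodesic in $(M_l,g_l)$ with initial position $x_0\in M_l$ and initial velocity $A-\frac{df(A)}{\alpha l}P\in T_{x_0}M_l$ (the $T_{x_0}M_l$-component of $A$ in the decomposition $T_{x_0}M=T_{x_0}M_l\oplus\mathbb{R}P_{x_0}$). - When $\beta=-1$, $$\gamma(t)=m\left(e^{\frac{df(A)}{\alpha l}t},\ \hat y_l(t)\right)$$ with the same $\hat y_l$.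
   Context: Homogeneous pair: $m:\mathbb{R}_{>0}\times M\to M$ is a smooth free action, $m_\lambda=m(\lambda,\cdot)$, and $P\in\mathfrak{X}(M)$ is the generated vector field, $P_x=\frac{d}{dt}m(e^t,x)|_{t=0}$. For a pseudo-Riemannian metric $g$, a smooth $f:M\to\mathbb{R}_{>0}$ and $\alpha\in\mathbb{R}-\{0\}$, $(g,f)$ is a homogeneous pair of degree $\alpha$ if $m_\lambda^*g=\lambda^\alpha g$, $m_\lambda^*f=\lambda^\alpha f$ for all $\lambda>0$ and $g(P,\cdot)=df$. Here $\epsilon>0$ is small enough that the expressions are defined. *)

theory Defs
  imports "HOL-Analysis.Analysis"
begin

section \<open>Smooth maps between open subsets of vector spaces\<close>

primrec C_on :: "nat \<Rightarrow> 'a::real_normed_vector set \<Rightarrow> ('a \<Rightarrow> 'b::real_normed_vector) \<Rightarrow> bool" where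
  "C_on 0 S f \<longleftrightarrow> continuous_on S f"
| "C_on (Suc k) S f \<longleftrightarrow>
     (\<forall>x\<in>S. f differentiable (at x)) \<and> (\<forall>v. C_on k S (\<lambda>x. frechet_derivative f (at x) v))"

text \<open>Only used for open \<open>S\<close> and finite-dimensional domains.\<close>

definition smooth_on :: "'a::real_normed_vector set \<Rightarrow> ('a \<Rightarrow> 'b::real_normed_vector) \<Rightarrow> bool" where
  "smooth_on S f \<longleftrightarrow> (\<forall>k. C_on k S f)"


section \<open>Manifolds\<close>

text \<open>A chart is a pair of a domain and a coordinate map (whose values outside the domain are
  irrelevant). A manifold is a set of points with the subspace topology of its ambient type,
  together with an atlas.\<close>

type_synonym ('a, 'e) chart = "'a set \<times> ('a \<Rightarrow> 'e)"

abbreviation chart_inv :: "('a, 'e) chart \<Rightarrow> 'e \<Rightarrow> 'a" where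
  "chart_inv c \<equiv> inv_into (fst c) (snd c)"

definition is_chart :: "'a::topological_space set \<Rightarrow> ('a, 'e::real_normed_vector) chart \<Rightarrow> bool" where
  "is_chart M c \<longleftrightarrow>
     openin (top_of_set M) (fst c) \<and> open (snd c ` fst c) \<and>
     homeomorphism (fst c) (snd c ` fst c) (snd c) (chart_inv c)"

definition smooth_manifold ::
  "'a::{t2_space,second_countable_topology} set \<Rightarrow> ('a, 'e::real_normed_vector) chart set \<Rightarrow> bool" where
  "smooth_manifold M \<A> \<longleftrightarrow>
     (\<forall>c\<in>\<A>. is_chart M c) \<and> (\<Union>c\<in>\<A>. fst c) = M \<and>
     (\<forall>c\<in>\<A>. \<forall>d\<in>\<A>. smooth_on (snd c ` (fst c \<inter> fst d)) (\<lambda>x. snd d (chart_inv c x)))"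

definition smooth_map_at ::
  "('a, 'e::real_normed_vector) chart set \<Rightarrow> ('b, 'f::real_normed_vector) chart set
    \<Rightarrow> 'a \<Rightarrow> ('a \<Rightarrow> 'b) \<Rightarrow> bool" where
  "smooth_map_at \<A> \<B> p F \<longleftrightarrow>
     (\<exists>c\<in>\<A>. \<exists>d\<in>\<B>. \<exists>W. p \<in> fst c \<and> open W \<and> snd c p \<in> W \<and> W \<subseteq> snd c ` fst c \<and>
        (\<forall>x\<in>W. F (chart_inv c x) \<in> fst d) \<and> smooth_on W (\<lambda>x. snd d (F (chart_inv c x))))"

definition id_atlas :: "'e set \<Rightarrow> ('e, 'e) chart set" where
  "id_atlas U = {(U, id)}"

definition prod_atlas ::
  "('a, 'e) chart set \<Rightarrow> ('b, 'f) chart set \<Rightarrow> ('a \<times> 'b, 'e \<times> 'f) chart set" where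
  "prod_atlas \<A> \<B> = {(fst c \<times> fst d, map_prod (snd c) (snd d)) | c d. c \<in> \<A> \<and> d \<in> \<B>}"

abbreviation smooth_fun_at ::
  "('a, 'e::real_normed_vector) chart set \<Rightarrow> 'a \<Rightarrow> ('a \<Rightarrow> real) \<Rightarrow> bool" where
  "smooth_fun_at \<A> p h \<equiv> smooth_map_at \<A> (id_atlas UNIV) p h"

abbreviation smooth_curve_at ::
  "('a, 'e::real_normed_vector) chart set \<Rightarrow> real \<Rightarrow> (real \<Rightarrow> 'a) \<Rightarrow> bool" where
  "smooth_curve_at \<A> t \<gamma> \<equiv> smooth_map_at (id_atlas UNIV) \<A> t \<gamma>"


section \<open>Tangent vectors\<close>

text \<open>A tangent vector at \<open>p\<close> is the directional derivative along a smooth curve through \<open>p\<close>,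
  acting on the functions that are smooth near \<open>p\<close>; it is set to 0 on all other functions, so that
  equality of tangent vectors is equality in HOL. In particular \<open>df(X)\<close> is just \<open>X f\<close>, and the
  vector space operations are pointwise.\<close>

type_synonym 'a tangent = "('a \<Rightarrow> real) \<Rightarrow> real"

definition velocity ::
  "('a, 'e::real_normed_vector) chart set \<Rightarrow> (real \<Rightarrow> 'a) \<Rightarrow> real \<Rightarrow> 'a tangent" where
  "velocity \<A> \<gamma> t = (\<lambda>h. if smooth_fun_at \<A> (\<gamma> t) h then deriv (\<lambda>s. h (\<gamma> s)) t else 0)"

definition tangent_space ::
  "('a, 'e::real_normed_vector) chart set \<Rightarrow> 'a \<Rightarrow> 'a tangent set" where
  "tangent_space \<A> p = {velocity \<A> \<gamma> 0 | \<gamma>. smooth_curve_at \<A> 0 \<gamma> \<and> \<gamma> 0 = p}"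

text \<open>The differential at \<open>p\<close> of a map \<open>F\<close> into the manifold with atlas \<open>\<B>\<close>.\<close>

definition push ::
  "('b, 'f::real_normed_vector) chart set \<Rightarrow> ('a \<Rightarrow> 'b) \<Rightarrow> 'a \<Rightarrow> 'a tangent \<Rightarrow> 'b tangent" where
  "push \<B> F p X = (\<lambda>h. if smooth_fun_at \<B> (F p) h then X (\<lambda>q. h (F q)) else 0)"

text \<open>The coordinate vector field in direction \<open>u\<close>, at the point with coordinates \<open>x\<close>.\<close>

definition coord_vec ::
  "('a, 'e::real_normed_vector) chart set \<Rightarrow> ('a, 'e) chart \<Rightarrow> 'e \<Rightarrow> 'e \<Rightarrow> 'a tangent" where
  "coord_vec \<A> c x u = velocity \<A> (\<lambda>s. chart_inv c (x + s *\<^sub>R u)) 0"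


section \<open>Embedded submanifolds\<close>

text \<open>The charts of the submanifold structure of a subset \<open>S\<close> (with the subspace topology):
  those for which the inclusion is a smooth immersion. The dimension of the structure is that
  of the model space \<open>'f\<close>, which may be trivial.\<close>

definition submanifold_atlas ::
  "('a::topological_space, 'e::real_normed_vector) chart set \<Rightarrow> 'a set
    \<Rightarrow> ('a, 'f::real_normed_vector) chart set" where
  "submanifold_atlas \<A> S =
     {c. is_chart S c \<and>
         (\<forall>p\<in>fst c. smooth_map_at {c} \<A> p id \<and> inj_on (push \<A> id p) (tangent_space {c} p))}"


section \<open>Pseudo-Riemannian metrics and geodesics\<close>

type_synonym 'a metric_tensor = "'a \<Rightarrow> 'a tangent \<Rightarrow> 'a tangent \<Rightarrow> real"

definition local_metric ::
  "('a, 'e::real_normed_vector) chart set \<Rightarrow> 'a metric_tensor \<Rightarrow> ('a, 'e) chart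
    \<Rightarrow> 'e \<Rightarrow> 'e \<Rightarrow> 'e \<Rightarrow> real" where
  "local_metric \<A> g c x u v = g (chart_inv c x) (coord_vec \<A> c x u) (coord_vec \<A> c x v)"

definition pseudo_riemannian ::
  "'a set \<Rightarrow> ('a, 'e::real_normed_vector) chart set \<Rightarrow> 'a metric_tensor \<Rightarrow> bool" where
  "pseudo_riemannian M \<A> g \<longleftrightarrow>
     (\<forall>p\<in>M.
        (\<forall>X\<in>tangent_space \<A> p. \<forall>Y\<in>tangent_space \<A> p. g p X Y = g p Y X) \<and>
        (\<forall>X\<in>tangent_space \<A> p. \<forall>Y\<in>tangent_space \<A> p. \<forall>Z\<in>tangent_space \<A> p. \<forall>a b.
           g p (\<lambda>h. a * X h + b * Y h) Z = a * g p X Z + b * g p Y Z) \<and>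
        (\<forall>X\<in>tangent_space \<A> p. (\<forall>Y\<in>tangent_space \<A> p. g p X Y = 0) \<longrightarrow> X = (\<lambda>h. 0))) \<and>
     (\<forall>c\<in>\<A>. \<forall>u v. smooth_on (snd c ` fst c) (\<lambda>x. local_metric \<A> g c x u v))"

definition pullback ::
  "('b, 'f::real_normed_vector) chart set \<Rightarrow> ('a \<Rightarrow> 'b) \<Rightarrow> 'b metric_tensor \<Rightarrow> 'a metric_tensor" where
  "pullback \<B> F g = (\<lambda>p X Y. g (F p) (push \<B> F p X) (push \<B> F p Y))"

text \<open>The coordinate expression of the Levi-Civita derivative of the constant field \<open>v\<close> in direction
  \<open>u\<close>, that is, \<open>\<Gamma>\<^sup>k\<^sub>i\<^sub>j u\<^sup>i v\<^sup>j\<close>. It is given by the Koszul formula for constant fields, whose Lie brackets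
  vanish; the vector \<open>z\<close> is unique by nondegeneracy.\<close>

definition christoffel ::
  "('a, 'e::real_normed_vector) chart set \<Rightarrow> 'a metric_tensor \<Rightarrow> ('a, 'e) chart
    \<Rightarrow> 'e \<Rightarrow> 'e \<Rightarrow> 'e \<Rightarrow> 'e" where
  "christoffel \<A> g c x u v =
     (THE z. \<forall>w. 2 * local_metric \<A> g c x z w =
          frechet_derivative (\<lambda>y. local_metric \<A> g c y v w) (at x) u
        + frechet_derivative (\<lambda>y. local_metric \<A> g c y u w) (at x) v
        - frechet_derivative (\<lambda>y. local_metric \<A> g c y u v) (at x) w)"

text \<open>The smoothness condition includes that \<open>\<gamma>\<close> stays in the manifold on \<open>J\<close>.\<close>

definition geodesic ::
  "('a, 'e::real_normed_vector) chart set \<Rightarrow> 'a metric_tensor \<Rightarrow> real set \<Rightarrow> (real \<Rightarrow> 'a) \<Rightarrow> bool" where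
  "geodesic \<A> g J \<gamma> \<longleftrightarrow>
     (\<forall>t\<in>J. smooth_curve_at \<A> t \<gamma> \<and>
        (\<forall>c\<in>\<A>. \<gamma> t \<in> fst c \<longrightarrow>
           (let x = (\<lambda>s. snd c (\<gamma> s)); x' = (\<lambda>s. vector_derivative x (at s)) in
             vector_derivative x' (at t) + christoffel \<A> g c (x t) (x' t) (x' t) = 0)))"


section \<open>Homogeneous pairs\<close>

definition free_smooth_action ::
  "'a::topological_space set \<Rightarrow> ('a, 'e::real_normed_vector) chart set
    \<Rightarrow> (real \<Rightarrow> 'a \<Rightarrow> 'a) \<Rightarrow> bool" where
  "free_smooth_action M \<A> m \<longleftrightarrow>
     (\<forall>r>0. \<forall>x\<in>M. m r x \<in> M) \<and>
     (\<forall>x\<in>M. m 1 x = x) \<and>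
     (\<forall>r>0. \<forall>s>0. \<forall>x\<in>M. m (r * s) x = m r (m s x)) \<and>
     (\<forall>r>0. \<forall>x\<in>M. m r x = x \<longrightarrow> r = 1) \<and>
     (\<forall>z\<in>{0<..} \<times> M. smooth_map_at (prod_atlas (id_atlas {0<..}) \<A>) \<A> z (\<lambda>(r, x). m r x))"

definition generator ::
  "('a, 'e::real_normed_vector) chart set \<Rightarrow> (real \<Rightarrow> 'a \<Rightarrow> 'a) \<Rightarrow> 'a \<Rightarrow> 'a tangent" where
  "generator \<A> m x = velocity \<A> (\<lambda>t. m (exp t) x) 0"

definition homogeneous_pair ::
  "'a set \<Rightarrow> ('a, 'e::real_normed_vector) chart set \<Rightarrow> (real \<Rightarrow> 'a \<Rightarrow> 'a)
    \<Rightarrow> 'a metric_tensor \<Rightarrow> ('a \<Rightarrow> real) \<Rightarrow> real \<Rightarrow> bool" where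
  "homogeneous_pair M \<A> m g f \<alpha> \<longleftrightarrow>
     \<alpha> \<noteq> 0 \<and> pseudo_riemannian M \<A> g \<and>
     (\<forall>p\<in>M. smooth_fun_at \<A> p f \<and> f p > 0) \<and>
     (\<forall>r>0. \<forall>p\<in>M. \<forall>X\<in>tangent_space \<A> p. \<forall>Y\<in>tangent_space \<A> p.
        pullback \<A> (m r) g p X Y = r powr \<alpha> * g p X Y) \<and>
     (\<forall>r>0. \<forall>p\<in>M. f (m r p) = r powr \<alpha> * f p) \<and>
     (\<forall>p\<in>M. \<forall>X\<in>tangent_space \<A> p. g p (generator \<A> m p) X = X f)"

end

theory Submission
  imports Defs
begin

text \<open>
  The flow box \<open>(w, s) \<mapsto> m (exp s) w\<close> over the level set \<open>M\<^sub>l\<close> turns the action into a translation, \<open>f\<close> into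
  \<open>l exp (\<alpha> s)\<close> and \<open>g\<close> into \<open>exp (\<alpha> s) (g\<^sub>l + \<alpha> l ds\<^sup>2)\<close>. Hence \<open>f\<^sup>\<beta> g\<close> is a constant multiple of
  \<open>exp (k s) (g\<^sub>l + \<alpha> l ds\<^sup>2)\<close> with \<open>k = \<alpha> (\<beta> + 1)\<close>, and a curve \<open>(y (\<sigma> t), s t)\<close>, where \<open>y\<close> is a geodesic
  of \<open>g\<^sub>l\<close> of constant energy \<open>K\<close>, is a geodesic of it iff \<open>\<sigma>'' + k s' \<sigma>' = 0\<close> and
  \<open>2 \<alpha> l s'' + k \<alpha> l s'\<^sup>2 = k \<sigma>'\<^sup>2 K\<close>. These equations are solved by \<open>s = ln \<mu> / k\<close> and \<open>\<sigma>' = 1 / \<mu>\<close>,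
  respectively by linear functions when \<open>k = 0\<close>; uniqueness is that of solutions of ordinary
  differential equations.
\<close>

section \<open>Calculus of smooth maps\<close>

text \<open>The origin of \<mu>: the equation for \<sigma> makes exp (k s) \<sigma>' constant, so
  \<mu> = exp (k s) and \<sigma>'(0) = 1 give \<sigma>' = 1 / \<mu>. The other equation becomes 2
  \<mu> \<mu>'' - \<mu>'^2 = k^2 K / (\<alpha> l). Its derivative is 2 \<mu> \<mu>''' = 0, so \<mu>
  is a quadratic polynomial, with coefficients fixed by \<mu>(0) = 1, s'(0) = df(A) / (\<alpha> l)
  and the equation at 0, where K = g(A,A) - df(A)^2 / (\<alpha> l). The obstacle is that geodesics
  are defined by Christoffel symbols in the charts of \<open>\<A>\<close>, while the flow box has
  domain in \<open>'f \<times> real\<close> and is no such chart. Pairing the equation with test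
  vectors turns it into the vanishing of an Euler-Lagrange expression, which pulls back along any
  smooth map; surjectivity of the differential of the flow box then supplies all test vectors of the
  chart. The metric may be indefinite, so its restriction to a level set could degenerate a priori.
  It does not, since P is orthogonal to the level set and g(P,P) = \<alpha> l is nonzero
  there.\<close>

abbreviation fd :: "('a::real_normed_vector \<Rightarrow> 'b::real_normed_vector) \<Rightarrow> 'a \<Rightarrow> 'a \<Rightarrow> 'b" where
  "fd f x \<equiv> frechet_derivative f (at x)"

lemma fd_eqI: "(f has_derivative f') (at x) \<Longrightarrow> fd f x = f'"
  by (metis frechet_derivative_at)

lemma fd_has_derivative: "f differentiable (at x) \<Longrightarrow> (f has_derivative fd f x) (at x)"
  by (simp add: frechet_derivative_works)

lemma has_derivative_cong_open:
  assumes "open S" "x \<in> S" "\<And>y. y \<in> S \<Longrightarrow> f y = g y"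
  shows "(f has_derivative D) (at x) \<longleftrightarrow> (g has_derivative D) (at x)"
  using assms by (metis has_derivative_transform_within_open)

lemma fd_cong_open:
  assumes "open S" "x \<in> S" "\<And>y. y \<in> S \<Longrightarrow> f y = g y"
  shows "fd f x = fd g x"
  using has_derivative_cong_open[OF assms] by (simp add: frechet_derivative_def)

lemma differentiable_cong_open:
  assumes "open S" "x \<in> S" "\<And>y. y \<in> S \<Longrightarrow> f y = g y"
  shows "f differentiable (at x) \<longleftrightarrow> g differentiable (at x)"
  using has_derivative_cong_open[OF assms] by (simp add: differentiable_def)

section \<open>Closure properties of maps of finite differentiability order\<close>

text \<open>The derivatives in \<open>C_on\<close> are taken \<open>at x\<close> and see a full
  neighbourhood, so agreement on S transfers them because S is open.\<close>

lemma C_on_cong: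
  assumes "open S" "\<And>x. x \<in> S \<Longrightarrow> f x = g x" "C_on k S f"
  shows "C_on k S g"
  using assms(2,3)
proof (induction k arbitrary: f g)
  case 0 then show ?case by (simp cong: continuous_on_cong)
next
  case (Suc k)
  have "C_on k S (\<lambda>x. fd g x v)" for v
    by (rule Suc.IH[of "\<lambda>x. fd f x v"])
      (use Suc.prems fd_cong_open[OF \<open>open S\<close>, of _ f g] in auto)
  then show ?case using Suc.prems differentiable_cong_open[OF \<open>open S\<close>, of _ f g] by auto
qed

text \<open>Any formula for the derivative may stand in for \<open>frechet_derivative\<close>; the
  inductions on the order below all run on explicit derivatives.\<close>

lemma C_on_SucI:
  assumes "open S" "\<And>x. x \<in> S \<Longrightarrow> (f has_derivative f' x) (at x)" "\<And>v. C_on k S (\<lambda>x. f' x v)"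
  shows "C_on (Suc k) S f"
proof -
  have "C_on k S (\<lambda>x. fd f x v)" for v
    by (rule C_on_cong[OF \<open>open S\<close> _ assms(3)[of v]]) (simp add: fd_eqI[OF assms(2)])
  then show ?thesis using assms(2) by (auto simp: differentiable_def)
qed

lemma C_on_SucD: "C_on (Suc k) S f \<Longrightarrow> C_on k S f"
proof (induction k arbitrary: f)
  case 0
  then show ?case
    by (auto intro!: differentiable_imp_continuous_on
        simp: differentiable_on_def differentiable_at_withinI)
next
  case (Suc k)
  then show ?case by (metis C_on.simps(2))
qed

lemma C_on_subset: "C_on k S f \<Longrightarrow> T \<subseteq> S \<Longrightarrow> C_on k T f"
  by (induction k arbitrary: f) (auto intro: continuous_on_subset)

lemma C_on_const: "C_on k S (\<lambda>x. c)"
  by (induction k arbitrary: c) auto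

lemma C_on_add:
  assumes "open S" "C_on k S f" "C_on k S g"
  shows "C_on k S (\<lambda>x. f x + g x)"
  using assms(2,3)
proof (induction k arbitrary: f g)
  case 0 then show ?case by (auto intro: continuous_intros)
next
  case (Suc k)
  show ?case
    by (rule C_on_SucI[OF \<open>open S\<close>, where f' = "\<lambda>x v. fd f x v + fd g x v"])
      (use Suc in \<open>auto intro!: has_derivative_add fd_has_derivative\<close>)
qed

lemma C_on_sum:
  assumes "open S" "\<And>i. i \<in> I \<Longrightarrow> C_on k S (f i)"
  shows "C_on k S (\<lambda>x. \<Sum>i\<in>I. f i x)"
  using assms(2) by (induction I rule: infinite_finite_induct)
    (auto intro: C_on_const C_on_add[OF \<open>open S\<close>])

lemma C_on_linear:
  assumes "open S" "bounded_linear L" "C_on k S f"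
  shows "C_on k S (\<lambda>x. L (f x))"
  using assms(3)
proof (induction k arbitrary: f)
  case 0 then show ?case using assms(2) by (auto intro: bounded_linear.continuous_on)
next
  case (Suc k)
  show ?case
    by (rule C_on_SucI[OF \<open>open S\<close>, where f' = "\<lambda>x v. L (fd f x v)"])
      (use Suc in \<open>auto intro!: bounded_linear.has_derivative[OF assms(2)] fd_has_derivative\<close>)
qed

text \<open>By the Leibniz rule, each summand of the derivative pairs a derivative of order k with
  an undifferentiated factor, whose order is lowered from \<open>Suc k\<close> to k to fit the
  induction hypothesis.\<close>

lemma C_on_bilinear:
  assumes "open S" "bounded_bilinear pr" "C_on k S f" "C_on k S g"
  shows "C_on k S (\<lambda>x. pr (f x) (g x))"
  using assms(3,4)
proof (induction k arbitrary: f g)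
  case 0 then show ?case using bounded_bilinear.continuous_on[OF assms(2)] by auto
next
  case (Suc k)
  show ?case
  proof (rule C_on_SucI[OF \<open>open S\<close>, where f' = "\<lambda>x v. pr (f x) (fd g x v) + pr (fd f x v) (g x)"])
    show "((\<lambda>x. pr (f x) (g x)) has_derivative (\<lambda>v. pr (f x) (fd g x v) + pr (fd f x v) (g x))) (at x)"
      if "x \<in> S" for x
      by (rule bounded_bilinear.FDERIV[OF assms(2)]) (use Suc.prems that in \<open>auto intro: fd_has_derivative\<close>)
    show "C_on k S (\<lambda>x. pr (f x) (fd g x v) + pr (fd f x v) (g x))" for v
    proof (rule C_on_add[OF \<open>open S\<close>])
      show "C_on k S (\<lambda>x. pr (f x) (fd g x v))"
        using Suc.IH[OF C_on_SucD[OF Suc.prems(1)]] Suc.prems(2) by simp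
      show "C_on k S (\<lambda>x. pr (fd f x v) (g x))"
        using Suc.IH[OF _ C_on_SucD[OF Suc.prems(2)]] Suc.prems(1) by simp
    qed
  qed
qed

lemma C_on_id: "open S \<Longrightarrow> C_on k S (\<lambda>x. x)"
  by (cases k) (auto intro!: C_on_SucI[where f' = "\<lambda>x v. v"] C_on_const)

lemma C_on_Pair:
  assumes "open S" "C_on k S f" "C_on k S g"
  shows "C_on k S (\<lambda>x. (f x, g x))"
proof -
  have "C_on k S (\<lambda>x. (f x, 0) + (0, g x))"
    by (intro C_on_add[OF assms(1)] C_on_linear[OF assms(1) _ assms(2)]
        C_on_linear[OF assms(1) _ assms(3)] bounded_linear_Pair bounded_linear_ident bounded_linear_zero)
  then show ?thesis by simp
qed

text \<open>The model space of a submanifold need not belong to the class of Euclidean spaces; the calculus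
  only uses a finite set \<open>B\<close> with the expansion property of an orthonormal basis.\<close>

definition frame :: "'a::real_inner set \<Rightarrow> bool" where
  "frame B \<longleftrightarrow> finite B \<and> (\<forall>x. (\<Sum>b\<in>B. (x \<bullet> b) *\<^sub>R b) = x)"

lemma frame_Basis: "frame (Basis :: 'a::euclidean_space set)"
  by (simp add: frame_def euclidean_representation)

lemma frame_expand:
  "frame B \<Longrightarrow> linear L \<Longrightarrow> L x = (\<Sum>b\<in>B. (x \<bullet> b) *\<^sub>R L b)"
proof -
  assume B: "frame B" and L: "linear L"
  have "L x = L (\<Sum>b\<in>B. (x \<bullet> b) *\<^sub>R b)" using B by (simp add: frame_def)
  also have "\<dots> = (\<Sum>b\<in>B. (x \<bullet> b) *\<^sub>R L b)" using L by (simp add: linear_sum linear_scale)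
  finally show ?thesis .
qed

text \<open>Provides the frame for the domain \<open>'f \<times> real\<close> of the flow
  box.\<close>

lemma frame_times_real:
  assumes "frame B"
  shows "frame ((\<lambda>b. (b, 0::real)) ` B \<union> {(0, 1)})"
proof -
  have *: "(0, 1) \<notin> (\<lambda>b. (b, 0::real)) ` B" by auto
  have inj: "inj_on (\<lambda>b. (b, 0::real)) B" by (auto simp: inj_on_def)
  have "(\<Sum>b\<in>B. (x \<bullet> b) *\<^sub>R (b, 0::real)) = (x, 0)" for x
  proof -
    have "(\<Sum>b\<in>B. (x \<bullet> b) *\<^sub>R (b, 0::real)) = (\<lambda>y. (y, 0::real)) (\<Sum>b\<in>B. (x \<bullet> b) *\<^sub>R b)"
      using assms by (simp add: frame_def) (simp add: prod_eq_iff fst_sum snd_sum)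
    then show ?thesis using assms by (simp add: frame_def)
  qed
  then show ?thesis
    using assms * by (auto simp: frame_def sum.reindex[OF inj] o_def)
qed

lemma frame_linear_bounded:
  fixes L :: "'a::real_inner \<Rightarrow> 'b::real_normed_vector"
  assumes "frame (B :: 'a set)" "linear L"
  shows "bounded_linear L"
proof -
  have "norm (L x) \<le> norm x * (\<Sum>b\<in>B. norm b * norm (L b))" for x :: 'a
  proof -
    have "norm (L x) \<le> (\<Sum>b\<in>B. norm ((x \<bullet> b) *\<^sub>R L b))"
      unfolding frame_expand[OF assms, of x] by (rule norm_sum)
    also have "\<dots> \<le> (\<Sum>b\<in>B. norm x * (norm b * norm (L b)))"
      by (rule sum_mono)
        (simp add: mult.assoc[symmetric] mult_right_mono Cauchy_Schwarz_ineq2)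
    finally show ?thesis by (simp add: sum_distrib_left)
  qed
  then show ?thesis
    using assms(2) by (intro bounded_linear_intro) (auto simp: linear_add linear_scale)
qed

text \<open>Normalising an orthogonal spanning set gives an orthonormal one, and the expansion
  property then holds by induction over the span.\<close>

lemma frame_exists:
  fixes D :: "'f::real_inner set"
  assumes "finite D" "span D = UNIV"
  obtains B :: "'f set" where "frame B" "card B \<le> card D"
proof -
  obtain C :: "'f set" where C: "finite C" "card C \<le> card D" "span C = UNIV" "pairwise orthogonal C"
    using basis_orthogonal[OF assms(1)] assms(2) by auto
  \<comment> \<open>The orthogonal set may contain 0, which has to be dropped before
    normalising.\<close>
  define B where "B = (\<lambda>c. c /\<^sub>R norm c) ` (C - {0})"
  have inner: "b \<bullet> c = (if b = c then 1 else 0)" if "b \<in> B" "c \<in> B" for b c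
  proof -
    obtain b' where b': "b = b' /\<^sub>R norm b'" "b' \<in> C" "b' \<noteq> 0"
      using \<open>b \<in> B\<close> unfolding B_def by blast
    obtain c' where c': "c = c' /\<^sub>R norm c'" "c' \<in> C" "c' \<noteq> 0"
      using \<open>c \<in> B\<close> unfolding B_def by blast
    note bc = b' c'
    show ?thesis
    proof (cases "b' = c'")
      case True
      then show ?thesis using bc by (simp add: dot_square_norm power2_eq_square)
    next
      case False
      then have "b \<bullet> c = 0"
        using C(4) bc by (auto simp: pairwise_def orthogonal_def)
      moreover have "b \<bullet> b = 1" using bc by (simp add: dot_square_norm power2_eq_square)
      ultimately show ?thesis by auto
    qed
  qed
  have fin: "finite B" using C by (simp add: B_def)
  have "C \<subseteq> span B"
  proof
    fix c assume "c \<in> C"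
    show "c \<in> span B"
    proof (cases "c = 0")
      case False
      then have "c = norm c *\<^sub>R (c /\<^sub>R norm c)" by simp
      moreover have "c /\<^sub>R norm c \<in> B" using False \<open>c \<in> C\<close> by (auto simp: B_def)
      ultimately show ?thesis by (metis span_base span_scale)
    qed (simp add: span_zero)
  qed
  then have sp: "span B = UNIV" using C(3) by (metis span_mono span_span top.extremum_uniqueI)
  have "(\<Sum>b\<in>B. (x \<bullet> b) *\<^sub>R b) = x" for x
  proof -
    have "x \<in> span B" using sp by simp
    then show ?thesis
    proof (induction rule: span_induct_alt)
      case base show ?case by simp
    next
      case (step a c y)
      have "(\<Sum>b\<in>B. (c \<bullet> b) *\<^sub>R b) = c"
        using step.hyps inner[OF step.hyps] fin by (simp add: if_distrib[of "\<lambda>r. r *\<^sub>R _"] cong: if_cong sum.cong)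
      then have "(\<Sum>b\<in>B. ((a *\<^sub>R c) \<bullet> b) *\<^sub>R b) = a *\<^sub>R c"
        by (simp flip: scaleR_scaleR scaleR_sum_right)
      then show ?case using step.IH by (simp add: inner_left_distrib scaleR_left_distrib sum.distrib del: inner_scaleR_left)
    qed
  qed
  moreover have "card B \<le> card D"
    using C(2) card_image_le[of "C - {0}" "\<lambda>c. c /\<^sub>R norm c"] C(1) card_Diff1_le[of C 0]
    unfolding B_def by (meson finite_Diff le_trans)
  ultimately show thesis using that fin by (auto simp: frame_def)
qed

text \<open>The chain rule differentiates f in the direction \<open>fd g x v\<close>, which moves
  with x, whereas \<open>C_on\<close> speaks of fixed directions. Expanding the direction over a
  frame separates the two; this is the main reason for frames.\<close>

lemma C_on_compose:
  fixes g :: "'a::real_normed_vector \<Rightarrow> 'b::real_inner" and f :: "'b \<Rightarrow> 'c::real_normed_vector"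
  assumes B: "frame (B :: 'b set)" and "open S" "open T" "C_on k T f" "C_on k S g" "\<And>x. x \<in> S \<Longrightarrow> g x \<in> T"
  shows "C_on k S (\<lambda>x. f (g x))"
  using assms(4,5)
proof (induction k arbitrary: f)
  case 0
  then show ?case using assms(6) by (auto intro!: continuous_on_compose2[of T f S g])
next
  case (Suc k)
  have gk: "C_on k S (\<lambda>x. fd g x v)" for v using Suc.prems by simp
  have f: "f differentiable at y" if "y \<in> T" for y using Suc.prems that by simp
  show ?case
  proof (rule C_on_SucI[OF \<open>open S\<close>, where f' = "\<lambda>x v. fd f (g x) (fd g x v)"])
    show "((\<lambda>x. f (g x)) has_derivative (\<lambda>v. fd f (g x) (fd g x v))) (at x)" if "x \<in> S" for x
      by (rule has_derivative_compose[of g]) (use Suc.prems assms(6) that in \<open>auto intro: fd_has_derivative f\<close>)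
    fix v
    have "C_on k S (\<lambda>x. \<Sum>b\<in>B. (fd g x v \<bullet> b) *\<^sub>R fd f (g x) b)"
      using Suc.prems C_on_SucD[OF Suc.prems(2)]
      by (intro C_on_sum[OF \<open>open S\<close>] C_on_bilinear[OF \<open>open S\<close> bounded_bilinear_scaleR]
          C_on_linear[OF \<open>open S\<close> bounded_linear_inner_left] gk Suc.IH) auto
    then show "C_on k S (\<lambda>x. fd f (g x) (fd g x v))"
      by (rule C_on_cong[OF \<open>open S\<close>, rotated])
        (use frame_expand[OF B linear_frechet_derivative[OF f[OF assms(6)]]] in metis)
  qed
qed

section \<open>Germs of smooth maps\<close>

text \<open>Smoothness of a germ. Chart expressions are meaningful only near a point, and in this
  form they compose without any bookkeeping of domains.\<close>

definition smooth_near :: "('a::real_normed_vector \<Rightarrow> 'b::real_normed_vector) \<Rightarrow> 'a \<Rightarrow> bool" where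
  "smooth_near f x \<longleftrightarrow> (\<exists>W. open W \<and> x \<in> W \<and> smooth_on W f)"

lemma smooth_on_subset: "smooth_on S f \<Longrightarrow> T \<subseteq> S \<Longrightarrow> smooth_on T f"
  by (auto simp: smooth_on_def intro: C_on_subset)

lemma smooth_nearI: "smooth_on W f \<Longrightarrow> open W \<Longrightarrow> x \<in> W \<Longrightarrow> smooth_near f x"
  by (auto simp: smooth_near_def)

lemma C_on_local:
  assumes "\<And>x. x \<in> S \<Longrightarrow> \<exists>W. open W \<and> x \<in> W \<and> C_on k W f"
  shows "C_on k S f"
  using assms
proof (induction k arbitrary: f)
  case 0
  have "isCont f x" if "x \<in> S" for x
    using 0[OF that] by (auto simp: continuous_on_eq_continuous_at)
  then show ?case by (simp add: continuous_at_imp_continuous_on)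
next
  case (Suc k)
  have "f differentiable at x" if "x \<in> S" for x using Suc.prems[OF that] by auto
  moreover have "C_on k S (\<lambda>x. fd f x v)" for v
    by (rule Suc.IH) (use Suc.prems in force)
  ultimately show ?case by simp
qed

lemma smooth_onI_near: "(\<And>x. x \<in> S \<Longrightarrow> smooth_near f x) \<Longrightarrow> smooth_on S f"
  unfolding smooth_on_def smooth_near_def by (rule allI, rule C_on_local) blast

lemma smooth_near_eventually:
  assumes "smooth_near f x" shows "\<forall>\<^sub>F y in nhds x. smooth_near f y"
  using assms unfolding eventually_nhds smooth_near_def by blast

lemma smooth_near_cong:
  assumes "smooth_near f x" "\<forall>\<^sub>F y in nhds x. f y = g y"
  shows "smooth_near g x"
proof -
  obtain W where W: "open W" "x \<in> W" "smooth_on W f" using assms(1) by (auto simp: smooth_near_def)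
  obtain V where V: "open V" "x \<in> V" "\<And>y. y \<in> V \<Longrightarrow> f y = g y"
    using assms(2) by (auto simp: eventually_nhds)
  have "smooth_on (W \<inter> V) g"
    unfolding smooth_on_def
    by (rule allI, rule C_on_cong[of "W \<inter> V" f]) (use W V in \<open>auto simp: smooth_on_def intro: C_on_subset\<close>)
  then show ?thesis using W V by (intro smooth_nearI[of "W \<inter> V"]) auto
qed

lemma smooth_near_differentiable: "smooth_near f x \<Longrightarrow> f differentiable (at x)"
  unfolding smooth_near_def smooth_on_def by (metis C_on.simps(2))

lemma smooth_near_has_derivative: "smooth_near f x \<Longrightarrow> (f has_derivative fd f x) (at x)"
  by (simp add: fd_has_derivative smooth_near_differentiable)

lemma smooth_near_linear_fd: "smooth_near f x \<Longrightarrow> linear (fd f x)"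
  by (simp add: linear_frechet_derivative smooth_near_differentiable)

lemma smooth_near_isCont: "smooth_near f x \<Longrightarrow> isCont f x"
  by (simp add: differentiable_imp_continuous_within smooth_near_differentiable)

lemma smooth_near_fd: "smooth_near f x \<Longrightarrow> smooth_near (\<lambda>y. fd f y v) x"
  unfolding smooth_near_def smooth_on_def by (metis C_on.simps(2))

text \<open>Reduces the closure rules for germs to those for a fixed open set by intersecting the
  two neighbourhoods.\<close>

lemma smooth_near2:
  assumes "smooth_near f x" "smooth_near g x"
    and "\<And>k S. open S \<Longrightarrow> C_on k S f \<Longrightarrow> C_on k S g \<Longrightarrow> C_on k S h"
  shows "smooth_near h x"
proof -
  obtain W V where W: "open W" "x \<in> W" "smooth_on W f" "open V" "x \<in> V" "smooth_on V g"
    using assms(1,2) by (auto simp: smooth_near_def)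
  have "smooth_on (W \<inter> V) h"
    unfolding smooth_on_def
    by (rule allI, rule assms(3)) (use W in \<open>auto simp: smooth_on_def intro: C_on_subset\<close>)
  then show ?thesis using W by (intro smooth_nearI[of "W \<inter> V"]) auto
qed

lemma smooth_near_const: "smooth_near (\<lambda>x. c) x"
  unfolding smooth_near_def smooth_on_def by (rule exI[of _ UNIV]) (auto intro: C_on_const)

lemma smooth_near_id: "smooth_near (\<lambda>x. x) x"
  unfolding smooth_near_def smooth_on_def by (rule exI[of _ UNIV]) (auto intro: C_on_id)

lemma smooth_near_add: "smooth_near f x \<Longrightarrow> smooth_near g x \<Longrightarrow> smooth_near (\<lambda>x. f x + g x) x"
  by (erule (1) smooth_near2) (rule C_on_add)

lemma smooth_near_sum: "(\<And>i. i \<in> I \<Longrightarrow> smooth_near (f i) x) \<Longrightarrow> smooth_near (\<lambda>x. \<Sum>i\<in>I. f i x) x"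
  by (induction I rule: infinite_finite_induct) (auto intro: smooth_near_const smooth_near_add)

lemma smooth_near_linear: "bounded_linear L \<Longrightarrow> smooth_near f x \<Longrightarrow> smooth_near (\<lambda>x. L (f x)) x"
  by (rule smooth_near2[of f x f]) (auto intro: C_on_linear)

lemma smooth_near_bilinear:
  "bounded_bilinear pr \<Longrightarrow> smooth_near f x \<Longrightarrow> smooth_near g x \<Longrightarrow> smooth_near (\<lambda>x. pr (f x) (g x)) x"
  by (rule smooth_near2[of f x g]) (auto intro: C_on_bilinear)

lemmas smooth_near_mult = smooth_near_bilinear[OF bounded_bilinear_mult]
lemmas smooth_near_scaleR = smooth_near_bilinear[OF bounded_bilinear_scaleR]
lemmas smooth_near_inner = smooth_near_bilinear[OF bounded_bilinear_inner]
lemmas smooth_near_minus = smooth_near_linear[OF bounded_linear_minus[OF bounded_linear_ident]]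
lemmas smooth_near_fst = smooth_near_linear[OF bounded_linear_fst]
lemmas smooth_near_snd = smooth_near_linear[OF bounded_linear_snd]

lemma smooth_near_diff: "smooth_near f x \<Longrightarrow> smooth_near g x \<Longrightarrow> smooth_near (\<lambda>x. f x - g x) x"
  using smooth_near_add[of f x "\<lambda>x. - g x"] smooth_near_minus[of g x] by simp

lemma smooth_near_Pair: "smooth_near f x \<Longrightarrow> smooth_near g x \<Longrightarrow> smooth_near (\<lambda>x. (f x, g x)) x"
  by (erule (1) smooth_near2) (rule C_on_Pair)

lemma smooth_near_compose:
  fixes g :: "'a::real_normed_vector \<Rightarrow> 'b::real_inner" and f :: "'b \<Rightarrow> 'c::real_normed_vector"
  assumes B: "frame (B :: 'b set)" and f: "smooth_near f (g x)" and g: "smooth_near g x"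
  shows "smooth_near (\<lambda>x. f (g x)) x"
proof -
  obtain T where T: "open T" "g x \<in> T" "smooth_on T f" using f by (auto simp: smooth_near_def)
  obtain W where W: "open W" "x \<in> W" "smooth_on W g" using g by (auto simp: smooth_near_def)
  have "continuous_on W g" using W(3) unfolding smooth_on_def by (metis C_on.simps(1))
  then have o: "open (g -` T \<inter> W)" using W T by (simp add: continuous_on_open_vimage)
  have "smooth_on (g -` T \<inter> W) (\<lambda>x. f (g x))"
    unfolding smooth_on_def
    by (rule allI, rule C_on_compose[OF B o T(1)]) (use W T in \<open>auto simp: smooth_on_def intro: C_on_subset\<close>)
  then show ?thesis using o W T by (intro smooth_nearI[of "g -` T \<inter> W"]) auto
qed

section \<open>Powers, exponential, antiderivatives and logarithm\<close>

lemma smooth_near_powr: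
  fixes a x :: real assumes "x > 0" shows "smooth_near (\<lambda>x. x powr a) x"
proof -
  have "C_on k {0<..} (\<lambda>x::real. x powr a)" for k
  \<comment> \<open>The exponent is generalised because differentiation replaces \<open>a\<close> by
    \<open>a - 1\<close>.\<close>
  proof (induction k arbitrary: a)
    case 0 show ?case by (auto intro!: continuous_intros)
  next
    case (Suc k)
    show ?case
    proof (rule C_on_SucI[where f' = "\<lambda>x v. (a * v) * x powr (a - 1)"])
      show "((\<lambda>x. x powr a) has_derivative (\<lambda>v. a * v * x powr (a - 1))) (at x)" if "x \<in> {0<..}" for x
        using has_real_derivative_powr[of x a] that
        by (auto simp: has_field_derivative_def mult.commute mult.left_commute mult.assoc elim!: has_derivative_eq_rhs)
      show "C_on k {0<..} (\<lambda>x. (a * v) * x powr (a - 1))" for v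
        by (intro C_on_linear[OF _ bounded_linear_mult_right] Suc.IH) auto
    qed auto
  qed
  then show ?thesis using assms by (intro smooth_nearI[of "{0<..}"]) (auto simp: smooth_on_def)
qed

lemma smooth_near_exp: "smooth_near exp (x::real)"
proof -
  have "C_on k UNIV (exp :: real \<Rightarrow> real)" for k
  proof (induction k)
    case 0 show ?case by (auto intro!: continuous_intros)
  next
    case (Suc k)
    show ?case
      by (rule C_on_SucI[where f' = "\<lambda>x v. v * exp x"])
        (use Suc DERIV_exp in \<open>auto intro!: C_on_linear[OF _ bounded_linear_mult_right] simp: has_field_derivative_def mult_commute_abs\<close>)
  qed
  then show ?thesis by (intro smooth_nearI[of UNIV]) (auto simp: smooth_on_def)
qed

text \<open>Integration gains one order of differentiability. Besides the logarithm, this makes the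
  integral of \<open>1 / \<mu>\<close> smooth.\<close>

lemma smooth_near_antiderivative:
  fixes f :: "real \<Rightarrow> real"
  assumes "open S" "x \<in> S" "\<And>t. t \<in> S \<Longrightarrow> (F has_real_derivative f t) (at t)" "smooth_near f x"
  shows "smooth_near F x"
proof -
  obtain W where W: "open W" "x \<in> W" "smooth_on W f" using assms(4) by (auto simp: smooth_near_def)
  have "C_on k (W \<inter> S) F" for k
  proof (cases k)
    case 0
    then show ?thesis using assms(3) by (auto intro!: continuous_at_imp_continuous_on DERIV_isCont)
  next
    case (Suc j)
    have "C_on j (W \<inter> S) (\<lambda>x. v * f x)" for v
      using W assms(1) by (intro C_on_linear[OF _ bounded_linear_mult_right])
         (auto simp: smooth_on_def intro: C_on_subset)
    then show ?thesis unfolding Suc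
      by (intro C_on_SucI[where f' = "\<lambda>x v. v * f x"])
        (use W assms in \<open>auto simp: has_field_derivative_def mult_commute_abs\<close>)
  qed
  then show ?thesis using W assms by (intro smooth_nearI[of "W \<inter> S"]) (auto simp: smooth_on_def)
qed

lemma smooth_near_ln:
  fixes x :: real assumes "x > 0" shows "smooth_near ln x"
proof (rule smooth_near_antiderivative)
  show "(ln has_real_derivative t powr - 1) (at t)" if "t \<in> {0<..}" for t :: real
    using DERIV_ln[of t] that by (simp add: powr_minus)
  show "smooth_near (\<lambda>t. t powr - 1) x" by (rule smooth_near_powr[OF assms])
qed (use assms in auto)

section \<open>Second derivatives, inverse functions and differential equations\<close>

lemma isCont_tendsto_nhds: "isCont f x \<Longrightarrow> (f \<longlongrightarrow> f x) (nhds x)"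
  using tendsto_at_iff_tendsto_nhds[of f x] by (simp add: continuous_at)

section \<open>Symmetry of second derivatives\<close>

text \<open>The mean value theorem is applied in direction u to the increment along v, and then in
  direction v to the derivative so obtained.\<close>

lemma second_difference_mvt:
  fixes f :: "'a::real_normed_vector \<Rightarrow> real"
  assumes sm: "\<And>y. y \<in> ball x r \<Longrightarrow> smooth_near f y"
    and h: "h > 0" "h * (norm u + norm v) < r"
  obtains s t where "0 < s" "s < h" "0 < t" "t < h"
    "f (x + h *\<^sub>R u + h *\<^sub>R v) - f (x + h *\<^sub>R u) - f (x + h *\<^sub>R v) + f x
      = h\<^sup>2 * fd (\<lambda>y. fd f y u) (x + s *\<^sub>R u + t *\<^sub>R v) v"
proof -
  have in_ball: "x + s *\<^sub>R u + t *\<^sub>R v \<in> ball x r" if "0 \<le> s" "s \<le> h" "0 \<le> t" "t \<le> h" for s t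
  proof -
    have "norm (s *\<^sub>R u + t *\<^sub>R v) \<le> s * norm u + t * norm v"
      using that by (intro norm_triangle_le) auto
    also have "\<dots> \<le> h * norm u + h * norm v"
      using that by (intro add_mono mult_right_mono) auto
    finally show ?thesis using h(2)
      by (simp add: dist_norm algebra_simps norm_minus_commute[of x])
        (metis (no_types, opaque_lifting) add.commute add.inverse_inverse diff_add_eq_diff_diff_swap diff_self minus_add_distrib norm_minus_cancel order_le_less_trans uminus_add_conv_diff)
  qed
  have fder: "(f has_derivative fd f y) (at y)" if "y \<in> ball x r" for y
    using sm[OF that] by (rule smooth_near_has_derivative)
  have ffder: "((\<lambda>y. fd f y u) has_derivative fd (\<lambda>y. fd f y u) y) (at y)" if "y \<in> ball x r" for y
    using smooth_near_fd[OF sm[OF that]] by (rule smooth_near_has_derivative)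
  \<comment> \<open>The second difference is \<open>\<phi> h - \<phi> 0\<close>. The term
    \<open>0 *\<^sub>R v\<close> gives both summands the form treated by \<open>aux\<close>.\<close>
  define \<phi> where "\<phi> = (\<lambda>s. f (x + s *\<^sub>R u + h *\<^sub>R v) - f (x + s *\<^sub>R u + 0 *\<^sub>R v))"
  have "(\<phi> has_real_derivative (fd f (x + s *\<^sub>R u + h *\<^sub>R v) u - fd f (x + s *\<^sub>R u + 0 *\<^sub>R v) u)) (at s)"
    if "0 \<le> s" "s \<le> h" for s
  proof -
    have aux: "((\<lambda>s. f (x + s *\<^sub>R u + t *\<^sub>R v)) has_real_derivative fd f (x + s *\<^sub>R u + t *\<^sub>R v) u) (at s)"
      if "0 \<le> t" "t \<le> h" for t
    proof -
      note fd1 = fder[OF in_ball[OF \<open>0 \<le> s\<close> \<open>s \<le> h\<close> that]]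
      have "((\<lambda>s. x + s *\<^sub>R u + t *\<^sub>R v) has_derivative (\<lambda>k. k *\<^sub>R u)) (at s)"
        by (auto intro!: derivative_eq_intros)
      from has_derivative_compose[OF this fd1] show ?thesis
        by (simp add: has_field_derivative_def linear_scale[OF has_derivative_linear[OF fd1]] mult_commute_abs)
    qed
    show ?thesis unfolding \<phi>_def using h by (intro DERIV_diff aux) auto
  qed
  from MVT2[OF h(1) this] obtain s where s: "0 < s" "s < h"
    "\<phi> h - \<phi> 0 = (h - 0) * (fd f (x + s *\<^sub>R u + h *\<^sub>R v) u - fd f (x + s *\<^sub>R u + 0 *\<^sub>R v) u)" by blast
  have "((\<lambda>t. fd f (x + s *\<^sub>R u + t *\<^sub>R v) u) has_real_derivative
      fd (\<lambda>y. fd f y u) (x + s *\<^sub>R u + t *\<^sub>R v) v) (at t)" if "0 \<le> t" "t \<le> h" for t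
  proof -
    note fd1 = ffder[OF in_ball[OF less_imp_le[OF s(1)] less_imp_le[OF s(2)] that]]
    have "((\<lambda>t. x + s *\<^sub>R u + t *\<^sub>R v) has_derivative (\<lambda>k. k *\<^sub>R v)) (at t)"
      by (auto intro!: derivative_eq_intros)
    from has_derivative_compose[OF this fd1] show ?thesis
      by (simp add: has_field_derivative_def linear_scale[OF has_derivative_linear[OF fd1]] mult_commute_abs)
  qed
  from MVT2[OF h(1) this] obtain t where t: "0 < t" "t < h"
    "fd f (x + s *\<^sub>R u + h *\<^sub>R v) u - fd f (x + s *\<^sub>R u + 0 *\<^sub>R v) u
      = (h - 0) * fd (\<lambda>y. fd f y u) (x + s *\<^sub>R u + t *\<^sub>R v) v" by blast
  show thesis
    by (rule that[OF s(1,2) t(1,2)]) (use s(3) t(3) in \<open>simp add: \<phi>_def power2_eq_square\<close>)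
qed

text \<open>The second difference is symmetric in u and v, and h^2 times either mixed derivative at
  a point near x represents it. If the mixed derivatives differed at x, continuity would keep them
  apart nearby.\<close>

lemma fd_fd_symmetric_real:
  fixes f :: "'a::real_normed_vector \<Rightarrow> real"
  assumes "smooth_near f x"
  shows "fd (\<lambda>y. fd f y u) x v = fd (\<lambda>y. fd f y v) x u"
proof (rule ccontr)
  let ?p = "\<lambda>y. fd (\<lambda>y. fd f y u) y v" and ?q = "\<lambda>y. fd (\<lambda>y. fd f y v) y u"
  assume ne: "?p x \<noteq> ?q x"
  define e where "e = \<bar>?p x - ?q x\<bar> / 2"
  have e: "e > 0" using ne by (simp add: e_def)
  obtain r0 where r0: "r0 > 0" "\<And>y. y \<in> ball x r0 \<Longrightarrow> smooth_near f y"
    using smooth_near_eventually[OF assms] unfolding eventually_nhds_metric by (auto simp: dist_commute)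
  have cont: "isCont ?p x" "isCont ?q x"
    by (intro smooth_near_isCont smooth_near_fd assms)+
  obtain r1 where r1: "r1 > 0" "\<And>y. dist y x < r1 \<Longrightarrow> dist (?p y) (?p x) < e"
    using cont(1) e unfolding continuous_at_eps_delta by blast
  obtain r2 where r2: "r2 > 0" "\<And>y. dist y x < r2 \<Longrightarrow> dist (?q y) (?q x) < e"
    using cont(2) e unfolding continuous_at_eps_delta by blast
  define r where "r = min r0 (min r1 r2)"
  \<comment> \<open>The summand 1 keeps the denominator positive when both directions
    vanish.\<close>
  define h where "h = r / (2 * (norm u + norm v + 1))"
  have r: "r > 0" using r0 r1 r2 by (simp add: r_def)
  have h: "h > 0" using r by (auto simp: h_def intro!: divide_pos_pos add_nonneg_pos)
  have "h * (norm u + norm v) < h * (2 * (norm u + norm v + 1))"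
    using h norm_ge_zero[of u] norm_ge_zero[of v] by (intro mult_strict_left_mono) (simp_all add: add_nonneg_pos algebra_simps)
  also have "\<dots> = r" using norm_ge_zero[of u] norm_ge_zero[of v] by (simp add: h_def add_nonneg_eq_0_iff)
  finally have hr: "h * (norm u + norm v) < r" .
  have near: "dist (x + s *\<^sub>R a + t *\<^sub>R b) x < r"
    if "0 < s" "s < h" "0 < t" "t < h" "{a, b} = {u, v}" for s t a b
  proof -
    have "norm (s *\<^sub>R a + t *\<^sub>R b) \<le> s * norm a + t * norm b"
      using that by (intro norm_triangle_le) auto
    also have "\<dots> \<le> h * norm a + h * norm b"
      using that by (intro add_mono mult_right_mono) auto
    also have "\<dots> = h * (norm u + norm v)" using that(5) by (auto simp: doubleton_eq_iff algebra_simps)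
    finally show ?thesis using hr by (simp add: dist_norm add.assoc)
  qed
  have sm: "smooth_near f y" if "y \<in> ball x r" for y using r0(2) that by (simp add: r_def)
  obtain s t where st: "0 < s" "s < h" "0 < t" "t < h"
    "f (x + h *\<^sub>R u + h *\<^sub>R v) - f (x + h *\<^sub>R u) - f (x + h *\<^sub>R v) + f x = h\<^sup>2 * ?p (x + s *\<^sub>R u + t *\<^sub>R v)"
    using second_difference_mvt[OF sm h hr] by blast
  have hr': "h * (norm v + norm u) < r" using hr by (simp add: add.commute)
  obtain s' t' where st': "0 < s'" "s' < h" "0 < t'" "t' < h"
    "f (x + h *\<^sub>R v + h *\<^sub>R u) - f (x + h *\<^sub>R v) - f (x + h *\<^sub>R u) + f x = h\<^sup>2 * ?q (x + s' *\<^sub>R v + t' *\<^sub>R u)"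
    using second_difference_mvt[OF sm h hr'] by blast
  have "h\<^sup>2 * ?p (x + s *\<^sub>R u + t *\<^sub>R v) = h\<^sup>2 * ?q (x + s' *\<^sub>R v + t' *\<^sub>R u)"
    unfolding st(5)[symmetric] st'(5)[symmetric] by (simp add: algebra_simps)
  then have eq: "?p (x + s *\<^sub>R u + t *\<^sub>R v) = ?q (x + s' *\<^sub>R v + t' *\<^sub>R u)" using h by simp
  have "dist (?p (x + s *\<^sub>R u + t *\<^sub>R v)) (?p x) < e"
    using near[OF st(1-4)] by (intro r1(2)) (auto simp: r_def)
  moreover have "dist (?q (x + s' *\<^sub>R v + t' *\<^sub>R u)) (?q x) < e"
    using near[OF st'(1-4)] by (intro r2(2)) (auto simp: r_def)
  moreover have False if "\<bar>a - p\<bar> < \<bar>p - q\<bar> / 2" "\<bar>a - q\<bar> < \<bar>p - q\<bar> / 2" for a p q :: real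
    using that by (auto simp: abs_if split: if_splits)
  ultimately show False unfolding eq e_def dist_real_def by blast
qed

lemma fd_inner_left:
  assumes "smooth_near f y"
  shows "fd (\<lambda>y. f y \<bullet> w) y u = fd f y u \<bullet> w"
  using fd_eqI[OF has_derivative_inner_left[OF smooth_near_has_derivative[OF assms]], of w] by simp

lemma fd_cong_eventually:
  assumes "\<forall>\<^sub>F y in nhds x. f y = g y" shows "fd f x = fd g x"
  using assms fd_cong_open[of _ x f g] by (auto simp: eventually_nhds)

text \<open>Pairing with an arbitrary vector w reduces this to real-valued functions.\<close>

lemma fd_fd_symmetric:
  fixes f :: "'a::real_normed_vector \<Rightarrow> 'b::real_inner"
  assumes "smooth_near f x"
  shows "fd (\<lambda>y. fd f y u) x v = fd (\<lambda>y. fd f y v) x u"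
proof -
  have "fd (\<lambda>y. fd f y u) x v \<bullet> w = fd (\<lambda>y. fd f y v) x u \<bullet> w" for w
  proof -
    have *: "fd (\<lambda>y. fd (\<lambda>y. f y \<bullet> w) y a) x b = fd (\<lambda>y. fd f y a) x b \<bullet> w" for a b
    proof -
      have "fd (\<lambda>y. fd (\<lambda>y. f y \<bullet> w) y a) x = fd (\<lambda>y. fd f y a \<bullet> w) x"
        by (rule fd_cong_eventually, rule eventually_mono[OF smooth_near_eventually[OF assms]])
          (simp add: fd_inner_left)
      then show ?thesis by (simp add: fd_inner_left smooth_near_fd assms)
    qed
    show ?thesis
      using fd_fd_symmetric_real[of "\<lambda>y. f y \<bullet> w" x u v]
      by (simp add: * smooth_near_inner smooth_near_const assms)
  qed
  then have "\<forall>w. fd (\<lambda>y. fd f y u) x v \<bullet> w = fd (\<lambda>y. fd f y v) x u \<bullet> w" by blast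
  then show ?thesis by (rule vector_eq_rdot[THEN iffD1])
qed

section \<open>Smooth families of linear maps and smooth inverse functions\<close>

text \<open>Where r vanishes, continuity of q is enough for a product rule: the remainder
  \<open>r y *\<^sub>R (q y - q x)\<close> is of linear size times something tending to 0.\<close>

lemma has_derivative_scaleR_zero:
  assumes r: "(r has_derivative r') (at x)" "r x = 0" and q: "isCont q x"
  shows "((\<lambda>y. r y *\<^sub>R q y) has_derivative (\<lambda>v. r' v *\<^sub>R q x)) (at x)"
proof -
  have bl: "bounded_linear r'" by (rule has_derivative_bounded_linear[OF r(1)])
  obtain K where K: "K > 0" "\<And>v. norm (r' v) \<le> norm v * K"
    using bounded_linear.pos_bounded[OF bl] by blast
  have "((\<lambda>y. r y *\<^sub>R (q y - q x)) has_derivative (\<lambda>v. 0)) (at x)"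
    unfolding has_derivative_at_alt
  proof (intro conjI allI impI)
    fix e :: real assume e: "e > 0"
    obtain d1 where d1: "d1 > 0" "\<And>y. norm (y - x) < d1 \<Longrightarrow> norm (r y - r x - r' (y - x)) \<le> 1 * norm (y - x)"
      using r(1)[unfolded has_derivative_at_alt] zero_less_one by blast
    have "e / (K + 1) > 0" using e K(1) by simp
    then obtain d2 where d2: "d2 > 0" "\<And>y. dist y x < d2 \<Longrightarrow> dist (q y) (q x) < e / (K + 1)"
      using q[unfolded continuous_at_eps_delta] by blast
    show "\<exists>d>0. \<forall>y. norm (y - x) < d \<longrightarrow>
        norm (r y *\<^sub>R (q y - q x) - r x *\<^sub>R (q x - q x) - 0) \<le> e * norm (y - x)"
    proof (intro exI conjI allI impI)
      show "min d1 d2 > 0" using d1 d2 by simp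
      fix y assume y: "norm (y - x) < min d1 d2"
      have "norm (r y) \<le> norm (r y - r x - r' (y - x)) + norm (r' (y - x))"
        using norm_triangle_ineq[of "r y - r x - r' (y - x)" "r' (y - x)"] r(2) by simp
      also have "\<dots> \<le> norm (y - x) * (K + 1)"
        using d1(2)[of y] K(2)[of "y - x"] y by (simp add: algebra_simps)
      finally have "norm (r y) \<le> norm (y - x) * (K + 1)" .
      moreover have "norm (q y - q x) \<le> e / (K + 1)"
        using d2(2)[of y] y by (simp add: dist_norm)
      ultimately have "norm (r y) * norm (q y - q x) \<le> (norm (y - x) * (K + 1)) * (e / (K + 1))"
        by (intro mult_mono) (use K in auto)
      also have "\<dots> = e * norm (y - x)" using K(1) by (simp add: divide_simps)
      finally show "norm (r y *\<^sub>R (q y - q x) - r x *\<^sub>R (q x - q x) - 0) \<le> e * norm (y - x)" by simp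
    qed
  qed simp
  from has_derivative_add[OF has_derivative_scaleR_left[OF r(1)] this, of "q x"]
  show ?thesis by (simp flip: scaleR_add_right)
qed

text \<open>Everything rests on the identity S_y w - S_x w = S_y ((T_x - T_y) S_x w) for the
  inverses S. It yields continuity, then differentiability, and the derivative is again an
  expression in S and the derivatives of T, so the order can be raised by induction.\<close>

lemma smooth_on_inverse_family:
  fixes T :: "'x::real_normed_vector \<Rightarrow> 'e::euclidean_space \<Rightarrow> 'e"
  assumes S: "open S" and lin: "\<And>y. y \<in> S \<Longrightarrow> linear (T y)" and inj: "\<And>y. y \<in> S \<Longrightarrow> inj (T y)"
    and sm: "\<And>w. smooth_on S (\<lambda>y. T y w)"
  shows "smooth_on S (\<lambda>y. inv (T y) w)"
proof -
  have surj: "surj (T y)" if "y \<in> S" for y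
    using lin[OF that] inj[OF that] by (rule linear_inj_imp_surj)
  have Tinv: "T y (inv (T y) w) = w" "inv (T y) (T y w) = w" if "y \<in> S" for y w
    using inj[OF that] surj[OF that] by (simp_all add: surj_f_inv_f)
  have linv: "linear (inv (T y))" if "y \<in> S" for y
    using lin[OF that] inj[OF that] surj[OF that] by (simp add: bij_def inj_linear_imp_inv_linear)
  have snear: "smooth_near (\<lambda>y. T y w) y" if "y \<in> S" for y w
    using sm S that by (rule smooth_nearI)
  have cont: "isCont (\<lambda>y. inv (T y) w) x" if x: "x \<in> S" for x w
  proof -
    obtain c where c: "c > 0" "\<And>u. c * norm u \<le> norm (T x u)"
      using linear_inj_bounded_below_pos[OF lin[OF x] inj[OF x]] by blast
    have "((\<lambda>y. \<Sum>b\<in>Basis. norm (T y b - T x b)) \<longlongrightarrow> (\<Sum>b\<in>Basis. norm (T x b - T x b))) (nhds x)"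
      by (intro tendsto_intros isCont_tendsto_nhds smooth_near_isCont[OF snear[OF x]])
    \<comment> \<open>Perturbing \<open>T x\<close> by at most c / 2 leaves half of its lower bound
      c, which controls the inverses uniformly near x.\<close>
    then have "\<forall>\<^sub>F y in nhds x. (\<Sum>b\<in>Basis. norm (T y b - T x b)) < c / 2"
      using c(1) by (intro order_tendstoD(2)) auto
    moreover have "\<forall>\<^sub>F y in nhds x. y \<in> S" using S x by (rule eventually_nhds_in_open)
    ultimately have ev: "\<forall>\<^sub>F y in nhds x. norm (inv (T y) w - inv (T x) w)
        \<le> 2 / c * norm (T x (inv (T x) w) - T y (inv (T x) w))"
    proof eventually_elim
      case (elim y)
      let ?a = "inv (T x) w"
      let ?u = "inv (T y) w - ?a"
      have u: "?u = inv (T y) (T x ?a - T y ?a)"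
        using elim(2) by (simp add: linear_diff[OF linv] Tinv x)
      have "norm (T y ?u - T x ?u) = norm (\<Sum>b\<in>Basis. (?u \<bullet> b) *\<^sub>R (T y b - T x b))"
        using frame_expand[OF frame_Basis linear_compose_sub[OF lin[OF elim(2)] lin[OF x]], of ?u] by simp
      also have "\<dots> \<le> (\<Sum>b\<in>Basis. norm ?u * norm (T y b - T x b))"
        by (rule order_trans[OF norm_sum], rule sum_mono)
           (simp add: mult_right_mono Basis_le_norm)
      also have "\<dots> \<le> norm ?u * (c / 2)"
        unfolding sum_distrib_left[symmetric] using elim(1) by (intro mult_left_mono) auto
      finally have "c * norm ?u \<le> norm (T y ?u) + norm ?u * (c / 2)"
        using c(2)[of ?u] norm_triangle_ineq2[of "T x ?u" "T y ?u"] by (simp add: norm_minus_commute)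
      moreover have "T y ?u = T x ?a - T y ?a" unfolding u using elim(2) by (simp add: Tinv)
      ultimately show ?case using c(1) by (simp add: field_simps)
    qed
    have "((\<lambda>y. 2 / c * norm (T x (inv (T x) w) - T y (inv (T x) w))) \<longlongrightarrow>
        2 / c * norm (T x (inv (T x) w) - T x (inv (T x) w))) (nhds x)"
      by (intro tendsto_intros isCont_tendsto_nhds smooth_near_isCont[OF snear[OF x]])
    then have "((\<lambda>y. norm (inv (T y) w - inv (T x) w)) \<longlongrightarrow> 0) (nhds x)"
      by (intro tendsto_sandwich[OF _ ev tendsto_const]) auto
    then have "((\<lambda>y. norm (inv (T y) w - inv (T x) w)) \<longlongrightarrow> 0) (at x)"
      by (rule tendsto_mono[rotated]) (simp add: at_within_def)
    then have "((\<lambda>y. inv (T y) w - inv (T x) w) \<longlongrightarrow> 0) (at x)"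
      by (rule tendsto_norm_zero_cancel)
    then show ?thesis unfolding isCont_def by (rule LIM_zero_cancel)
  qed
  \<comment> \<open>The familiar derivative -S (dT) S of an inverse S, written out in a
    basis.\<close>
  let ?D = "\<lambda>w x v. - (\<Sum>b\<in>Basis. (fd (\<lambda>y. T y (inv (T x) w)) x v \<bullet> b) *\<^sub>R inv (T x) b)"
  have der: "((\<lambda>y. inv (T y) w) has_derivative ?D w x) (at x)" if x: "x \<in> S" for x w
  proof -
    let ?a = "inv (T x) w"
    \<comment> \<open>The identity above in coordinates: all coefficients vanish at x, so continuity
      of the inverses suffices to differentiate.\<close>
    have "((\<lambda>y. ?a - (\<Sum>b\<in>Basis. ((T y ?a - T x ?a) \<bullet> b) *\<^sub>R inv (T y) b)) has_derivative
        (\<lambda>v. 0 - (\<Sum>b\<in>Basis. ((fd (\<lambda>y. T y ?a) x v - 0) \<bullet> b) *\<^sub>R inv (T x) b))) (at x)"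
      by (intro has_derivative_diff has_derivative_sum has_derivative_const has_derivative_scaleR_zero
          has_derivative_inner_left smooth_near_has_derivative snear x cont) simp
    then have "((\<lambda>y. ?a - (\<Sum>b\<in>Basis. ((T y ?a - T x ?a) \<bullet> b) *\<^sub>R inv (T y) b)) has_derivative ?D w x) (at x)"
      by simp
    moreover have "?a - (\<Sum>b\<in>Basis. ((T y ?a - T x ?a) \<bullet> b) *\<^sub>R inv (T y) b) = inv (T y) w" if "y \<in> S" for y
      unfolding frame_expand[OF frame_Basis linv[OF that], symmetric]
      using that x by (simp add: linear_diff[OF linv] Tinv)
    ultimately show ?thesis by (rule has_derivative_transform_within_open[OF _ S x])
  qed
  have "C_on k S (\<lambda>y. inv (T y) w)" for k
  proof (induction k arbitrary: w)
    case 0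
    then show ?case using cont by (simp add: continuous_at_imp_continuous_on)
  next
    case (Suc k)
    show ?case
    proof (rule C_on_SucI[OF S der])
      fix v
      have fdT: "C_on k S (\<lambda>x. fd (\<lambda>y. T y c) x v)" for c
        using sm[of c] unfolding smooth_on_def by (metis C_on.simps(2))
      \<comment> \<open>The argument \<open>inv (T x) w\<close> of T varies with x as well;
        expanding it over c leaves only derivatives of T at fixed arguments.\<close>
      have "C_on k S (\<lambda>x. - (\<Sum>b\<in>Basis. \<Sum>c\<in>Basis. ((inv (T x) w \<bullet> c) * (fd (\<lambda>y. T y c) x v \<bullet> b)) *\<^sub>R inv (T x) b))"
        by (intro C_on_linear[OF S bounded_linear_minus[OF bounded_linear_ident]] C_on_sum[OF S]
            C_on_bilinear[OF S bounded_bilinear_scaleR] C_on_bilinear[OF S bounded_bilinear_mult]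
            C_on_linear[OF S bounded_linear_inner_left] fdT Suc.IH)
      moreover have "fd (\<lambda>y. T y a) x v = (\<Sum>c\<in>Basis. (a \<bullet> c) *\<^sub>R fd (\<lambda>y. T y c) x v)" if x: "x \<in> S" for x a
      proof -
        have "((\<lambda>y. \<Sum>c\<in>Basis. (a \<bullet> c) *\<^sub>R T y c) has_derivative
            (\<lambda>v. \<Sum>c\<in>Basis. (a \<bullet> c) *\<^sub>R fd (\<lambda>y. T y c) x v)) (at x)"
          by (intro has_derivative_sum has_derivative_scaleR_right smooth_near_has_derivative snear x)
        from has_derivative_transform_within_open[OF this S x, of "\<lambda>y. T y a"]
        show ?thesis using fd_eqI frame_expand[OF frame_Basis lin] by fastforce
      qed
      ultimately show "C_on k S (\<lambda>x. ?D w x v)"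
        by (elim C_on_cong[OF S, rotated]) (simp add: inner_sum_left scaleR_sum_left)
    qed
  qed
  then show ?thesis by (simp add: smooth_on_def)
qed

text \<open>The classical inverse function theorem gives one derivative of G, namely the inverse of
  dF at G. If G has order k, so has this expression, hence G has order k + 1. An identity
  differential at \<open>x0\<close> is enough, since the map straightening a level set is built that
  way.\<close>

lemma smooth_inverse_function:
  fixes F :: "'e::euclidean_space \<Rightarrow> 'e"
  assumes U: "open U" "smooth_on U F" "x0 \<in> U" and id: "fd F x0 = (\<lambda>v. v)"
  obtains U' V G where "open U'" "U' \<subseteq> U" "x0 \<in> U'" "open V" "F x0 \<in> V"
    "homeomorphism U' V F G" "smooth_on V G"
    "\<And>x. x \<in> U' \<Longrightarrow> bij (fd F x)"
proof -
  have near: "smooth_near F x" if "x \<in> U" for x using U that by (intro smooth_nearI)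
  have bl: "bounded_linear (fd F x)" if "x \<in> U" for x
    using smooth_near_linear_fd[OF near[OF that]] by (simp add: linear_conv_bounded_linear)
  have ap: "blinfun_apply (Blinfun (fd F x)) = fd F x" if "x \<in> U" for x
    using bl[OF that] by (rule bounded_linear_Blinfun_apply)
  have der: "(F has_derivative blinfun_apply (Blinfun (fd F x))) (at x)" if "x \<in> U" for x
    using smooth_near_has_derivative[OF near[OF that]] ap[OF that] by simp
  have cont: "continuous_on U (\<lambda>x. Blinfun (fd F x))"
  proof (rule continuous_on_blinfun_componentwise)
    fix i :: 'e
    have "continuous_on U (\<lambda>x. fd F x i)"
      using near by (intro continuous_at_imp_continuous_on ballI smooth_near_isCont smooth_near_fd)
    then show "continuous_on U (\<lambda>x. blinfun_apply (Blinfun (fd F x)) i)"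
      by (rule continuous_on_cong[THEN iffD1, rotated 2]) (simp_all add: ap)
  qed
  have "id_blinfun o\<^sub>L Blinfun (fd F x0) = id_blinfun"
    by (rule blinfun_eqI) (simp add: ap U(3), simp add: id)
  from inverse_function_theorem[OF U(1) der cont U(3) this]
  obtain U' V G G' where *: "open U'" "U' \<subseteq> U" "x0 \<in> U'" "open V" "F x0 \<in> V" "homeomorphism U' V F G"
    "\<And>y. y \<in> V \<Longrightarrow> (G has_derivative (G' y)) (at y)"
    "\<And>y. y \<in> V \<Longrightarrow> G' y = inv (blinfun_apply (Blinfun (fd F (G y))))"
    "\<And>y. y \<in> V \<Longrightarrow> bij (blinfun_apply (Blinfun (fd F (G y))))" by blast
  have GV: "G y \<in> U'" if "y \<in> V" for y using *(6) that by (auto simp: homeomorphism_def)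
  have Gder: "(G has_derivative inv (fd F (G y))) (at y)" if "y \<in> V" for y
    using *(7)[OF that] *(8)[OF that] ap[of "G y"] GV[OF that] *(2) by auto
  have bij: "bij (fd F x)" if "x \<in> U'" for x
    using *(9)[of "F x"] *(6) that ap[of x] *(2) by (auto simp: homeomorphism_def)
  have sminv: "smooth_on U' (\<lambda>x. inv (fd F x) v)" for v
  proof (rule smooth_on_inverse_family[OF *(1)])
    show "smooth_on U' (\<lambda>y. fd F y w)" for w
      using near *(2) by (intro smooth_onI_near smooth_near_fd) auto
    show "linear (fd F y)" if "y \<in> U'" for y
      using near *(2) that by (intro smooth_near_linear_fd) auto
  qed (use bij in \<open>auto simp: bij_def\<close>)
  have "C_on k V G" for k
  proof (induction k)
    case 0 show ?case using *(6) by (simp add: homeomorphism_def)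
  next
    case (Suc k)
    show ?case
    proof (rule C_on_SucI[OF *(4) Gder])
      show "C_on k V (\<lambda>y. inv (fd F (G y)) v)" for v
        by (rule C_on_compose[OF frame_Basis *(4) *(1) _ Suc, of "\<lambda>x. inv (fd F x) v"])
          (use sminv GV in \<open>auto simp: smooth_on_def\<close>)
    qed
  qed
  then show thesis using that[OF *(1-6) _ bij] by (simp add: smooth_on_def)
qed

section \<open>Local uniqueness for autonomous differential equations\<close>

text \<open>The sum N bounds the operator norm of the differential through a frame and is
  continuous, hence below \<open>N z + 1\<close> on a ball, which is convex.\<close>

lemma smooth_near_lipschitz:
  fixes H :: "'a::real_inner \<Rightarrow> 'b::real_normed_vector"
  assumes B: "frame (B :: 'a set)" and H: "smooth_near H z"
  obtains L r where "r > 0" "\<And>a b. a \<in> ball z r \<Longrightarrow> b \<in> ball z r \<Longrightarrow> norm (H a - H b) \<le> L * norm (a - b)"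
proof -
  define N where "N = (\<lambda>y. \<Sum>b\<in>B. norm b * norm (fd H y b))"
  have "(N \<longlongrightarrow> N z) (nhds z)"
    unfolding N_def by (intro tendsto_intros isCont_tendsto_nhds smooth_near_isCont[OF smooth_near_fd[OF H]])
  then have "\<forall>\<^sub>F y in nhds z. N y < N z + 1" by (rule order_tendstoD) simp
  with smooth_near_eventually[OF H] have "\<forall>\<^sub>F y in nhds z. smooth_near H y \<and> N y < N z + 1"
    by (rule eventually_conj)
  then obtain r where r: "r > 0" "\<And>y. dist y z < r \<Longrightarrow> smooth_near H y \<and> N y < N z + 1"
    unfolding eventually_nhds_metric by blast
  have "norm (H a - H b) \<le> (N z + 1) * norm (a - b)" if "a \<in> ball z r" "b \<in> ball z r" for a b
  proof (rule differentiable_bound[OF convex_ball _ _ that])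
    fix y assume y: "y \<in> ball z r"
    then have y': "smooth_near H y" "N y < N z + 1" using r(2)[of y] by (auto simp: dist_commute)
    show "(H has_derivative fd H y) (at y within ball z r)"
      using smooth_near_has_derivative[OF y'(1)] by (rule has_derivative_at_withinI)
    have "norm (fd H y v) \<le> (N z + 1) * norm v" for v
    proof -
      have "norm (fd H y v) \<le> (\<Sum>b\<in>B. norm ((v \<bullet> b) *\<^sub>R fd H y b))"
        by (subst frame_expand[OF B smooth_near_linear_fd[OF y'(1)], of v]) (rule norm_sum)
      also have "\<dots> \<le> (\<Sum>b\<in>B. norm v * (norm b * norm (fd H y b)))"
        by (rule sum_mono) (simp add: mult.assoc[symmetric] mult_right_mono Cauchy_Schwarz_ineq2)
      also have "\<dots> = N y * norm v" by (simp add: N_def sum_distrib_left[symmetric] mult.commute)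
      also have "\<dots> \<le> (N z + 1) * norm v" using y'(2) by (intro mult_right_mono) auto
      finally show ?thesis .
    qed
    moreover have "N z \<ge> 0" by (simp add: N_def sum_nonneg)
    ultimately show "onorm (fd H y) \<le> N z + 1" by (intro onorm_bound) auto
  qed
  then show thesis using that r(1) by blast
qed

text \<open>On an interval of radius \<delta> with K \<delta> \<le> 1/2, the largest distance
  between the solutions is at most half of itself, hence 0.\<close>

lemma ode_unique_local:
  fixes z1 z2 :: "real \<Rightarrow> 'a::real_inner"
  assumes B: "frame (B :: 'a set)" and H: "smooth_near H (z1 t0)" and eq: "z1 t0 = z2 t0"
    and z1: "\<forall>\<^sub>F t in nhds t0. (z1 has_vector_derivative H (z1 t)) (at t)"
    and z2: "\<forall>\<^sub>F t in nhds t0. (z2 has_vector_derivative H (z2 t)) (at t)"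
  shows "\<forall>\<^sub>F t in nhds t0. z1 t = z2 t"
proof -
  obtain L r where Lr: "r > 0" "\<And>a b. a \<in> ball (z1 t0) r \<Longrightarrow> b \<in> ball (z1 t0) r \<Longrightarrow> norm (H a - H b) \<le> L * norm (a - b)"
    by (rule smooth_near_lipschitz[OF B H]) blast
  have cont: "isCont z1 t0" "isCont z2 t0"
    using eventually_nhds_x_imp_x[OF z1] eventually_nhds_x_imp_x[OF z2]
    by (auto dest: has_vector_derivative_continuous)
  have near: "\<forall>\<^sub>F t in nhds t0. z t \<in> ball (z1 t0) r" if "isCont z t0" "z t0 = z1 t0" for z
  proof -
    have "(z \<longlongrightarrow> z1 t0) (nhds t0)" using isCont_tendsto_nhds[OF that(1)] that(2) by simp
    then show ?thesis by (rule topological_tendstoD) (use Lr in auto)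
  qed
  have "\<forall>\<^sub>F t in nhds t0. z1 t \<in> ball (z1 t0) r \<and> z2 t \<in> ball (z1 t0) r \<and>
     (z1 has_vector_derivative H (z1 t)) (at t) \<and> (z2 has_vector_derivative H (z2 t)) (at t)"
    using near[OF cont(1)] near[OF cont(2)] z1 z2 eq by (auto intro!: eventually_conj)
  then obtain d where d: "d > 0" "\<And>t. dist t t0 < d \<Longrightarrow> z1 t \<in> ball (z1 t0) r \<and> z2 t \<in> ball (z1 t0) r \<and>
     (z1 has_vector_derivative H (z1 t)) (at t) \<and> (z2 has_vector_derivative H (z2 t)) (at t)"
    unfolding eventually_nhds_metric by blast
  \<comment> \<open>L is not known to be positive; the maximum with 1 allows division by K.\<close>
  define K where "K = max L 1"
  define \<delta> where "\<delta> = min (d / 2) (1 / (2 * K))"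
  have K: "K \<ge> 1" by (simp add: K_def)
  have \<delta>: "\<delta> > 0" "\<delta> < d" "K * \<delta> \<le> 1 / 2"
    using d(1) K by (auto simp: \<delta>_def min_def field_simps)
  let ?I = "{t0 - \<delta>..t0 + \<delta>}"
  define u where "u = (\<lambda>t. z1 t - z2 t)"
  have inI: "dist t t0 < d" if "t \<in> ?I" for t using that \<delta> by (auto simp: dist_real_def)
  have uder: "(u has_vector_derivative (H (z1 t) - H (z2 t))) (at t)" if "t \<in> ?I" for t
    unfolding u_def using d(2)[OF inI[OF that]] by (intro has_vector_derivative_diff) auto
  have "continuous_on ?I (\<lambda>t. norm (u t))"
    by (intro continuous_on_norm continuous_at_imp_continuous_on ballI)
      (use uder has_vector_derivative_continuous in blast)
  moreover have "?I \<noteq> {}" using \<delta> by simp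
  ultimately obtain s where s: "s \<in> ?I" "\<And>t. t \<in> ?I \<Longrightarrow> norm (u t) \<le> norm (u s)"
    using continuous_attains_sup[of ?I "\<lambda>t. norm (u t)"] by blast
  have "norm (u s - u t0) \<le> (K * norm (u s)) * norm (s - t0)"
  proof (rule differentiable_bound[of ?I u "\<lambda>t h. h *\<^sub>R (H (z1 t) - H (z2 t))"])
    fix t assume t: "t \<in> ?I"
    show "(u has_derivative (\<lambda>h. h *\<^sub>R (H (z1 t) - H (z2 t)))) (at t within ?I)"
      using uder[OF t] unfolding has_vector_derivative_def by (rule has_derivative_at_withinI)
    have "norm (H (z1 t) - H (z2 t)) \<le> L * norm (u t)"
      unfolding u_def using d(2)[OF inI[OF t]] by (intro Lr) auto
    also have "\<dots> \<le> K * norm (u s)" using s(2)[OF t] K by (intro mult_mono) (auto simp: K_def)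
    finally show "onorm (\<lambda>h. h *\<^sub>R (H (z1 t) - H (z2 t))) \<le> K * norm (u s)"
      using K by (intro onorm_bound)
        (auto simp: mult.commute[of "K * norm (u s)"] intro: mult_left_mono)
  qed (use s \<delta> in auto)
  also have "\<dots> \<le> (K * norm (u s)) * \<delta>"
    using s(1) K by (intro mult_left_mono) auto
  also have "\<dots> = (K * \<delta>) * norm (u s)" by simp
  also have "\<dots> \<le> 1 / 2 * norm (u s)" using \<delta>(3) by (intro mult_right_mono) auto
  finally have "norm (u s) \<le> 1 / 2 * norm (u s)" using eq by (simp add: u_def)
  then have "norm (u s) = 0" using norm_ge_zero[of "u s"] by linarith
  then have "z1 t = z2 t" if "t \<in> ?I" for t using s(2)[OF that] by (simp add: u_def)
  moreover have "\<forall>\<^sub>F t in nhds t0. t \<in> {t0 - \<delta><..<t0 + \<delta>}" using \<delta> by (intro eventually_nhds_in_open) auto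
  ultimately show ?thesis by (auto elim!: eventually_mono)
qed

section \<open>Metrics in coordinates\<close>

definition metric_on :: "'e::real_inner set \<Rightarrow> ('e \<Rightarrow> 'e \<Rightarrow> 'e \<Rightarrow> real) \<Rightarrow> bool" where
  "metric_on S G \<longleftrightarrow> open S \<and> (\<forall>u v. smooth_on S (\<lambda>y. G y u v)) \<and>
     (\<forall>y\<in>S. bilinear (G y) \<and> (\<forall>u v. G y u v = G y v u) \<and> (\<forall>u. (\<forall>v. G y u v = 0) \<longrightarrow> u = 0))"

definition christoffel_of :: "('e::real_normed_vector \<Rightarrow> 'e \<Rightarrow> 'e \<Rightarrow> real) \<Rightarrow> 'e \<Rightarrow> 'e \<Rightarrow> 'e \<Rightarrow> 'e" where
  "christoffel_of G x u v = (THE z. \<forall>w. 2 * G x z w =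
     fd (\<lambda>y. G y v w) x u + fd (\<lambda>y. G y u w) x v - fd (\<lambda>y. G y u v) x w)"

lemma christoffel_eq_of: "christoffel \<A> g c = christoffel_of (local_metric \<A> g c)"
  by (simp add: fun_eq_iff christoffel_def christoffel_of_def)

text \<open>Twice the Euler-Lagrange expression of the energy functional, paired with \<open>w\<close>, at a curve with
  position \<open>x\<close>, velocity \<open>v\<close> and acceleration \<open>a\<close>. Unlike the Christoffel symbols, it is natural
  under arbitrary smooth maps.\<close>

definition EL :: "('e::real_normed_vector \<Rightarrow> 'e \<Rightarrow> 'e \<Rightarrow> real) \<Rightarrow> 'e \<Rightarrow> 'e \<Rightarrow> 'e \<Rightarrow> 'e \<Rightarrow> real" where
  "EL G x v a w = 2 * G x a w + 2 * fd (\<lambda>y. G y v w) x v - fd (\<lambda>y. G y v v) x w"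

lemma metric_onD:
  assumes "metric_on S G" "x \<in> S"
  shows "bilinear (G x)" "\<And>u v. G x u v = G x v u" "\<And>u. (\<And>v. G x u v = 0) \<Longrightarrow> u = 0"
    "\<And>u v. smooth_near (\<lambda>y. G y u v) x"
proof -
  have *: "bilinear (G x) \<and> (\<forall>u v. G x u v = G x v u) \<and> (\<forall>u. (\<forall>v. G x u v = 0) \<longrightarrow> u = 0)"
    using assms unfolding metric_on_def by blast
  show "bilinear (G x)" "\<And>u v. G x u v = G x v u" "\<And>u. (\<And>v. G x u v = 0) \<Longrightarrow> u = 0"
    using * by auto
  show "smooth_near (\<lambda>y. G y u v) x" for u v
    using assms unfolding metric_on_def by (intro smooth_nearI[of S]) auto
qed

section \<open>Counting dimensions and representing bilinear forms\<close>

text \<open>By the exchange bound, a vector outside the span would give an independent set larger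
  than T. Working in \<open>real_vector\<close> covers the model space of the level set.\<close>

lemma independent_card_span:
  fixes S T :: "'a::real_vector set"
  assumes "finite T" "span T = UNIV" "independent S" "card T \<le> card S"
  shows "span S = UNIV"
proof (rule ccontr)
  assume "span S \<noteq> UNIV"
  then obtain x where x: "x \<notin> span S" by auto
  have S: "finite S" "card S \<le> card T"
    using independent_span_bound[of T S] assms by auto
  have "independent (insert x S)" using x assms(3) by (simp add: independent_insert)
  then have "card (insert x S) \<le> card T"
    using independent_span_bound[of T "insert x S"] assms by auto
  moreover have "x \<notin> S" using x span_base by blast
  ultimately show False using S assms(4) by simp
qed

lemma frame_span:
  assumes "frame B" shows "span B = UNIV"
proof -
  have "x \<in> span B" for x
  proof -
    have "(\<Sum>b\<in>B. (x \<bullet> b) *\<^sub>R b) \<in> span B" by (intro span_sum span_scale span_base)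
    then show ?thesis using assms by (simp add: frame_def)
  qed
  then show ?thesis by auto
qed

text \<open>An injective map carries the independent set I to one with at least as many elements as
  the spanning set T.\<close>

lemma linear_injective_card_surj:
  fixes L :: "'a::real_vector \<Rightarrow> 'b::real_vector" and I :: "'a set" and T :: "'b set"
  assumes L: "linear L" "inj L" and I: "independent I" and T: "finite T" "span T = UNIV" "card T \<le> card I"
  shows "surj L"
proof -
  have "independent (L ` I)"
    using I L by (simp add: linear_independent_injective_image inj_on_subset)
  moreover have "card (L ` I) = card I" using L(2) by (simp add: card_image inj_on_subset)
  ultimately have "span (L ` I) = UNIV" using T by (metis independent_card_span)
  then have "L ` span I = UNIV" using linear_span_image[OF L(1)] by metis
  then show ?thesis by auto
qed

lemma frame_injective_surj:
  fixes L :: "'a::real_inner \<Rightarrow> 'a"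
  assumes B: "frame (B :: 'a set)" and L: "linear L" "inj L"
  shows "surj L"
proof -
  obtain I where I: "I \<subseteq> B" "independent I" "B \<subseteq> span I"
    using maximal_independent_subset[of B] by blast
  have "finite I" using I B finite_subset by (auto simp: frame_def)
  moreover have "span I = UNIV" using I(3) frame_span[OF B] by (metis span_mono span_span top.extremum_uniqueI)
  ultimately show ?thesis using linear_injective_card_surj[OF L I(2), of I] by simp
qed

text \<open>Riesz representation of a linear functional by means of a frame.\<close>

lemma frame_inner: "frame B \<Longrightarrow> linear K \<Longrightarrow> (\<Sum>b\<in>B. K b *\<^sub>R b) \<bullet> w = (K w :: real)"
  using frame_expand[of B K w] by (simp add: inner_sum_left inner_commute[of w] mult.commute)

lemma bilinear_linear:
  "bilinear G \<Longrightarrow> linear (G u)" "bilinear G \<Longrightarrow> linear (\<lambda>u. G u v)"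
  by (auto simp: bilinear_def)

text \<open>The endomorphism that represents the form \<open>G y\<close> with respect to the inner
  product. Its injectivity is the nondegeneracy of the form, and its inverse raises indices.\<close>

definition gram :: "'e::real_inner set \<Rightarrow> ('e \<Rightarrow> 'e \<Rightarrow> 'e \<Rightarrow> real) \<Rightarrow> 'e \<Rightarrow> 'e \<Rightarrow> 'e" where
  "gram B G y z = (\<Sum>b\<in>B. G y z b *\<^sub>R b)"

lemma gram:
  fixes B :: "'e::real_inner set" and G :: "'e \<Rightarrow> 'e \<Rightarrow> 'e \<Rightarrow> real"
  assumes B: "frame B" and G: "metric_on S G" and y: "y \<in> S"
  shows "gram B G y z \<bullet> w = G y z w" "linear (gram B G y)" "inj (gram B G y)" "surj (gram B G y)"
proof -
  note m = metric_onD[OF G y]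
  show 1: "gram B G y z \<bullet> w = G y z w" for z w
    unfolding gram_def by (rule frame_inner[OF B bilinear_linear(1)[OF m(1)]])
  show 2: "linear (gram B G y)"
    by (rule linearI)
      (simp_all add: gram_def bilinear_ladd[OF m(1)] bilinear_lmul[OF m(1)] scaleR_add_left sum.distrib scaleR_sum_right)
  show "inj (gram B G y)"
    unfolding linear_injective_0[OF 2] using m(3) 1 by (metis inner_zero_left)
  then show "surj (gram B G y)" using 2 B by (intro frame_injective_surj)
qed

section \<open>Christoffel symbols and the geodesic equation in coordinates\<close>

lemma fd_metric_linear:
  fixes G :: "'e::real_inner \<Rightarrow> 'e \<Rightarrow> 'e \<Rightarrow> real"
  assumes G: "metric_on S G" and x: "x \<in> S"
  shows "linear (\<lambda>w. fd (\<lambda>y. G y v w) x u)" "linear (\<lambda>u. fd (\<lambda>y. G y v w) x u)"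
    "fd (\<lambda>y. G y v w) x u = fd (\<lambda>y. G y w v) x u"
proof -
  note m = metric_onD[OF G]
  have S: "open S" using G by (simp add: metric_on_def)
  have der: "((\<lambda>y. G y v w) has_derivative fd (\<lambda>y. G y v w) x) (at x)" for v w
    using m(4)[OF x] by (rule smooth_near_has_derivative)
  show "linear (\<lambda>w. fd (\<lambda>y. G y v w) x u)"
  proof (rule linearI)
    fix w w' :: 'e and r :: real
    have "fd (\<lambda>y. G y v (w + w')) x = fd (\<lambda>y. G y v w + G y v w') x"
      by (rule fd_cong_open[OF S x]) (simp add: bilinear_radd[OF m(1)])
    then show "fd (\<lambda>y. G y v (w + w')) x u = fd (\<lambda>y. G y v w) x u + fd (\<lambda>y. G y v w') x u"
      using fd_eqI[OF has_derivative_add[OF der der]] by simp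
    have "fd (\<lambda>y. G y v (r *\<^sub>R w)) x = fd (\<lambda>y. r *\<^sub>R G y v w) x"
      by (rule fd_cong_open[OF S x]) (simp add: bilinear_rmul[OF m(1)])
    then show "fd (\<lambda>y. G y v (r *\<^sub>R w)) x u = r *\<^sub>R fd (\<lambda>y. G y v w) x u"
      using fd_eqI[OF has_derivative_scaleR_right[OF der]] by simp
  qed
  show "linear (\<lambda>u. fd (\<lambda>y. G y v w) x u)"
    using smooth_near_linear_fd[OF m(4)[OF x, of v w]] by simp
  show "fd (\<lambda>y. G y v w) x u = fd (\<lambda>y. G y w v) x u"
    using fd_cong_open[OF S x, of "\<lambda>y. G y v w" "\<lambda>y. G y w v"] m(2) by metis
qed

text \<open>The Christoffel symbols of the first kind.\<close>

definition koszul :: "('e::real_normed_vector \<Rightarrow> 'e \<Rightarrow> 'e \<Rightarrow> real) \<Rightarrow> 'e \<Rightarrow> 'e \<Rightarrow> 'e \<Rightarrow> 'e \<Rightarrow> real" where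
  "koszul G x u v w = (1 / 2) * (fd (\<lambda>y. G y v w) x u + fd (\<lambda>y. G y u w) x v - fd (\<lambda>y. G y u v) x w)"

lemma koszul_linear:
  fixes G :: "'e::real_inner \<Rightarrow> 'e \<Rightarrow> 'e \<Rightarrow> real"
  assumes G: "metric_on S G" and x: "x \<in> S"
  shows "linear (koszul G x u v)" "linear (\<lambda>u. koszul G x u v w)" "linear (\<lambda>v. koszul G x u v w)"
proof -
  note l = fd_metric_linear[OF G x]
  have l': "linear (\<lambda>u. fd (\<lambda>y. G y u v) x w)" for v w
    using l(1)[of v w] by (simp add: l(3)[of _ v])
  show "linear (koszul G x u v)"
    unfolding koszul_def real_scaleR_def[symmetric]
    by (intro linear_compose_sub linear_compose_add linear_compose_scale_right l l')
  show "linear (\<lambda>u. koszul G x u v w)"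
    unfolding koszul_def real_scaleR_def[symmetric]
    by (intro linear_compose_sub linear_compose_add linear_compose_scale_right l l')
  show "linear (\<lambda>v. koszul G x u v w)"
    unfolding koszul_def real_scaleR_def[symmetric]
    by (intro linear_compose_sub linear_compose_add linear_compose_scale_right l l')
qed

text \<open>The Koszul equation says that \<open>gram\<close> maps the unknown to the vector
  representing \<open>koszul\<close>. Bijectivity of \<open>gram\<close> therefore gives both
  existence and uniqueness for the definite description.\<close>

lemma christoffel_of_eq:
  fixes G :: "'e::real_inner \<Rightarrow> 'e \<Rightarrow> 'e \<Rightarrow> real"
  assumes B: "frame (B :: 'e set)" and G: "metric_on S G" and x: "x \<in> S"
  shows "christoffel_of G x u v = inv (gram B G x) (\<Sum>b\<in>B. koszul G x u v b *\<^sub>R b)"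
    and "G x (christoffel_of G x u v) w = koszul G x u v w"
proof -
  note g = gram[OF B G x]
  let ?k = "\<Sum>b\<in>B. koszul G x u v b *\<^sub>R b"
  have k: "?k \<bullet> w = koszul G x u v w" for w by (rule frame_inner[OF B koszul_linear(1)[OF G x]])
  have iff: "(\<forall>w. 2 * G x z w = fd (\<lambda>y. G y v w) x u + fd (\<lambda>y. G y u w) x v - fd (\<lambda>y. G y u v) x w)
      \<longleftrightarrow> gram B G x z = ?k" for z
  proof -
    have "(\<forall>w. 2 * G x z w = fd (\<lambda>y. G y v w) x u + fd (\<lambda>y. G y u w) x v - fd (\<lambda>y. G y u v) x w)
      \<longleftrightarrow> (\<forall>w. gram B G x z \<bullet> w = ?k \<bullet> w)"
      unfolding g(1) k unfolding koszul_def by (simp add: field_simps)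
    then show ?thesis using vector_eq_rdot by blast
  qed
  have *: "gram B G x z = ?k \<longleftrightarrow> z = inv (gram B G x) ?k" for z
  proof
    assume "gram B G x z = ?k"
    then show "z = inv (gram B G x) ?k" using inv_f_f[OF g(3), of z] by simp
  qed (simp add: surj_f_inv_f[OF g(4)])
  show 1: "christoffel_of G x u v = inv (gram B G x) ?k" unfolding christoffel_of_def iff * by simp
  show "G x (christoffel_of G x u v) w = koszul G x u v w"
    using g(1)[of "christoffel_of G x u v" w] * 1 k by metis
qed

text \<open>\<open>EL\<close> at w is twice the pairing of w with the left-hand side of the geodesic
  equation, so nondegeneracy makes the tested equation equivalent to the original one.\<close>

lemma geodesic_equation_iff_EL:
  fixes G :: "'e::real_inner \<Rightarrow> 'e \<Rightarrow> 'e \<Rightarrow> real"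
  assumes B: "frame (B :: 'e set)" and G: "metric_on S G" and x: "x \<in> S"
  shows "a + christoffel_of G x v v = 0 \<longleftrightarrow> (\<forall>w. EL G x v a w = 0)"
proof -
  note m = metric_onD[OF G x]
  have "EL G x v a w = 2 * G x (a + christoffel_of G x v v) w" for w
    unfolding EL_def bilinear_ladd[OF m(1)] christoffel_of_eq(2)[OF B G x] koszul_def by simp
  then show ?thesis using m(3)[of "a + christoffel_of G x v v"] bilinear_lzero[OF m(1)] by auto
qed

text \<open>Makes the right-hand side of the geodesic system smooth jointly in position and
  velocity, as the uniqueness theorem requires.\<close>

lemma smooth_near_christoffel:
  fixes G :: "'e::euclidean_space \<Rightarrow> 'e \<Rightarrow> 'e \<Rightarrow> real"
  assumes G: "metric_on S G" and x: "x \<in> S"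
  shows "smooth_near (\<lambda>z. christoffel_of G (fst z) (snd z) (snd z)) (x, v)"
proof -
  note B = frame_Basis[where 'a = 'e]
  have S: "open S" using G by (simp add: metric_on_def)
  have "smooth_on S (\<lambda>y. inv (gram Basis G y) w)" for w
  proof (rule smooth_on_inverse_family[OF S gram(2)[OF B G] gram(3)[OF B G]])
    show "smooth_on S (\<lambda>y. gram Basis G y w)" for w
      unfolding gram_def using metric_onD(4)[OF G]
      by (intro smooth_onI_near smooth_near_sum smooth_near_scaleR smooth_near_const) auto
  qed
  then have inv: "smooth_near (\<lambda>y. inv (gram Basis G y) w) x" for w
    using S x by (rule smooth_nearI)
  \<comment> \<open>The symbols at basis directions depend on the position only; the velocity enters
    through its coordinates, as a quadratic polynomial.\<close>
  define \<Gamma> where "\<Gamma> = (\<lambda>i j y. \<Sum>b\<in>Basis. koszul G y i j b *\<^sub>R inv (gram Basis G y) b)"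
  have sm: "smooth_near (\<Gamma> i j) x" for i j
    unfolding \<Gamma>_def koszul_def
    by (intro smooth_near_sum smooth_near_scaleR smooth_near_mult smooth_near_diff smooth_near_add
        smooth_near_const smooth_near_fd metric_onD(4)[OF G x] inv)
  have lin: "linear (inv (gram Basis G y))" if "y \<in> S" for y
    using gram(2-4)[OF B G that] by (simp add: inj_linear_imp_inv_linear)
  have eq: "christoffel_of G y v v = (\<Sum>i\<in>Basis. \<Sum>j\<in>Basis. ((v \<bullet> i) * (v \<bullet> j)) *\<^sub>R \<Gamma> i j y)" if y: "y \<in> S" for y v
  proof -
    note k = koszul_linear[OF G y]
    have kk: "koszul G y v v b = (\<Sum>i\<in>Basis. \<Sum>j\<in>Basis. ((v \<bullet> i) * (v \<bullet> j)) * koszul G y i j b)" for b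
    proof -
      have "koszul G y v v b = (\<Sum>i\<in>Basis. (v \<bullet> i) *\<^sub>R koszul G y i v b)"
        by (rule frame_expand[OF B k(2)])
      also have "\<dots> = (\<Sum>i\<in>Basis. (v \<bullet> i) *\<^sub>R (\<Sum>j\<in>Basis. (v \<bullet> j) *\<^sub>R koszul G y i j b))"
        by (intro sum.cong refl arg_cong2[where f = scaleR] frame_expand[OF B k(3)])
      finally show ?thesis by (simp add: sum_distrib_left mult.assoc)
    qed
    have "christoffel_of G y v v = (\<Sum>b\<in>Basis. koszul G y v v b *\<^sub>R inv (gram Basis G y) b)"
      unfolding christoffel_of_eq(1)[OF B G y] by (simp add: linear_sum[OF lin[OF y]] linear_scale[OF lin[OF y]])
    also have "\<dots> = (\<Sum>b\<in>Basis. \<Sum>i\<in>Basis. \<Sum>j\<in>Basis. ((v \<bullet> i) * (v \<bullet> j)) *\<^sub>R koszul G y i j b *\<^sub>R inv (gram Basis G y) b)"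
      unfolding kk by (simp add: scaleR_sum_left)
    also have "\<dots> = (\<Sum>i\<in>Basis. \<Sum>b\<in>Basis. \<Sum>j\<in>Basis. ((v \<bullet> i) * (v \<bullet> j)) *\<^sub>R koszul G y i j b *\<^sub>R inv (gram Basis G y) b)"
      by (rule sum.swap)
    also have "\<dots> = (\<Sum>i\<in>Basis. \<Sum>j\<in>Basis. \<Sum>b\<in>Basis. ((v \<bullet> i) * (v \<bullet> j)) *\<^sub>R koszul G y i j b *\<^sub>R inv (gram Basis G y) b)"
      by (rule sum.cong[OF refl]) (rule sum.swap)
    also have "\<dots> = (\<Sum>i\<in>Basis. \<Sum>j\<in>Basis. ((v \<bullet> i) * (v \<bullet> j)) *\<^sub>R \<Gamma> i j y)"
      unfolding \<Gamma>_def scaleR_sum_right by simp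
    finally show ?thesis .
  qed
  have "smooth_near (\<lambda>z. \<Sum>i\<in>Basis. \<Sum>j\<in>Basis. ((snd z \<bullet> i) * (snd z \<bullet> j)) *\<^sub>R \<Gamma> i j (fst z)) (x, v)"
    by (intro smooth_near_sum smooth_near_scaleR smooth_near_mult smooth_near_inner smooth_near_snd
        smooth_near_id smooth_near_const smooth_near_compose[OF B, of "\<Gamma> _ _" fst] smooth_near_fst)
      (simp add: sm)
  moreover have "\<forall>\<^sub>F z in nhds (x, v). z \<in> S \<times> UNIV"
    using S x by (intro eventually_nhds_in_open open_Times) auto
  then have "\<forall>\<^sub>F z in nhds (x, v). (\<Sum>i\<in>Basis. \<Sum>j\<in>Basis. ((snd z \<bullet> i) * (snd z \<bullet> j)) *\<^sub>R \<Gamma> i j (fst z))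
      = christoffel_of G (fst z) (snd z) (snd z)"
    by (rule eventually_mono) (auto simp: eq)
  ultimately show ?thesis by (rule smooth_near_cong)
qed

section \<open>Derivatives along curves and maps\<close>

lemma smooth_near_has_vector_derivative:
  assumes "smooth_near x t" shows "(x has_vector_derivative fd x t 1) (at t)"
proof -
  have "fd x t = (\<lambda>h. h *\<^sub>R fd x t 1)"
  proof
    fix h :: real
    have "fd x t h = fd x t (h *\<^sub>R 1)" by simp
    also have "\<dots> = h *\<^sub>R fd x t 1" by (rule linear_scale[OF smooth_near_linear_fd[OF assms]])
    finally show "fd x t h = h *\<^sub>R fd x t 1" .
  qed
  then show ?thesis
    unfolding has_vector_derivative_def
    by (rule has_derivative_eq_rhs[OF smooth_near_has_derivative[OF assms]])
qed

lemma vector_derivative_eq_fd: "smooth_near x t \<Longrightarrow> vector_derivative x (at t) = fd x t 1"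
  by (rule vector_derivative_at) (rule smooth_near_has_vector_derivative)

lemma vector_derivative2_eq_fd:
  assumes "smooth_near x t"
  shows "vector_derivative (\<lambda>s. vector_derivative x (at s)) (at t) = fd (\<lambda>s. fd x s 1) t 1"
proof -
  have "\<forall>\<^sub>F s in nhds t. fd x s 1 = vector_derivative x (at s)"
    using smooth_near_eventually[OF assms] by (rule eventually_mono) (simp add: vector_derivative_eq_fd)
  from smooth_near_cong[OF smooth_near_fd[OF assms] this] fd_cong_eventually[OF this]
  show ?thesis by (simp add: vector_derivative_eq_fd)
qed

text \<open>Smoothness of a metric is known only at fixed pairs of vectors. Expanding both moving
  arguments over a frame leaves products of real functions, and the resulting sums are collapsed
  again by bilinearity.\<close>

lemma fd_metric_along:
  fixes G :: "'e::real_inner \<Rightarrow> 'e \<Rightarrow> 'e \<Rightarrow> real"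
  assumes B: "frame (B :: 'e set)" and G: "metric_on S G" and S: "\<phi> z \<in> S" and \<phi>: "smooth_near \<phi> z"
    and p: "smooth_near p z" and q: "smooth_near q z"
  shows "fd (\<lambda>y. G (\<phi> y) (p y) (q y)) z w
    = fd (\<lambda>x. G x (p z) (q z)) (\<phi> z) (fd \<phi> z w) + G (\<phi> z) (fd p z w) (q z) + G (\<phi> z) (p z) (fd q z w)"
    and "smooth_near (\<lambda>y. G (\<phi> y) (p y) (q y)) z"
proof -
  note m = metric_onD[OF G]
  have oS: "open S" using G by (simp add: metric_on_def)
  have "isCont \<phi> z" by (rule smooth_near_isCont[OF \<phi>])
  then have evS: "\<forall>\<^sub>F y in nhds z. \<phi> y \<in> S"
    using isCont_tendsto_nhds oS S topological_tendstoD by metis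
  have expand: "G x a b = (\<Sum>i\<in>B. \<Sum>j\<in>B. (a \<bullet> i) * ((b \<bullet> j) * G x i j))" if "x \<in> S" for x a b
  proof -
    have "G x a b = (\<Sum>i\<in>B. (a \<bullet> i) *\<^sub>R G x i b)"
      by (rule frame_expand[OF B bilinear_linear(2)[OF m(1)[OF that]]])
    also have "\<dots> = (\<Sum>i\<in>B. (a \<bullet> i) *\<^sub>R (\<Sum>j\<in>B. (b \<bullet> j) *\<^sub>R G x i j))"
      by (intro sum.cong refl arg_cong2[where f = scaleR] frame_expand[OF B bilinear_linear(1)[OF m(1)[OF that]]])
    finally show ?thesis by (simp add: sum_distrib_left)
  qed
  let ?E = "\<lambda>y. \<Sum>i\<in>B. \<Sum>j\<in>B. (p y \<bullet> i) * ((q y \<bullet> j) * G (\<phi> y) i j)"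
  have ev: "\<forall>\<^sub>F y in nhds z. ?E y = G (\<phi> y) (p y) (q y)"
    using evS by (rule eventually_mono) (simp add: expand)
  have Gsm: "smooth_near (\<lambda>y. G (\<phi> y) i j) z" for i j
    by (rule smooth_near_compose[OF B m(4)[OF S] \<phi>])
  have "smooth_near ?E z"
    by (intro smooth_near_sum smooth_near_mult smooth_near_inner p q smooth_near_const Gsm)
  from smooth_near_cong[OF this ev] show "smooth_near (\<lambda>y. G (\<phi> y) (p y) (q y)) z" .
  have Gd: "((\<lambda>y. G (\<phi> y) i j) has_derivative (\<lambda>w. fd (\<lambda>x. G x i j) (\<phi> z) (fd \<phi> z w))) (at z)" for i j
    using has_derivative_compose[OF smooth_near_has_derivative[OF \<phi>] smooth_near_has_derivative[OF m(4)[OF S]]] .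
  have "(?E has_derivative (\<lambda>w. \<Sum>i\<in>B. \<Sum>j\<in>B. (p z \<bullet> i) *
      ((q z \<bullet> j) * fd (\<lambda>x. G x i j) (\<phi> z) (fd \<phi> z w) + (fd q z w \<bullet> j) * G (\<phi> z) i j)
      + (fd p z w \<bullet> i) * ((q z \<bullet> j) * G (\<phi> z) i j))) (at z)"
    by (intro has_derivative_sum has_derivative_mult has_derivative_inner_left smooth_near_has_derivative p q Gd)
  then have "fd (\<lambda>y. G (\<phi> y) (p y) (q y)) z w = (\<Sum>i\<in>B. \<Sum>j\<in>B. (p z \<bullet> i) *
      ((q z \<bullet> j) * fd (\<lambda>x. G x i j) (\<phi> z) (fd \<phi> z w) + (fd q z w \<bullet> j) * G (\<phi> z) i j)
      + (fd p z w \<bullet> i) * ((q z \<bullet> j) * G (\<phi> z) i j))"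
    unfolding fd_cong_eventually[OF ev, symmetric] by (simp add: fd_eqI)
  also have "\<dots> = (\<Sum>i\<in>B. \<Sum>j\<in>B. (p z \<bullet> i) * ((q z \<bullet> j) * fd (\<lambda>x. G x i j) (\<phi> z) (fd \<phi> z w)))
     + G (\<phi> z) (fd p z w) (q z) + G (\<phi> z) (p z) (fd q z w)"
    unfolding expand[OF S, of "fd p z w" "q z"] expand[OF S, of "p z" "fd q z w"]
    by (simp add: algebra_simps sum.distrib)
  also have "(\<Sum>i\<in>B. \<Sum>j\<in>B. (p z \<bullet> i) * ((q z \<bullet> j) * fd (\<lambda>x. G x i j) (\<phi> z) (fd \<phi> z w)))
     = fd (\<lambda>x. G x (p z) (q z)) (\<phi> z) (fd \<phi> z w)"
  proof -
    let ?F = "\<lambda>a b. fd (\<lambda>x. G x a b) (\<phi> z) (fd \<phi> z w)"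
    have "(\<Sum>i\<in>B. \<Sum>j\<in>B. (p z \<bullet> i) * ((q z \<bullet> j) * ?F i j))
        = (\<Sum>i\<in>B. (p z \<bullet> i) *\<^sub>R (\<Sum>j\<in>B. (q z \<bullet> j) *\<^sub>R ?F i j))"
      by (simp add: sum_distrib_left)
    also have "\<dots> = (\<Sum>i\<in>B. (p z \<bullet> i) *\<^sub>R ?F i (q z))"
      by (intro sum.cong refl arg_cong2[where f = scaleR] frame_expand[symmetric] B fd_metric_linear(1)[OF G S])
    \<comment> \<open>Linearity is available in the second slot, so symmetry swaps the arguments
      before the outer sum is collapsed.\<close>
    also have "\<dots> = (\<Sum>i\<in>B. (p z \<bullet> i) *\<^sub>R ?F (q z) i)"
      by (intro sum.cong refl arg_cong2[where f = scaleR] fd_metric_linear(3)[OF G S])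
    also have "\<dots> = ?F (q z) (p z)"
      by (intro frame_expand[symmetric] B fd_metric_linear(1)[OF G S])
    also have "\<dots> = ?F (p z) (q z)" by (rule fd_metric_linear(3)[OF G S])
    finally show ?thesis .
  qed
  finally show "fd (\<lambda>y. G (\<phi> y) (p y) (q y)) z w
    = fd (\<lambda>x. G x (p z) (q z)) (\<phi> z) (fd \<phi> z w) + G (\<phi> z) (fd p z w) (q z) + G (\<phi> z) (p z) (fd q z w)" .
qed

text \<open>Naturality of \<^const>\<open>EL\<close>: the second derivatives of \<open>\<phi>\<close> cancel by their symmetry.\<close>

lemma EL_natural:
  fixes G :: "'e::euclidean_space \<Rightarrow> 'e \<Rightarrow> 'e \<Rightarrow> real"
  assumes G: "metric_on S G" and S: "\<phi> z \<in> S" and \<phi>: "smooth_near \<phi> z"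
  shows "EL (\<lambda>y u v. G (\<phi> y) (fd \<phi> y u) (fd \<phi> y v)) z v a w
    = EL G (\<phi> z) (fd \<phi> z v) (fd \<phi> z a + fd (\<lambda>y. fd \<phi> y v) z v) (fd \<phi> z w)"
proof -
  note m = metric_onD[OF G S]
  note d = fd_metric_along(1)[OF frame_Basis G S \<phi> smooth_near_fd[OF \<phi>] smooth_near_fd[OF \<phi>]]
  show ?thesis
    unfolding EL_def d bilinear_ladd[OF m(1)]
    using fd_fd_symmetric[OF \<phi>, of v w] m(2)[of "fd \<phi> z v" "fd (\<lambda>y. fd \<phi> y v) z w"] by simp
qed

lemma fd_compose:
  assumes "smooth_near \<phi> (z t)" "smooth_near z t"
  shows "fd (\<lambda>s. \<phi> (z s)) t v = fd \<phi> (z t) (fd z t v)"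
  using fd_eqI[OF has_derivative_compose[OF smooth_near_has_derivative[OF assms(2)] smooth_near_has_derivative[OF assms(1)]]]
  by simp

text \<open>The acceleration acquires a Hessian term, which is exactly the one that
  \<open>EL_natural\<close> absorbs.\<close>

lemma curve_compose:
  fixes z :: "real \<Rightarrow> 'a::real_inner" and \<phi> :: "'a \<Rightarrow> 'b::real_normed_vector"
  assumes B: "frame (B :: 'a set)" and \<phi>: "smooth_near \<phi> (z t)" and z: "smooth_near z t"
    and x: "\<forall>\<^sub>F s in nhds t. x s = \<phi> (z s)"
  shows "smooth_near x t" "fd x t 1 = fd \<phi> (z t) (fd z t 1)"
    "fd (\<lambda>s. fd x s 1) t 1 = fd \<phi> (z t) (fd (\<lambda>s. fd z s 1) t 1) + fd (\<lambda>y. fd \<phi> y (fd z t 1)) (z t) (fd z t 1)"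
proof -
  have x': "\<forall>\<^sub>F s in nhds t. \<phi> (z s) = x s" using x by (simp add: eq_commute)
  show "smooth_near x t"
    by (rule smooth_near_cong[OF smooth_near_compose[OF B \<phi> z] x'])
  show "fd x t 1 = fd \<phi> (z t) (fd z t 1)"
    using fd_cong_eventually[OF x] fd_compose[of \<phi> z t 1, OF \<phi> z] by simp
  have cont: "(z \<longlongrightarrow> z t) (nhds t)" using z by (intro isCont_tendsto_nhds smooth_near_isCont)
  have "\<forall>\<^sub>F s in nhds t. smooth_near \<phi> (z s)"
    using smooth_near_eventually[OF \<phi>] cont by (simp add: filterlim_iff)
  moreover have "\<forall>\<^sub>F s in nhds t. smooth_near z s" by (rule smooth_near_eventually[OF z])
  moreover have "\<forall>\<^sub>F s in nhds t. \<forall>\<^sub>F r in nhds s. x r = \<phi> (z r)"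
    using x by (simp add: eventually_eventually)
  \<comment> \<open>The direction of differentiation moves with s, so it is expanded over the frame
    before differentiating again.\<close>
  ultimately have "\<forall>\<^sub>F s in nhds t. fd x s 1 = (\<Sum>b\<in>B. (fd z s 1 \<bullet> b) *\<^sub>R fd \<phi> (z s) b)"
  proof eventually_elim
    case (elim s)
    then have "fd x s 1 = fd \<phi> (z s) (fd z s 1)"
      using fd_cong_eventually[OF elim(3)] fd_compose[of \<phi> z s 1] by simp
    then show ?case using frame_expand[OF B smooth_near_linear_fd[OF elim(1)], of "fd z s 1"] by simp
  qed
  then have "fd (\<lambda>s. fd x s 1) t = fd (\<lambda>s. \<Sum>b\<in>B. (fd z s 1 \<bullet> b) *\<^sub>R fd \<phi> (z s) b) t"
    by (rule fd_cong_eventually)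
  also have "\<dots> = (\<lambda>h. \<Sum>b\<in>B. (fd z t 1 \<bullet> b) *\<^sub>R fd (\<lambda>y. fd \<phi> y b) (z t) (fd z t h)
      + (fd (\<lambda>s. fd z s 1) t h \<bullet> b) *\<^sub>R fd \<phi> (z t) b)"
    by (intro fd_eqI has_derivative_sum has_derivative_scaleR has_derivative_inner_left
        smooth_near_has_derivative smooth_near_fd z
        has_derivative_compose[OF smooth_near_has_derivative[OF z] smooth_near_has_derivative[OF smooth_near_fd[OF \<phi>]]])
  finally have 1: "fd (\<lambda>s. fd x s 1) t 1 = (\<Sum>b\<in>B. (fd z t 1 \<bullet> b) *\<^sub>R fd (\<lambda>y. fd \<phi> y b) (z t) (fd z t 1))
      + (\<Sum>b\<in>B. (fd (\<lambda>s. fd z s 1) t 1 \<bullet> b) *\<^sub>R fd \<phi> (z t) b)"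
    by (simp add: sum.distrib)
  have 2: "fd (\<lambda>y. fd \<phi> y v) (z t) = (\<lambda>h. \<Sum>b\<in>B. (v \<bullet> b) *\<^sub>R fd (\<lambda>y. fd \<phi> y b) (z t) h)" for v
  proof -
    have ev: "\<forall>\<^sub>F y in nhds (z t). fd \<phi> y v = (\<Sum>b\<in>B. (v \<bullet> b) *\<^sub>R fd \<phi> y b)"
      using smooth_near_eventually[OF \<phi>]
      by (rule eventually_mono) (rule frame_expand[OF B smooth_near_linear_fd])
    show ?thesis unfolding fd_cong_eventually[OF ev]
      by (intro fd_eqI has_derivative_sum has_derivative_scaleR_right smooth_near_has_derivative smooth_near_fd \<phi>)
  qed
  have 3: "(\<Sum>b\<in>B. (fd (\<lambda>s. fd z s 1) t 1 \<bullet> b) *\<^sub>R fd \<phi> (z t) b) = fd \<phi> (z t) (fd (\<lambda>s. fd z s 1) t 1)"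
    by (rule frame_expand[OF B smooth_near_linear_fd[OF \<phi>], symmetric])
  show "fd (\<lambda>s. fd x s 1) t 1 = fd \<phi> (z t) (fd (\<lambda>s. fd z s 1) t 1) + fd (\<lambda>y. fd \<phi> y (fd z t 1)) (z t) (fd z t 1)"
    unfolding 1 3 by (subst 2) (rule add.commute)
qed

section \<open>Charts, velocities and geodesics\<close>

lemma eventually_nhds_compose:
  "isCont f x \<Longrightarrow> \<forall>\<^sub>F y in nhds (f x). P y \<Longrightarrow> \<forall>\<^sub>F y in nhds x. P (f y)"
  using isCont_tendsto_nhds[of x f] by (simp add: filterlim_iff)

lemma is_chartD:
  assumes "is_chart S c"
  shows "open (snd c ` fst c)" "fst c \<subseteq> S" "openin (top_of_set S) (fst c)"
    "p \<in> fst c \<Longrightarrow> chart_inv c (snd c p) = p"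
    "x \<in> snd c ` fst c \<Longrightarrow> chart_inv c x \<in> fst c" "x \<in> snd c ` fst c \<Longrightarrow> snd c (chart_inv c x) = x"
proof -
  show o: "openin (top_of_set S) (fst c)" using assms by (simp add: is_chart_def)
  show "fst c \<subseteq> S" by (rule openin_imp_subset[OF o])
qed (use assms inv_into_into[of x "snd c" "fst c"] f_inv_into_f[of x "snd c" "fst c"]
    in \<open>simp_all add: is_chart_def homeomorphism_def\<close>)

lemma chart_image_open:
  assumes c: "is_chart S c" and V: "openin (top_of_set S) V"
  shows "open (snd c ` (V \<inter> fst c))"
proof -
  have "openin (top_of_set (fst c)) (V \<inter> fst c)"
    using V is_chartD(2)[OF c] by (metis inf.commute openin_subtopology_Int_subset openin_subset_trans
        Int_lower2 inf_le1 openin_Int openin_subtopology_self is_chartD(3)[OF c])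
  then have "openin (top_of_set (snd c ` fst c)) (snd c ` (V \<inter> fst c))"
    using c by (auto simp: is_chart_def intro: homeomorphism_imp_open_map)
  then show ?thesis using is_chartD(1)[OF c] by (metis openin_open_trans)
qed

lemma chart_inv_eventually:
  assumes c: "is_chart S c" and p: "p \<in> fst c" and V: "openin (top_of_set S) V" "p \<in> V"
  shows "\<forall>\<^sub>F x in nhds (snd c p). x \<in> snd c ` fst c \<and> chart_inv c x \<in> V"
proof -
  have "\<forall>\<^sub>F x in nhds (snd c p). x \<in> snd c ` (V \<inter> fst c)"
    using chart_image_open[OF c V(1)] p V(2) by (intro eventually_nhds_in_open) auto
  then show ?thesis by (rule eventually_mono) (auto simp: is_chartD(4)[OF c])
qed

lemma chart_eventually_in:
  assumes c: "is_chart S c" and p: "p \<in> fst c"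
  shows "\<forall>\<^sub>F x in nhds (snd c p). x \<in> snd c ` fst c"
  using is_chartD(1)[OF c] p by (intro eventually_nhds_in_open) auto

text \<open>Charts are homeomorphisms, so continuity read in one chart gives continuity for the
  subspace topology of S.\<close>

lemma map_eventually_in:
  assumes c: "is_chart S c" and F: "\<forall>\<^sub>F y in nhds x. F y \<in> fst c" "isCont (\<lambda>y. snd c (F y)) x"
    and V: "openin (top_of_set S) V" "F x \<in> V"
  shows "\<forall>\<^sub>F y in nhds x. F y \<in> V"
proof -
  have "\<forall>\<^sub>F y in nhds x. chart_inv c (snd c (F y)) \<in> V"
    using eventually_nhds_compose[OF F(2) chart_inv_eventually[OF c _ V]] eventually_nhds_x_imp_x[OF F(1)]
    by (simp add: eventually_conj_iff)
  with F(1) show ?thesis by eventually_elim (simp add: is_chartD(4)[OF c])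
qed

lemma smooth_map_atI:
  assumes "c \<in> \<A>" "d \<in> \<B>" "is_chart S c" "p \<in> fst c"
    "\<forall>\<^sub>F x in nhds (snd c p). F (chart_inv c x) \<in> fst d"
    "smooth_near (\<lambda>x. snd d (F (chart_inv c x))) (snd c p)"
  shows "smooth_map_at \<A> \<B> p F"
proof -
  obtain V where V: "open V" "snd c p \<in> V" "smooth_on V (\<lambda>x. snd d (F (chart_inv c x)))"
    using assms(6) by (auto simp: smooth_near_def)
  obtain W where W: "open W" "snd c p \<in> W" "\<And>x. x \<in> W \<Longrightarrow> F (chart_inv c x) \<in> fst d \<and> x \<in> snd c ` fst c"
    using eventually_conj[OF assms(5) chart_eventually_in[OF assms(3,4)]] by (auto simp: eventually_nhds)
  show ?thesis unfolding smooth_map_at_def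
    by (rule bexI[of _ c], rule bexI[of _ d], rule exI[of _ "V \<inter> W"])
      (use V W assms smooth_on_subset[OF V(3)] in auto)
qed

lemma smooth_map_atE:
  assumes "smooth_map_at \<A> \<B> p F"
  obtains c d where "c \<in> \<A>" "d \<in> \<B>" "p \<in> fst c" "\<forall>\<^sub>F x in nhds (snd c p). F (chart_inv c x) \<in> fst d"
    "smooth_near (\<lambda>x. snd d (F (chart_inv c x))) (snd c p)"
proof -
  obtain c d W where *: "c \<in> \<A>" "d \<in> \<B>" "p \<in> fst c" "open W" "snd c p \<in> W"
      "\<forall>x\<in>W. F (chart_inv c x) \<in> fst d" "smooth_on W (\<lambda>x. snd d (F (chart_inv c x)))"
    using assms unfolding smooth_map_at_def by blast
  show thesis
  proof (rule that[OF *(1-3)])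
    show "\<forall>\<^sub>F x in nhds (snd c p). F (chart_inv c x) \<in> fst d"
      using eventually_nhds_in_open[OF *(4,5)] by (rule eventually_mono) (use *(6) in auto)
    show "smooth_near (\<lambda>x. snd d (F (chart_inv c x))) (snd c p)"
      using *(7,4,5) by (rule smooth_nearI)
  qed
qed

lemma smooth_fun_atI:
  assumes "c \<in> \<A>" "is_chart S c" "p \<in> fst c" "smooth_near (\<lambda>x. h (chart_inv c x)) (snd c p)"
  shows "smooth_fun_at \<A> p h"
  by (rule smooth_map_atI[OF assms(1) _ assms(2,3), of "(UNIV, id)"]) (use assms in \<open>auto simp: id_atlas_def\<close>)

lemma smooth_fun_atE:
  assumes "smooth_fun_at \<A> p h"
  obtains c where "c \<in> \<A>" "p \<in> fst c" "smooth_near (\<lambda>x. h (chart_inv c x)) (snd c p)"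
  by (rule smooth_map_atE[OF assms]) (auto simp: id_atlas_def)

lemma id_chart: "open U \<Longrightarrow> is_chart U (U, id)"
  by (auto simp: is_chart_def homeomorphism_def continuous_on_cong[OF refl, of U "inv_into U id" id]
      intro: inv_into_into dest: f_inv_into_f[of _ id U, simplified] )

lemma smooth_curve_atI:
  assumes "c \<in> \<A>" "\<forall>\<^sub>F s in nhds t. \<gamma> s \<in> fst c" "smooth_near (\<lambda>s. snd c (\<gamma> s)) t"
  shows "smooth_curve_at \<A> t \<gamma>"
  by (rule smooth_map_atI[OF _ assms(1), of "(UNIV, id)" _ UNIV])
    (use assms in \<open>auto simp: id_atlas_def id_chart\<close>)

lemma smooth_curve_atE:
  assumes "smooth_curve_at \<A> t \<gamma>"
  obtains c where "c \<in> \<A>" "\<forall>\<^sub>F s in nhds t. \<gamma> s \<in> fst c" "smooth_near (\<lambda>s. snd c (\<gamma> s)) t"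
  by (rule smooth_map_atE[OF assms]) (auto simp: id_atlas_def)

text \<open>Only a single chart enters, so the formula also applies to the singleton atlas of a
  chart of the level set.\<close>

lemma velocity_chart:
  assumes c: "c \<in> \<A>" "is_chart S c" and \<gamma>: "\<forall>\<^sub>F s in nhds t. \<gamma> s \<in> fst c" "smooth_near (\<lambda>s. snd c (\<gamma> s)) t"
    and h: "smooth_near (\<lambda>x. h (chart_inv c x)) (snd c (\<gamma> t))"
  shows "velocity \<A> \<gamma> t h = fd (\<lambda>x. h (chart_inv c x)) (snd c (\<gamma> t)) (fd (\<lambda>s. snd c (\<gamma> s)) t 1)"
proof -
  have "smooth_fun_at \<A> (\<gamma> t) h"
    by (rule smooth_fun_atI[OF c _ h]) (rule eventually_nhds_x_imp_x[OF \<gamma>(1)])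
  then have "velocity \<A> \<gamma> t h = deriv (\<lambda>s. h (\<gamma> s)) t" by (simp add: velocity_def)
  also have "\<dots> = deriv (\<lambda>s. h (chart_inv c (snd c (\<gamma> s)))) t"
    using \<gamma>(1) by (intro deriv_cong_ev refl) (auto elim!: eventually_mono simp: is_chartD(4)[OF c(2)])
  also have "\<dots> = fd (\<lambda>x. h (chart_inv c x)) (snd c (\<gamma> t)) (fd (\<lambda>s. snd c (\<gamma> s)) t 1)"
  proof (rule DERIV_imp_deriv)
    have "((\<lambda>s. h (chart_inv c (snd c (\<gamma> s)))) has_derivative
       (\<lambda>v. fd (\<lambda>x. h (chart_inv c x)) (snd c (\<gamma> t)) (fd (\<lambda>s. snd c (\<gamma> s)) t v))) (at t)"
      using has_derivative_compose[OF smooth_near_has_derivative[OF \<gamma>(2)] smooth_near_has_derivative[OF h]] .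
    then have "((\<lambda>s. h (chart_inv c (snd c (\<gamma> s)))) has_real_derivative
       (fd (\<lambda>x. h (chart_inv c x)) (snd c (\<gamma> t)) (fd (\<lambda>s. snd c (\<gamma> s)) t 1))) (at t)"
      unfolding has_field_derivative_def
    proof (rule has_derivative_eq_rhs)
      have l: "linear (\<lambda>v. fd (\<lambda>x. h (chart_inv c x)) (snd c (\<gamma> t)) (fd (\<lambda>s. snd c (\<gamma> s)) t v))"
        using linear_compose[OF smooth_near_linear_fd[OF \<gamma>(2)] smooth_near_linear_fd[OF h]] by (simp add: o_def)
      show "(\<lambda>v. fd (\<lambda>x. h (chart_inv c x)) (snd c (\<gamma> t)) (fd (\<lambda>s. snd c (\<gamma> s)) t v))
        = (*) (fd (\<lambda>x. h (chart_inv c x)) (snd c (\<gamma> t)) (fd (\<lambda>s. snd c (\<gamma> s)) t 1))"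
      proof
        fix v :: real
        show "fd (\<lambda>x. h (chart_inv c x)) (snd c (\<gamma> t)) (fd (\<lambda>s. snd c (\<gamma> s)) t v)
          = fd (\<lambda>x. h (chart_inv c x)) (snd c (\<gamma> t)) (fd (\<lambda>s. snd c (\<gamma> s)) t 1) * v"
          using linear_scale[OF l, of v 1] by (simp add: mult.commute)
      qed
    qed
    then show "((\<lambda>s. h (chart_inv c (snd c (\<gamma> s)))) has_real_derivative
       (fd (\<lambda>x. h (chart_inv c x)) (snd c (\<gamma> t)) (fd (\<lambda>s. snd c (\<gamma> s)) t 1))) (at t)" .
  qed
  finally show ?thesis .
qed

lemma velocity_cong:
  assumes "\<forall>\<^sub>F s in nhds t. \<gamma> s = \<gamma>' s"
  shows "velocity \<A> \<gamma> t = velocity \<A> \<gamma>' t"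
proof -
  have d: "deriv (\<lambda>s. h (\<gamma> s)) t = deriv (\<lambda>s. h (\<gamma>' s)) t" for h
    using assms by (intro deriv_cong_ev refl) (auto elim!: eventually_mono)
  show ?thesis
  proof
    fix h
    show "velocity \<A> \<gamma> t h = velocity \<A> \<gamma>' t h"
      using eventually_nhds_x_imp_x[OF assms] d[of h] by (simp add: velocity_def)
  qed
qed

lemma chart_line:
  assumes c: "is_chart S c" and x: "x \<in> snd c ` fst c"
  shows "\<forall>\<^sub>F s in nhds (0::real). chart_inv c (x + s *\<^sub>R u) \<in> fst c"
    "smooth_near (\<lambda>s::real. snd c (chart_inv c (x + s *\<^sub>R u))) 0"
    "fd (\<lambda>s::real. snd c (chart_inv c (x + s *\<^sub>R u))) 0 1 = u"
proof -
  have sm: "smooth_near (\<lambda>s::real. x + s *\<^sub>R u) 0"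
    by (intro smooth_near_add smooth_near_scaleR smooth_near_const smooth_near_id)
  have "\<forall>\<^sub>F y in nhds (x + 0 *\<^sub>R u). y \<in> snd c ` fst c"
    using x is_chartD(1)[OF c] by (intro eventually_nhds_in_open) auto
  then have ev: "\<forall>\<^sub>F s in nhds (0::real). x + s *\<^sub>R u \<in> snd c ` fst c"
    by (rule eventually_nhds_compose[OF smooth_near_isCont[OF sm]])
  then show "\<forall>\<^sub>F s in nhds (0::real). chart_inv c (x + s *\<^sub>R u) \<in> fst c"
    by (rule eventually_mono) (rule is_chartD(5)[OF c])
  have ev': "\<forall>\<^sub>F s in nhds (0::real). x + s *\<^sub>R u = snd c (chart_inv c (x + s *\<^sub>R u))"
    using ev by (rule eventually_mono) (simp add: is_chartD(6)[OF c])
  show "smooth_near (\<lambda>s::real. snd c (chart_inv c (x + s *\<^sub>R u))) 0"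
    by (rule smooth_near_cong[OF sm ev'])
  have "((\<lambda>s::real. x + s *\<^sub>R u) has_derivative (\<lambda>s. s *\<^sub>R u)) (at 0)"
    by (auto intro!: derivative_eq_intros)
  from fd_eqI[OF this] show "fd (\<lambda>s::real. snd c (chart_inv c (x + s *\<^sub>R u))) 0 1 = u"
    unfolding fd_cong_eventually[OF ev', symmetric] by simp
qed

text \<open>The tangent vector with given coordinates as a derivation, without a representing curve.
  The value 0 outside the smooth functions agrees with that of \<open>velocity\<close>, so the two
  can be equated in HOL.\<close>

definition tvec :: "('a, 'e::real_normed_vector) chart set \<Rightarrow> ('a, 'e) chart \<Rightarrow> 'a \<Rightarrow> 'e \<Rightarrow> 'a tangent" where
  "tvec \<A> c p u = (\<lambda>h. if smooth_fun_at \<A> p h then fd (\<lambda>x. h (chart_inv c x)) (snd c p) u else 0)"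

lemma geodesic_equation_chart:
  fixes c :: "('a::topological_space, 'e::real_inner) chart"
  assumes B: "frame (B :: 'e set)" and G: "metric_on S (local_metric \<A> g c)" and x: "snd c (\<gamma> t) \<in> S"
    and \<gamma>: "smooth_near (\<lambda>s. snd c (\<gamma> s)) t"
  shows "(let x = (\<lambda>s. snd c (\<gamma> s)); x' = (\<lambda>s. vector_derivative x (at s)) in
             vector_derivative x' (at t) + christoffel \<A> g c (x t) (x' t) (x' t) = 0)
    \<longleftrightarrow> (\<forall>w. EL (local_metric \<A> g c) (snd c (\<gamma> t)) (fd (\<lambda>s. snd c (\<gamma> s)) t 1)
           (fd (\<lambda>s. fd (\<lambda>s. snd c (\<gamma> s)) s 1) t 1) w = 0)"
  unfolding Let_def vector_derivative2_eq_fd[OF \<gamma>] vector_derivative_eq_fd[OF \<gamma>] christoffel_eq_of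
  by (rule geodesic_equation_iff_EL[OF B G x])

section \<open>Coordinates and uniqueness of geodesics on a manifold\<close>

locale manifold =
  fixes M :: "'a::{t2_space,second_countable_topology} set" and \<A> :: "('a, 'e::euclidean_space) chart set"
  assumes manifold: "smooth_manifold M \<A>"
begin

lemma chart: "c \<in> \<A> \<Longrightarrow> is_chart M c"
  using manifold by (simp add: smooth_manifold_def)

lemma chart_exists: assumes "p \<in> M" obtains c where "c \<in> \<A>" "p \<in> fst c"
proof -
  have "p \<in> (\<Union>c\<in>\<A>. fst c)" using assms manifold by (simp add: smooth_manifold_def)
  then show thesis using that by blast
qed

lemma transition:
  assumes "c \<in> \<A>" "d \<in> \<A>" "p \<in> fst c" "p \<in> fst d"
  shows "smooth_near (\<lambda>x. snd d (chart_inv c x)) (snd c p)"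
proof (rule smooth_nearI)
  show "smooth_on (snd c ` (fst c \<inter> fst d)) (\<lambda>x. snd d (chart_inv c x))"
    using manifold assms by (simp add: smooth_manifold_def)
  show "open (snd c ` (fst c \<inter> fst d))"
    using chart_image_open[OF chart[OF assms(1)] is_chartD(3)[OF chart[OF assms(2)]]] by (simp add: Int_commute)
qed (use assms in auto)

lemma smooth_change_target:
  assumes d: "d \<in> \<A>" "\<forall>\<^sub>F y in nhds x. F y \<in> fst d" "smooth_near (\<lambda>y. snd d (F y)) x"
    and c: "c \<in> \<A>" "F x \<in> fst c"
  shows "\<forall>\<^sub>F y in nhds x. F y \<in> fst c" "smooth_near (\<lambda>y. snd c (F y)) x"
proof -
  show "\<forall>\<^sub>F y in nhds x. F y \<in> fst c"
    by (rule map_eventually_in[OF chart[OF d(1)] d(2) smooth_near_isCont[OF d(3)] is_chartD(3)[OF chart[OF c(1)]] c(2)])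
  have "smooth_near (\<lambda>y. snd c (chart_inv d (snd d (F y)))) x"
    by (rule smooth_near_compose[OF frame_Basis transition[OF d(1) c(1) eventually_nhds_x_imp_x[OF d(2)] c(2)] d(3)])
  then show "smooth_near (\<lambda>y. snd c (F y)) x"
    by (rule smooth_near_cong) (use d(2) in \<open>auto elim!: eventually_mono simp: is_chartD(4)[OF chart[OF d(1)]]\<close>)
qed

lemma smooth_change_source:
  assumes d: "d \<in> \<A>" "p \<in> fst d" "smooth_near (\<lambda>x. H (chart_inv d x)) (snd d p)"
    and c: "c \<in> \<A>" "p \<in> fst c"
  shows "smooth_near (\<lambda>x. H (chart_inv c x)) (snd c p)"
proof -
  have "smooth_near (\<lambda>x. H (chart_inv d (snd d (chart_inv c x)))) (snd c p)"
    by (rule smooth_near_compose[OF frame_Basis _ transition[OF c(1) d(1) c(2) d(2)], of "\<lambda>x. H (chart_inv d x)"])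
      (simp add: d is_chartD(4)[OF chart[OF c(1)]] c)
  moreover have "\<forall>\<^sub>F x in nhds (snd c p). H (chart_inv d (snd d (chart_inv c x))) = H (chart_inv c x)"
    using chart_inv_eventually[OF chart[OF c(1)] c(2) is_chartD(3)[OF chart[OF d(1)]] d(2)]
    by (rule eventually_mono) (simp add: is_chartD(4)[OF chart[OF d(1)]])
  ultimately show ?thesis by (rule smooth_near_cong)
qed

lemma smooth_fun_at_iff:
  assumes c: "c \<in> \<A>" "p \<in> fst c"
  shows "smooth_fun_at \<A> p h \<longleftrightarrow> smooth_near (\<lambda>x. h (chart_inv c x)) (snd c p)"
  using smooth_fun_atI[OF c(1) chart[OF c(1)] c(2)] smooth_fun_atE[of \<A> p h] smooth_change_source[OF _ _ _ c]
  by metis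

lemma smooth_curve_atD:
  assumes "smooth_curve_at \<A> t \<gamma>" "c \<in> \<A>" "\<gamma> t \<in> fst c"
  shows "\<forall>\<^sub>F s in nhds t. \<gamma> s \<in> fst c" "smooth_near (\<lambda>s. snd c (\<gamma> s)) t"
proof -
  obtain d where d: "d \<in> \<A>" "\<forall>\<^sub>F s in nhds t. \<gamma> s \<in> fst d" "smooth_near (\<lambda>s. snd d (\<gamma> s)) t"
    using smooth_curve_atE[OF assms(1)] by metis
  show "\<forall>\<^sub>F s in nhds t. \<gamma> s \<in> fst c" "smooth_near (\<lambda>s. snd c (\<gamma> s)) t"
    using smooth_change_target[where d = d and F = \<gamma> and x = t and c = c] d assms(2,3) by auto
qed

lemma velocity_eq_tvec:
  assumes "smooth_curve_at \<A> t \<gamma>" "c \<in> \<A>" "\<gamma> t \<in> fst c"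
  shows "velocity \<A> \<gamma> t = tvec \<A> c (\<gamma> t) (fd (\<lambda>s. snd c (\<gamma> s)) t 1)"
proof
  fix h
  show "velocity \<A> \<gamma> t h = tvec \<A> c (\<gamma> t) (fd (\<lambda>s. snd c (\<gamma> s)) t 1) h"
    using velocity_chart[OF assms(2) chart[OF assms(2)] smooth_curve_atD[OF assms], of h]
    by (auto simp: tvec_def smooth_fun_at_iff[OF assms(2,3)]) (simp add: velocity_def smooth_fun_at_iff[OF assms(2,3)])
qed

lemma coord_vec_eq_tvec:
  assumes "c \<in> \<A>" "x \<in> snd c ` fst c"
  shows "coord_vec \<A> c x u = tvec \<A> c (chart_inv c x) u"
    and "smooth_curve_at \<A> 0 (\<lambda>s. chart_inv c (x + s *\<^sub>R u))"
proof -
  note l = chart_line[OF chart[OF assms(1)] assms(2), of u]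
  show s: "smooth_curve_at \<A> 0 (\<lambda>s. chart_inv c (x + s *\<^sub>R u))"
    by (rule smooth_curve_atI[OF assms(1) l(1,2)])
  show "coord_vec \<A> c x u = tvec \<A> c (chart_inv c x) u"
    unfolding coord_vec_def using velocity_eq_tvec[OF s assms(1)] is_chartD(5)[OF chart[OF assms(1)] assms(2)] l(3)
    by simp
qed

lemma tvec_inj:
  assumes c: "c \<in> \<A>" "p \<in> fst c" and eq: "tvec \<A> c p u = tvec \<A> c p v"
  shows "u = v"
proof -
  \<comment> \<open>The test function is the coordinate in direction u - v; on it the two vectors
    differ by the squared norm of u - v.\<close>
  let ?h = "\<lambda>q. snd c q \<bullet> (u - v)"
  have ev: "\<forall>\<^sub>F x in nhds (snd c p). x \<bullet> (u - v) = ?h (chart_inv c x)"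
    using chart_eventually_in[OF chart[OF c(1)] c(2)] by (rule eventually_mono) (simp add: is_chartD(6)[OF chart[OF c(1)]])
  have "smooth_near (\<lambda>x. x \<bullet> (u - v)) (snd c p)"
    by (intro smooth_near_inner smooth_near_id smooth_near_const)
  then have sm: "smooth_fun_at \<A> p ?h"
    unfolding smooth_fun_at_iff[OF c] by (rule smooth_near_cong[OF _ ev])
  have "((\<lambda>x. x \<bullet> (u - v)) has_derivative (\<lambda>w. w \<bullet> (u - v))) (at (snd c p))"
    by (auto intro!: derivative_eq_intros)
  then have "tvec \<A> c p w ?h = w \<bullet> (u - v)" for w
    using sm fd_eqI unfolding tvec_def fd_cong_eventually[OF ev, symmetric] by metis
  then have "u \<bullet> (u - v) = v \<bullet> (u - v)" using eq by metis
  then have "(u - v) \<bullet> (u - v) = 0" unfolding inner_diff_left[of u v] by simp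
  then show ?thesis by simp
qed

lemma tvec_linear:
  assumes c: "c \<in> \<A>" "p \<in> fst c"
  shows "tvec \<A> c p (a *\<^sub>R u + b *\<^sub>R v) = (\<lambda>h. a * tvec \<A> c p u h + b * tvec \<A> c p v h)"
    and "tvec \<A> c p 0 = (\<lambda>h. 0)"
proof -
  have l: "linear (fd (\<lambda>x. h (chart_inv c x)) (snd c p))" if "smooth_fun_at \<A> p h" for h
    using that unfolding smooth_fun_at_iff[OF c] by (rule smooth_near_linear_fd)
  show "tvec \<A> c p (a *\<^sub>R u + b *\<^sub>R v) = (\<lambda>h. a * tvec \<A> c p u h + b * tvec \<A> c p v h)"
  proof
    fix h
    show "tvec \<A> c p (a *\<^sub>R u + b *\<^sub>R v) h = a * tvec \<A> c p u h + b * tvec \<A> c p v h"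
      using l[of h] by (simp add: tvec_def linear_add linear_scale)
  qed
  show "tvec \<A> c p 0 = (\<lambda>h. 0)"
  proof
    fix h show "tvec \<A> c p 0 h = 0" using l[of h] by (simp add: tvec_def linear_0)
  qed
qed

lemma tangent_space_eq:
  assumes c: "c \<in> \<A>" "p \<in> fst c"
  shows "tangent_space \<A> p = range (tvec \<A> c p)"
proof safe
  fix X assume "X \<in> tangent_space \<A> p"
  then obtain \<gamma> where "X = velocity \<A> \<gamma> 0" "smooth_curve_at \<A> 0 \<gamma>" "\<gamma> 0 = p"
    by (auto simp: tangent_space_def)
  then show "X \<in> range (tvec \<A> c p)" using velocity_eq_tvec[of 0 \<gamma> c] c by auto
next
  fix u
  have p: "snd c p \<in> snd c ` fst c" "chart_inv c (snd c p) = p"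
    using c is_chartD(4)[OF chart[OF c(1)]] by auto
  show "tvec \<A> c p u \<in> tangent_space \<A> p"
    using coord_vec_eq_tvec[OF c(1) p(1), of u] p(2) unfolding tangent_space_def coord_vec_def by force
qed

lemma velocity_in_tangent_space:
  assumes "smooth_curve_at \<A> t \<gamma>" "c \<in> \<A>" "\<gamma> t \<in> fst c"
  shows "velocity \<A> \<gamma> t \<in> tangent_space \<A> (\<gamma> t)"
  using velocity_eq_tvec[OF assms] tangent_space_eq[OF assms(2,3)] by simp

lemma local_metric_eq:
  assumes "c \<in> \<A>" "x \<in> snd c ` fst c"
  shows "local_metric \<A> g c x u v = g (chart_inv c x) (tvec \<A> c (chart_inv c x) u) (tvec \<A> c (chart_inv c x) v)"
  unfolding local_metric_def coord_vec_eq_tvec(1)[OF assms] ..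

lemma metric_on_chart:
  assumes g: "pseudo_riemannian M \<A> g" and c: "c \<in> \<A>"
  shows "metric_on (snd c ` fst c) (local_metric \<A> g c)"
  unfolding metric_on_def
proof (intro conjI ballI allI impI)
  show "open (snd c ` fst c)" by (rule is_chartD(1)[OF chart[OF c]])
  show "smooth_on (snd c ` fst c) (\<lambda>y. local_metric \<A> g c y u v)" for u v
    using g c by (simp add: pseudo_riemannian_def)
  fix x assume x: "x \<in> snd c ` fst c"
  define p where "p = chart_inv c x"
  have p: "p \<in> fst c" using is_chartD(5)[OF chart[OF c] x] by (simp add: p_def)
  have pM: "p \<in> M" using p is_chartD(2)[OF chart[OF c]] by auto
  note ts = tangent_space_eq[OF c p]
  note lm = local_metric_eq[OF c x, of g, folded p_def]
  have sym: "g p (tvec \<A> c p u) (tvec \<A> c p v) = g p (tvec \<A> c p v) (tvec \<A> c p u)" for u v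
  proof -
    have "\<forall>X\<in>tangent_space \<A> p. \<forall>Y\<in>tangent_space \<A> p. g p X Y = g p Y X"
      using g pM unfolding pseudo_riemannian_def by blast
    then show ?thesis unfolding ts by simp
  qed
  have lin: "g p (\<lambda>h. a * tvec \<A> c p u h + b * tvec \<A> c p v h) (tvec \<A> c p w)
      = a * g p (tvec \<A> c p u) (tvec \<A> c p w) + b * g p (tvec \<A> c p v) (tvec \<A> c p w)" for a b u v w
  proof -
    have "\<forall>X\<in>tangent_space \<A> p. \<forall>Y\<in>tangent_space \<A> p. \<forall>Z\<in>tangent_space \<A> p. \<forall>a b.
        g p (\<lambda>h. a * X h + b * Y h) Z = a * g p X Z + b * g p Y Z"
      using g pM unfolding pseudo_riemannian_def by blast
    then show ?thesis unfolding ts by simp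
  qed
  have add: "local_metric \<A> g c x (u + v) w = local_metric \<A> g c x u w + local_metric \<A> g c x v w" for u v w
    unfolding lm using tvec_linear(1)[OF c p, of 1 u 1 v] lin[of 1 u 1 v w] by simp
  have scale: "local_metric \<A> g c x (r *\<^sub>R u) w = r * local_metric \<A> g c x u w" for r u w
    unfolding lm using tvec_linear(1)[OF c p, of r u 0 u] lin[of r u 0 u w] by simp
  show sym': "local_metric \<A> g c x u v = local_metric \<A> g c x v u" for u v
    unfolding lm by (rule sym)
  have add': "local_metric \<A> g c x w (u + v) = local_metric \<A> g c x w u + local_metric \<A> g c x w v" for u v w
    using add[of u v w] by (simp only: sym'[of w])
  have scale': "local_metric \<A> g c x w (r *\<^sub>R u) = r * local_metric \<A> g c x w u" for r u w
    using scale[of r u w] by (simp only: sym'[of w])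
  show "bilinear (local_metric \<A> g c x)"
    unfolding bilinear_def by (intro conjI allI linearI) (simp_all add: add scale add' scale')
  show "u = 0" if "\<forall>v. local_metric \<A> g c x u v = 0" for u
  proof -
    have "\<forall>Y\<in>tangent_space \<A> p. g p (tvec \<A> c p u) Y = 0" using that unfolding lm ts by auto
    moreover have "\<forall>X\<in>tangent_space \<A> p. (\<forall>Y\<in>tangent_space \<A> p. g p X Y = 0) \<longrightarrow> X = (\<lambda>h. 0)"
      using g pM unfolding pseudo_riemannian_def by blast
    ultimately have "tvec \<A> c p u = (\<lambda>h. 0)" unfolding ts by simp
    then show "u = 0" using tvec_linear(2)[OF c p] tvec_inj[OF c p, of u 0] by simp
  qed
qed

lemma geodesic_iff_EL:
  assumes g: "pseudo_riemannian M \<A> g"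
  shows "geodesic \<A> g J \<gamma> \<longleftrightarrow> (\<forall>t\<in>J. smooth_curve_at \<A> t \<gamma> \<and> (\<forall>c\<in>\<A>. \<gamma> t \<in> fst c \<longrightarrow>
     (\<forall>w. EL (local_metric \<A> g c) (snd c (\<gamma> t)) (fd (\<lambda>s. snd c (\<gamma> s)) t 1)
           (fd (\<lambda>s. fd (\<lambda>s. snd c (\<gamma> s)) s 1) t 1) w = 0)))"
proof -
  have "(let x = (\<lambda>s. snd c (\<gamma> s)); x' = (\<lambda>s. vector_derivative x (at s)) in
             vector_derivative x' (at t) + christoffel \<A> g c (x t) (x' t) (x' t) = 0)
    \<longleftrightarrow> (\<forall>w. EL (local_metric \<A> g c) (snd c (\<gamma> t)) (fd (\<lambda>s. snd c (\<gamma> s)) t 1)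
           (fd (\<lambda>s. fd (\<lambda>s. snd c (\<gamma> s)) s 1) t 1) w = 0)"
    if "smooth_curve_at \<A> t \<gamma>" "c \<in> \<A>" "\<gamma> t \<in> fst c" for c t
    using that by (intro geodesic_equation_chart[OF frame_Basis metric_on_chart[OF g]] smooth_curve_atD(2)) auto
  then show ?thesis unfolding geodesic_def by blast
qed

lemma smooth_curve_at_cong:
  assumes "\<forall>\<^sub>F s in nhds t. \<gamma> s = \<gamma>' s" "smooth_curve_at \<A> t \<gamma>"
  shows "smooth_curve_at \<A> t \<gamma>'"
proof -
  obtain c where c: "c \<in> \<A>" "\<forall>\<^sub>F s in nhds t. \<gamma> s \<in> fst c" "smooth_near (\<lambda>s. snd c (\<gamma> s)) t"
    using smooth_curve_atE[OF assms(2)] by metis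
  show ?thesis
  proof (rule smooth_curve_atI[OF c(1)])
    show "\<forall>\<^sub>F s in nhds t. \<gamma>' s \<in> fst c" using c(2) assms(1) by eventually_elim simp
    show "smooth_near (\<lambda>s. snd c (\<gamma>' s)) t"
      by (rule smooth_near_cong[OF c(3)]) (use assms(1) in \<open>auto elim!: eventually_mono\<close>)
  qed
qed

lemma geodesic_cong:
  assumes g: "pseudo_riemannian M \<A> g" and I: "open I" and eq: "\<And>t. t \<in> I \<Longrightarrow> \<gamma> t = \<gamma>' t"
    and geo: "geodesic \<A> g I \<gamma>"
  shows "geodesic \<A> g I \<gamma>'"
  unfolding geodesic_iff_EL[OF g]
proof (intro ballI conjI impI allI)
  fix t assume t: "t \<in> I"
  have ev: "\<forall>\<^sub>F s in nhds t. \<gamma> s = \<gamma>' s"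
    using eventually_nhds_in_open[OF I t] by (rule eventually_mono) (rule eq)
  have geo': "smooth_curve_at \<A> t \<gamma>" "\<And>c w. c \<in> \<A> \<Longrightarrow> \<gamma> t \<in> fst c \<Longrightarrow>
     EL (local_metric \<A> g c) (snd c (\<gamma> t)) (fd (\<lambda>s. snd c (\<gamma> s)) t 1)
           (fd (\<lambda>s. fd (\<lambda>s. snd c (\<gamma> s)) s 1) t 1) w = 0"
    using geo t unfolding geodesic_iff_EL[OF g] by blast+
  show "smooth_curve_at \<A> t \<gamma>'" by (rule smooth_curve_at_cong[OF ev geo'(1)])
  fix c w assume c: "c \<in> \<A>" "\<gamma>' t \<in> fst c"
  have ev1: "\<forall>\<^sub>F s in nhds t. snd c (\<gamma> s) = snd c (\<gamma>' s)" using ev by (rule eventually_mono) simp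
  have "\<forall>\<^sub>F s in nhds t. \<forall>\<^sub>F r in nhds s. snd c (\<gamma> r) = snd c (\<gamma>' r)"
    using ev1 by (simp add: eventually_eventually)
  then have "\<forall>\<^sub>F s in nhds t. fd (\<lambda>s. snd c (\<gamma> s)) s 1 = fd (\<lambda>s. snd c (\<gamma>' s)) s 1"
    by (rule eventually_mono) (simp add: fd_cong_eventually)
  note ev2 = fd_cong_eventually[OF this]
  show "EL (local_metric \<A> g c) (snd c (\<gamma>' t)) (fd (\<lambda>s. snd c (\<gamma>' s)) t 1)
           (fd (\<lambda>s. fd (\<lambda>s. snd c (\<gamma>' s)) s 1) t 1) w = 0"
    using geo'(2)[OF c(1), of w] c(2) eq[OF t] unfolding fd_cong_eventually[OF ev1] ev2 by simp
qed

text \<open>In one chart the geodesic equation is the first-order system \<open>H\<close> for pairs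
  of position and velocity. Equal velocities as derivations mean equal coordinate velocities by
  \<open>tvec_inj\<close>.\<close>

lemma geodesic_unique_local:
  assumes g: "pseudo_riemannian M \<A> g" and I: "open I" "t \<in> I"
    and geo: "geodesic \<A> g I \<gamma>1" "geodesic \<A> g I \<gamma>2"
    and eq: "\<gamma>1 t = \<gamma>2 t" "velocity \<A> \<gamma>1 t = velocity \<A> \<gamma>2 t" and c: "c \<in> \<A>" "\<gamma>1 t \<in> fst c"
  shows "\<forall>\<^sub>F s in nhds t. \<gamma>1 s = \<gamma>2 s"
proof -
  let ?G = "local_metric \<A> g c"
  note G = metric_on_chart[OF g c(1)]
  define H where "H = (\<lambda>z. (snd z, - christoffel_of ?G (fst z) (snd z) (snd z)))"
  define z where "z = (\<lambda>(\<gamma> :: real \<Rightarrow> 'a) s. (snd c (\<gamma> s), fd (\<lambda>s. snd c (\<gamma> s)) s 1))"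
  have sc: "smooth_curve_at \<A> s \<gamma>" if "geodesic \<A> g I \<gamma>" "s \<in> I" for \<gamma> s
    using that by (simp add: geodesic_def)
  have ev: "(\<forall>\<^sub>F s in nhds t. \<gamma> s \<in> fst c) \<and> (\<forall>\<^sub>F s in nhds t. (z \<gamma> has_vector_derivative H (z \<gamma> s)) (at s))"
    if \<gamma>: "geodesic \<A> g I \<gamma>" "\<gamma> t \<in> fst c" for \<gamma>
  proof -
    note d = smooth_curve_atD[OF sc[OF \<gamma>(1) I(2)] c(1) \<gamma>(2)]
    have "\<forall>\<^sub>F s in nhds t. (z \<gamma> has_vector_derivative H (z \<gamma> s)) (at s)"
      using d(1) smooth_near_eventually[OF d(2)] eventually_nhds_in_open[OF I]
    proof eventually_elim
      case (elim s)
      have "(let x = (\<lambda>s. snd c (\<gamma> s)); x' = (\<lambda>s. vector_derivative x (at s)) in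
             vector_derivative x' (at s) + christoffel \<A> g c (x s) (x' s) (x' s) = 0)"
        using \<gamma>(1) elim c(1) unfolding geodesic_def by blast
      then have "fd (\<lambda>s. fd (\<lambda>s. snd c (\<gamma> s)) s 1) s 1
          = - christoffel_of ?G (snd c (\<gamma> s)) (fd (\<lambda>s. snd c (\<gamma> s)) s 1) (fd (\<lambda>s. snd c (\<gamma> s)) s 1)"
        unfolding Let_def vector_derivative2_eq_fd[OF elim(2)] vector_derivative_eq_fd[OF elim(2)] christoffel_eq_of
        by (simp add: eq_neg_iff_add_eq_0)
      then show ?case
        using has_vector_derivative_Pair[OF smooth_near_has_vector_derivative[OF elim(2)]
            smooth_near_has_vector_derivative[OF smooth_near_fd[OF elim(2), of 1]]]
        by (simp add: z_def H_def)
    qed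
    with d(1) show ?thesis by simp
  qed
  have v: "fd (\<lambda>s. snd c (\<gamma>1 s)) t 1 = fd (\<lambda>s. snd c (\<gamma>2 s)) t 1"
    using eq velocity_eq_tvec[OF sc[OF geo(1) I(2)] c] velocity_eq_tvec[OF sc[OF geo(2) I(2)] c(1)] c
      tvec_inj[OF c] by metis
  have "smooth_near H (z \<gamma>1 t)"
    unfolding H_def z_def using smooth_near_christoffel[OF G, of "snd c (\<gamma>1 t)"] c(2)
    by (intro smooth_near_Pair smooth_near_snd smooth_near_id smooth_near_minus) auto
  then have "\<forall>\<^sub>F s in nhds t. z \<gamma>1 s = z \<gamma>2 s"
    using ev[OF geo(1) c(2)] ev[OF geo(2)] c(2) eq(1) v
    by (intro ode_unique_local[OF frame_Basis, of H]) (auto simp: z_def)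
  moreover have "\<forall>\<^sub>F s in nhds t. \<gamma>1 s \<in> fst c" "\<forall>\<^sub>F s in nhds t. \<gamma>2 s \<in> fst c"
    using ev[OF geo(1) c(2)] ev[OF geo(2)] c(2) eq(1) by auto
  ultimately show ?thesis
    by eventually_elim (metis z_def fst_conv is_chartD(4)[OF chart[OF c(1)]])
qed

lemma smooth_curve_isCont:
  assumes "smooth_curve_at \<A> t \<gamma>" "open U" "\<gamma> t \<in> U"
  shows "\<forall>\<^sub>F s in nhds t. \<gamma> s \<in> U"
proof -
  obtain c where c: "c \<in> \<A>" "\<forall>\<^sub>F s in nhds t. \<gamma> s \<in> fst c" "smooth_near (\<lambda>s. snd c (\<gamma> s)) t"
    using smooth_curve_atE[OF assms(1)] by metis
  have "\<gamma> t \<in> M" using eventually_nhds_x_imp_x[OF c(2)] is_chartD(2)[OF chart[OF c(1)]] by auto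
  then have "\<forall>\<^sub>F s in nhds t. \<gamma> s \<in> M \<inter> U"
    using map_eventually_in[OF chart[OF c(1)] c(2) smooth_near_isCont[OF c(3)], of "M \<inter> U"] assms by auto
  then show ?thesis by (rule eventually_mono) auto
qed

text \<open>The truth value of coincidence of position and velocity is locally constant, hence
  constant on the connected set I. Coincidence persists by local uniqueness; failure persists by
  continuity.\<close>

lemma geodesic_unique:
  assumes g: "pseudo_riemannian M \<A> g" and I: "open I" "connected I" "t0 \<in> I" "t \<in> I"
    and geo: "geodesic \<A> g I \<gamma>1" "geodesic \<A> g I \<gamma>2"
    and eq: "\<gamma>1 t0 = \<gamma>2 t0" "velocity \<A> \<gamma>1 t0 = velocity \<A> \<gamma>2 t0"
  shows "\<gamma>1 t = \<gamma>2 t"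
proof -
  let ?Q = "\<lambda>s. \<gamma>1 s = \<gamma>2 s \<and> velocity \<A> \<gamma>1 s = velocity \<A> \<gamma>2 s"
  have "\<forall>\<^sub>F s in nhds r. ?Q r = ?Q s" if r: "r \<in> I" for r
  proof -
    have sc: "smooth_curve_at \<A> r \<gamma>1" "smooth_curve_at \<A> r \<gamma>2" using geo r by (auto simp: geodesic_def)
    obtain c where c: "c \<in> \<A>" "\<gamma>1 r \<in> fst c"
      using smooth_curve_atE[OF sc(1)] eventually_nhds_x_imp_x by metis
    consider "?Q r" | "\<gamma>1 r \<noteq> \<gamma>2 r" | "\<gamma>1 r = \<gamma>2 r" "velocity \<A> \<gamma>1 r \<noteq> velocity \<A> \<gamma>2 r" by blast
    then show ?thesis
    proof cases
      case 1
      then have "\<forall>\<^sub>F s in nhds r. \<gamma>1 s = \<gamma>2 s"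
        by (intro geodesic_unique_local[OF g I(1) r geo _ _ c]) auto
      then have "\<forall>\<^sub>F s in nhds r. \<forall>\<^sub>F s in nhds s. \<gamma>1 s = \<gamma>2 s" by (simp add: eventually_eventually)
      then show ?thesis
      proof (rule eventually_mono)
        fix s assume s: "\<forall>\<^sub>F s in nhds s. \<gamma>1 s = \<gamma>2 s"
        show "?Q r = ?Q s"
          using 1 velocity_cong[OF s] eventually_nhds_x_imp_x[OF s] by simp
      qed
    next
      \<comment> \<open>Different positions remain different by the Hausdorff property.\<close>
      case 2
      then obtain U V where U: "open U" "open V" "\<gamma>1 r \<in> U" "\<gamma>2 r \<in> V" "U \<inter> V = {}"
        using hausdorff by metis
      have "\<forall>\<^sub>F s in nhds r. \<gamma>1 s \<in> U" "\<forall>\<^sub>F s in nhds r. \<gamma>2 s \<in> V"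
        using smooth_curve_isCont sc U by blast+
      then show ?thesis by eventually_elim (use 2 U(5) in auto)
    next
      \<comment> \<open>At a common position the coordinate velocities in one chart differ, and they
        still do nearby; wherever the curves meet there, this separates the velocities.\<close>
      case 3
      have c2: "\<gamma>2 r \<in> fst c" using c 3 by simp
      note d1 = smooth_curve_atD[OF sc(1) c] and d2 = smooth_curve_atD[OF sc(2) c(1) c2]
      let ?v1 = "\<lambda>s. fd (\<lambda>s. snd c (\<gamma>1 s)) s 1" and ?v2 = "\<lambda>s. fd (\<lambda>s. snd c (\<gamma>2 s)) s 1"
      have "?v1 r - ?v2 r \<noteq> 0"
        using 3 velocity_eq_tvec[OF sc(1) c] velocity_eq_tvec[OF sc(2) c(1) c2] by auto
      moreover have "isCont (\<lambda>s. ?v1 s - ?v2 s) r"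
        by (intro smooth_near_isCont smooth_near_diff smooth_near_fd d1 d2)
      ultimately have "\<forall>\<^sub>F s in nhds r. ?v1 s - ?v2 s \<in> UNIV - {0}"
        by (intro topological_tendstoD[OF isCont_tendsto_nhds]) auto
      moreover have "\<forall>\<^sub>F s in nhds r. s \<in> I" by (rule eventually_nhds_in_open[OF I(1) r])
      ultimately show ?thesis using d1(1) d2(1)
      proof eventually_elim
        case (elim s)
        have "velocity \<A> \<gamma>1 s \<noteq> velocity \<A> \<gamma>2 s" if "\<gamma>1 s = \<gamma>2 s"
        proof -
          have s: "smooth_curve_at \<A> s \<gamma>1" "smooth_curve_at \<A> s \<gamma>2"
            using geo elim by (auto simp: geodesic_def)
          show ?thesis
            using velocity_eq_tvec[OF s(1) c(1) elim(3)] velocity_eq_tvec[OF s(2) c(1) elim(4)]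
              tvec_inj[OF c(1) elim(3)] elim(1) that by fastforce
        qed
        then show ?case using 3 by auto
      qed
    qed
  qed
  then have "\<forall>r\<in>I. \<forall>\<^sub>F s in at r within I. ?Q r = ?Q s"
    unfolding eventually_at_filter by (blast intro: eventually_mono)
  then have "?Q t0 = ?Q t" by (rule connected_local_const[OF I(2-4)])
  then show ?thesis using eq by blast
qed

end

section \<open>Level sets of homogeneous pairs\<close>

lemma chart_inv_prod:
  assumes "inj_on (snd c) (fst c)" "inj_on (snd d) (fst d)" "x \<in> snd c ` fst c" "y \<in> snd d ` fst d"
  shows "chart_inv (fst c \<times> fst d, map_prod (snd c) (snd d)) (x, y) = (chart_inv c x, chart_inv d y)"
proof -
  have "inj_on (map_prod (snd c) (snd d)) (fst c \<times> fst d)"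
    using assms(1,2) by (auto simp: inj_on_def)
  then show ?thesis
    using assms(3,4) by (auto intro!: inv_into_f_eq inv_into_into simp: f_inv_into_f)
qed

lemma chart_inj: "is_chart S c \<Longrightarrow> inj_on (snd c) (fst c)"
  by (metis inj_on_inverseI is_chartD(4))

section \<open>Smoothly included subsets\<close>

text \<open>Isolates smoothness of the inclusion from injectivity of its differential, so that it
  can be used while a chart of the level set is still being constructed.\<close>

definition (in manifold) smooth_param :: "'a set \<Rightarrow> ('a, 'f::real_inner) chart \<Rightarrow> bool" where
  "smooth_param S d \<longleftrightarrow> is_chart S d \<and> (\<forall>p\<in>fst d. smooth_map_at {d} \<A> p id)"

context manifold begin

lemma smooth_paramD:
  fixes d :: "('a, 'f::real_inner) chart"
  assumes d: "smooth_param S d" and w: "w \<in> snd d ` fst d" and c: "c \<in> \<A>" "chart_inv d w \<in> fst c"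
  shows "\<forall>\<^sub>F y in nhds w. chart_inv d y \<in> fst c" "smooth_near (\<lambda>y. snd c (chart_inv d y)) w"
proof -
  have ch: "is_chart S d" using d by (simp add: smooth_param_def)
  have "smooth_map_at {d} \<A> (chart_inv d w) id"
    using d is_chartD(5)[OF ch w] by (simp add: smooth_param_def)
  then obtain c' where c': "c' \<in> \<A>" "\<forall>\<^sub>F x in nhds w. chart_inv d x \<in> fst c'"
    "smooth_near (\<lambda>x. snd c' (chart_inv d x)) w"
    by (rule smooth_map_atE) (auto simp: is_chartD(6)[OF ch w])
  show "\<forall>\<^sub>F y in nhds w. chart_inv d y \<in> fst c" "smooth_near (\<lambda>y. snd c (chart_inv d y)) w"
    using smooth_change_target[where d = c' and F = "chart_inv d" and x = w and c = c] c' c by auto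
qed

lemma smooth_curve_param:
  fixes d :: "('a, 'f::real_inner) chart"
  assumes B: "frame (B :: 'f set)" and d: "smooth_param S d"
    and \<gamma>: "\<forall>\<^sub>F s in nhds t. \<gamma> s \<in> fst d" "smooth_near (\<lambda>s. snd d (\<gamma> s)) t"
  shows "smooth_curve_at \<A> t \<gamma>"
    and "c \<in> \<A> \<Longrightarrow> \<gamma> t \<in> fst c \<Longrightarrow>
      fd (\<lambda>s. snd c (\<gamma> s)) t 1 = fd (\<lambda>y. snd c (chart_inv d y)) (snd d (\<gamma> t)) (fd (\<lambda>s. snd d (\<gamma> s)) t 1)"
proof -
  have ch: "is_chart S d" using d by (simp add: smooth_param_def)
  have dt: "\<gamma> t \<in> fst d" by (rule eventually_nhds_x_imp_x[OF \<gamma>(1)])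
  have ev: "\<forall>\<^sub>F s in nhds t. chart_inv d (snd d (\<gamma> s)) = \<gamma> s"
    using \<gamma>(1) by (rule eventually_mono) (rule is_chartD(4)[OF ch])
  have inv: "chart_inv d (snd d (\<gamma> t)) = \<gamma> t" by (rule eventually_nhds_x_imp_x[OF ev])
  have main: "(\<forall>\<^sub>F s in nhds t. \<gamma> s \<in> fst c) \<and> smooth_near (\<lambda>s. snd c (\<gamma> s)) t \<and>
      fd (\<lambda>s. snd c (\<gamma> s)) t 1 = fd (\<lambda>y. snd c (chart_inv d y)) (snd d (\<gamma> t)) (fd (\<lambda>s. snd d (\<gamma> s)) t 1)"
    if c: "c \<in> \<A>" "\<gamma> t \<in> fst c" for c
  proof (intro conjI)
    have w: "snd d (\<gamma> t) \<in> snd d ` fst d" "chart_inv d (snd d (\<gamma> t)) \<in> fst c" using dt inv c by auto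
    note p = smooth_paramD[OF d w(1) c(1) w(2)]
    have "\<forall>\<^sub>F s in nhds t. chart_inv d (snd d (\<gamma> s)) \<in> fst c"
      by (rule eventually_nhds_compose[OF smooth_near_isCont[OF \<gamma>(2)] p(1)])
    with ev show "\<forall>\<^sub>F s in nhds t. \<gamma> s \<in> fst c" by eventually_elim simp
    have ev': "\<forall>\<^sub>F s in nhds t. snd c (\<gamma> s) = snd c (chart_inv d (snd d (\<gamma> s)))"
      using ev by (rule eventually_mono) simp
    show "smooth_near (\<lambda>s. snd c (\<gamma> s)) t"
      "fd (\<lambda>s. snd c (\<gamma> s)) t 1 = fd (\<lambda>y. snd c (chart_inv d y)) (snd d (\<gamma> t)) (fd (\<lambda>s. snd d (\<gamma> s)) t 1)"
      by (rule curve_compose(1,2)[OF B p(2) \<gamma>(2) ev'])+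
  qed
  have "smooth_map_at {d} \<A> (\<gamma> t) id" using d dt by (simp add: smooth_param_def)
  then obtain c0 where c0: "c0 \<in> \<A>" "\<forall>\<^sub>F x in nhds (snd d (\<gamma> t)). chart_inv d x \<in> fst c0"
    by (rule smooth_map_atE) auto
  have "\<gamma> t \<in> fst c0" using eventually_nhds_x_imp_x[OF c0(2)] inv by simp
  with c0(1)
  show "smooth_curve_at \<A> t \<gamma>" using main smooth_curve_atI by metis
  show "c \<in> \<A> \<Longrightarrow> \<gamma> t \<in> fst c \<Longrightarrow>
      fd (\<lambda>s. snd c (\<gamma> s)) t 1 = fd (\<lambda>y. snd c (chart_inv d y)) (snd d (\<gamma> t)) (fd (\<lambda>s. snd d (\<gamma> s)) t 1)"
    using main by blast
qed

text \<open>A function smooth on the ambient manifold near the point restricts to one smooth for d.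
  Hence the conditionals in \<open>push\<close> and \<open>velocity\<close> take the same
  branch.\<close>

lemma push_velocity:
  fixes d :: "('a, 'f::real_inner) chart"
  assumes d: "smooth_param S d" "d \<in> \<C>" and t: "\<gamma> t \<in> fst d"
  shows "push \<A> id (\<gamma> t) (velocity \<C> \<gamma> t) = velocity \<A> \<gamma> t"
proof -
  have ch: "is_chart S d" using d by (simp add: smooth_param_def)
  have inv: "chart_inv d (snd d (\<gamma> t)) = \<gamma> t" by (rule is_chartD(4)[OF ch t])
  have *: "smooth_fun_at \<C> (\<gamma> t) h" if h: "smooth_fun_at \<A> (\<gamma> t) h" for h
  proof -
    obtain c where c: "c \<in> \<A>" "\<gamma> t \<in> fst c" "smooth_near (\<lambda>x. h (chart_inv c x)) (snd c (\<gamma> t))"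
      using smooth_fun_atE[OF h] by metis
    have w: "snd d (\<gamma> t) \<in> snd d ` fst d" "chart_inv d (snd d (\<gamma> t)) \<in> fst c" using t inv c by auto
    note p = smooth_paramD[OF d(1) w(1) c(1) w(2)]
    have "smooth_near (\<lambda>y. h (chart_inv c (snd c (chart_inv d y)))) (snd d (\<gamma> t))"
      by (rule smooth_near_compose[OF frame_Basis _ p(2), of "\<lambda>x. h (chart_inv c x)"]) (simp add: inv c(3))
    then have "smooth_near (\<lambda>y. h (chart_inv d y)) (snd d (\<gamma> t))"
      by (rule smooth_near_cong) (use p(1) in \<open>auto elim!: eventually_mono simp: is_chartD(4)[OF chart[OF c(1)]]\<close>)
    then show ?thesis by (rule smooth_fun_atI[OF d(2) ch t])
  qed
  show ?thesis
  proof
    fix h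
    show "push \<A> id (\<gamma> t) (velocity \<C> \<gamma> t) h = velocity \<A> \<gamma> t h"
      using *[of h] by (simp add: push_def velocity_def)
  qed
qed

lemma push_coord_vec:
  fixes d :: "('a, 'f::real_inner) chart"
  assumes B: "frame (B :: 'f set)" and d: "smooth_param S d" "d \<in> \<C>" and w: "w \<in> snd d ` fst d"
    and c: "c \<in> \<A>" "chart_inv d w \<in> fst c"
  shows "push \<A> id (chart_inv d w) (coord_vec \<C> d w u)
    = tvec \<A> c (chart_inv d w) (fd (\<lambda>y. snd c (chart_inv d y)) w u)"
proof -
  let ?\<gamma> = "\<lambda>s::real. chart_inv d (w + s *\<^sub>R u)"
  have ch: "is_chart S d" using d by (simp add: smooth_param_def)
  note l = chart_line[OF ch w, of u]
  have 0: "?\<gamma> 0 = chart_inv d w" by simp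
  note sc = smooth_curve_param[OF B d(1) l(1,2)]
  have "push \<A> id (?\<gamma> 0) (velocity \<C> ?\<gamma> 0) = velocity \<A> ?\<gamma> 0"
    by (rule push_velocity[OF d]) (rule eventually_nhds_x_imp_x[OF l(1)])
  also have "\<dots> = tvec \<A> c (?\<gamma> 0) (fd (\<lambda>s. snd c (?\<gamma> s)) 0 1)"
    by (rule velocity_eq_tvec[OF sc(1) c(1)]) (simp add: c)
  also have "fd (\<lambda>s. snd c (?\<gamma> s)) 0 1 = fd (\<lambda>y. snd c (chart_inv d y)) (snd d (?\<gamma> 0)) u"
    using sc(2)[OF c(1)] c(2) l(3) by simp
  finally show ?thesis by (simp add: coord_vec_def is_chartD(6)[OF ch w] id_def)
qed

text \<open>Equal images under the coordinate differential give equal pushed coordinate vectors. The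
  immersion property cancels the push, and the coordinate function in direction u - v separates the
  vectors that remain.\<close>

lemma immersion_inj:
  fixes d :: "('a, 'f::real_inner) chart"
  assumes B: "frame (B :: 'f set)" and d: "smooth_param S d"
    and inj: "\<And>p. p \<in> fst d \<Longrightarrow> inj_on (push \<A> id p) (tangent_space {d} p)"
    and w: "w \<in> snd d ` fst d" and c: "c \<in> \<A>" "chart_inv d w \<in> fst c"
  shows "inj (fd (\<lambda>y. snd c (chart_inv d y)) w)"
proof -
  have ch: "is_chart S d" using d by (simp add: smooth_param_def)
  have p: "chart_inv d w \<in> fst d" by (rule is_chartD(5)[OF ch w])
  show ?thesis
  proof (rule injI)
    fix u v assume eq: "fd (\<lambda>y. snd c (chart_inv d y)) w u = fd (\<lambda>y. snd c (chart_inv d y)) w v"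
    have ts: "coord_vec {d} d w u \<in> tangent_space {d} (chart_inv d w)" for u
      using smooth_curve_atI[OF _ chart_line(1,2)[OF ch w, of u]]
      unfolding coord_vec_def tangent_space_def by fastforce
    have "coord_vec {d} d w u = coord_vec {d} d w v"
      using inj_onD[OF inj[OF p] _ ts ts, of u v] eq push_coord_vec[OF B d _ w c, of "{d}"] by simp
    moreover have "coord_vec {d} d w u (\<lambda>q. snd d q \<bullet> (a - b)) = u \<bullet> (a - b)" for u a b
    proof -
      have ev: "\<forall>\<^sub>F x in nhds w. x \<bullet> (a - b) = snd d (chart_inv d x) \<bullet> (a - b)"
        using is_chartD(1)[OF ch] w
        by (intro eventually_mono[OF eventually_nhds_in_open[of "snd d ` fst d"]]) (simp_all add: is_chartD(6)[OF ch])
      have sm: "smooth_near (\<lambda>x. x \<bullet> (a - b)) w" by (intro smooth_near_inner smooth_near_id smooth_near_const)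
      have "((\<lambda>x. x \<bullet> (a - b)) has_derivative (\<lambda>w. w \<bullet> (a - b))) (at w)"
        by (auto intro!: derivative_eq_intros)
      then have f: "fd (\<lambda>x. snd d (chart_inv d x) \<bullet> (a - b)) w = (\<lambda>w. w \<bullet> (a - b))"
        unfolding fd_cong_eventually[OF ev, symmetric] by (rule fd_eqI)
      note l = chart_line[OF ch w, of u]
      show ?thesis
        unfolding coord_vec_def
        using velocity_chart[where c = d and \<A> = "{d}" and S = S and t = 0
            and \<gamma> = "\<lambda>s. chart_inv d (w + s *\<^sub>R u)" and h = "\<lambda>q. snd d q \<bullet> (a - b)"]
          ch l smooth_near_cong[OF sm ev] by (simp add: is_chartD(6)[OF ch w] f)
    qed
    ultimately have "u \<bullet> (u - v) = v \<bullet> (u - v)" by metis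
    then have "(u - v) \<bullet> (u - v) = 0" unfolding inner_diff_left[of u v] by simp
    then show "u = v" by simp
  qed
qed

end

section \<open>The action, its generator and the potential\<close>

text \<open>The basis D states codimension one without forcing \<open>'f\<close> into the class of
  Euclidean spaces. That class demands a nonempty basis and would exclude the level sets of a
  one-dimensional manifold.\<close>

locale homogeneous = manifold M \<A>
  for M :: "'a::{t2_space,second_countable_topology} set" and \<A> :: "('a, 'e::euclidean_space) chart set" +
  fixes m :: "real \<Rightarrow> 'a \<Rightarrow> 'a" and g :: "'a metric_tensor" and f :: "'a \<Rightarrow> real" and \<alpha> l :: real
    and D :: "'f::real_inner set"
  assumes action: "free_smooth_action M \<A> m" and pair: "homogeneous_pair M \<A> m g f \<alpha>" and l: "l > 0"
    and D: "finite D" "independent D" "span D = UNIV" "card D + 1 = DIM('e)"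
begin

definition "M\<^sub>l = {x \<in> M. f x = l}"

definition sub_atlas :: "('a, 'f) chart set" where "sub_atlas = submanifold_atlas \<A> M\<^sub>l"

definition frm :: "'f set" where "frm = (SOME B. frame B)"

lemma frm: "frame frm"
  unfolding frm_def by (rule someI_ex) (use frame_exists[OF D(1,3)] in blast)

lemma m_in: "r > 0 \<Longrightarrow> x \<in> M \<Longrightarrow> m r x \<in> M"
  and m_1: "x \<in> M \<Longrightarrow> m 1 x = x"
  and m_mult: "r > 0 \<Longrightarrow> s > 0 \<Longrightarrow> x \<in> M \<Longrightarrow> m (r * s) x = m r (m s x)"
  using action by (auto simp: free_smooth_action_def)

lemma \<alpha>: "\<alpha> \<noteq> 0" and g: "pseudo_riemannian M \<A> g"
  and f_smooth: "p \<in> M \<Longrightarrow> smooth_fun_at \<A> p f" and f_pos: "p \<in> M \<Longrightarrow> f p > 0"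
  and f_m: "r > 0 \<Longrightarrow> p \<in> M \<Longrightarrow> f (m r p) = r powr \<alpha> * f p"
  and g_m: "r > 0 \<Longrightarrow> p \<in> M \<Longrightarrow> X \<in> tangent_space \<A> p \<Longrightarrow> Y \<in> tangent_space \<A> p \<Longrightarrow>
    g (m r p) (push \<A> (m r) p X) (push \<A> (m r) p Y) = r powr \<alpha> * g p X Y"
  and g_generator: "p \<in> M \<Longrightarrow> X \<in> tangent_space \<A> p \<Longrightarrow> g p (generator \<A> m p) X = X f"
  using pair by (auto simp: homogeneous_pair_def pullback_def)

lemma chart_in_M: "c \<in> \<A> \<Longrightarrow> p \<in> fst c \<Longrightarrow> p \<in> M"
  using is_chartD(2)[OF chart] by blast

text \<open>Both the scale and the point may depend on a parameter: this one rule covers the orbits,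
  the individual maps \<open>m r\<close> and the flow box.\<close>

lemma action_smooth:
  fixes q :: "'x::real_normed_vector \<Rightarrow> 'a"
  assumes r: "smooth_near r x" "r x > 0"
    and d: "d \<in> \<A>" "\<forall>\<^sub>F y in nhds x. q y \<in> fst d" "smooth_near (\<lambda>y. snd d (q y)) x"
    and c: "c \<in> \<A>" "m (r x) (q x) \<in> fst c"
  shows "\<forall>\<^sub>F y in nhds x. m (r y) (q y) \<in> fst c" "smooth_near (\<lambda>y. snd c (m (r y) (q y))) x"
proof -
  have qM: "q x \<in> M" using chart_in_M[OF d(1) eventually_nhds_x_imp_x[OF d(2)]] .
  have "smooth_map_at (prod_atlas (id_atlas {0<..}) \<A>) \<A> (r x, q x) (\<lambda>(r, x). m r x)"
    using action r qM by (simp add: free_smooth_action_def)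
  then obtain C c' where C: "C \<in> prod_atlas (id_atlas {0<..}) \<A>" and c': "c' \<in> \<A>" and inC: "(r x, q x) \<in> fst C"
    and ev: "\<forall>\<^sub>F z in nhds (snd C (r x, q x)). (\<lambda>(r, x). m r x) (chart_inv C z) \<in> fst c'"
    and sm: "smooth_near (\<lambda>z. snd c' ((\<lambda>(r, x). m r x) (chart_inv C z))) (snd C (r x, q x))"
    by (rule smooth_map_atE)
  \<comment> \<open>A chart of the product atlas is the identity in the scale, so only the chart of
    the point has to be changed.\<close>
  obtain c1 where c1: "c1 \<in> \<A>" "C = ({0<..} \<times> fst c1, map_prod id (snd c1))"
    using C by (auto simp: prod_atlas_def id_atlas_def)
  have inv: "chart_inv C (a, y) = (a, chart_inv c1 y)" if "a > 0" "y \<in> snd c1 ` fst c1" for a y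
    using chart_inv_prod[of "({0<..}, id)" c1 a y] chart_inj[OF chart[OF c1(1)]] that
    by (simp add: c1(2) inv_into_f_eq[of id "{0<..}" a a])
  have qc1: "q x \<in> fst c1" using inC c1 by auto
  note q1 = smooth_change_target[OF d c1(1) qc1]
  let ?z = "\<lambda>y. (r y, snd c1 (q y))"
  have z: "smooth_near ?z x" by (rule smooth_near_Pair[OF r(1) q1(2)])
  have zx: "snd C (r x, q x) = ?z x" using c1 by simp
  have "\<forall>\<^sub>F y in nhds x. r y \<in> {0<..}"
    using smooth_near_isCont[OF r(1)] r(2) by (intro topological_tendstoD[OF isCont_tendsto_nhds]) auto
  with q1(1) have eq: "\<forall>\<^sub>F y in nhds x. (\<lambda>(r, x). m r x) (chart_inv C (?z y)) = m (r y) (q y)"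
    by eventually_elim (simp add: inv is_chartD(4)[OF chart[OF c1(1)]])
  have "\<forall>\<^sub>F y in nhds x. (\<lambda>(r, x). m r x) (chart_inv C (?z y)) \<in> fst c'"
    by (rule eventually_nhds_compose[OF smooth_near_isCont[OF z]]) (use ev zx in simp)
  with eq have 1: "\<forall>\<^sub>F y in nhds x. m (r y) (q y) \<in> fst c'" by eventually_elim simp
  have "smooth_near (\<lambda>y. snd c' ((\<lambda>(r, x). m r x) (chart_inv C (?z y)))) x"
    by (rule smooth_near_compose[OF frame_Basis _ z, of "\<lambda>z. snd c' ((\<lambda>(r, x). m r x) (chart_inv C z))"]) (use sm zx in simp)
  then have 2: "smooth_near (\<lambda>y. snd c' (m (r y) (q y))) x"
    by (rule smooth_near_cong) (use eq in \<open>auto elim!: eventually_mono\<close>)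
  show "\<forall>\<^sub>F y in nhds x. m (r y) (q y) \<in> fst c" "smooth_near (\<lambda>y. snd c (m (r y) (q y))) x"
    using smooth_change_target[where d = c' and F = "\<lambda>y. m (r y) (q y)" and x = x and c = c] c' 1 2 c by auto
qed

lemma push_action_velocity:
  assumes r: "r > 0" and \<gamma>: "smooth_curve_at \<A> t \<gamma>"
  shows "push \<A> (m r) (\<gamma> t) (velocity \<A> \<gamma> t) = velocity \<A> (\<lambda>s. m r (\<gamma> s)) t"
proof -
  obtain d where d: "d \<in> \<A>" "\<forall>\<^sub>F s in nhds t. \<gamma> s \<in> fst d" "smooth_near (\<lambda>s. snd d (\<gamma> s)) t"
    using smooth_curve_atE[OF \<gamma>] by metis
  have p: "\<gamma> t \<in> fst d" by (rule eventually_nhds_x_imp_x[OF d(2)])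
  then obtain c where c: "c \<in> \<A>" "m r (\<gamma> t) \<in> fst c"
    using chart_exists[OF m_in[OF r chart_in_M[OF d(1) p]]] by blast
  have *: "smooth_fun_at \<A> (\<gamma> t) (\<lambda>q. h (m r q))" if h: "smooth_fun_at \<A> (m r (\<gamma> t)) h" for h
  proof -
    have inv: "chart_inv d (snd d (\<gamma> t)) = \<gamma> t" by (rule is_chartD(4)[OF chart[OF d(1)] p])
    have ev: "\<forall>\<^sub>F x in nhds (snd d (\<gamma> t)). x \<in> snd d ` fst d"
      by (rule chart_eventually_in[OF chart[OF d(1)] p])
    have sm: "smooth_near (\<lambda>x. snd d (chart_inv d x)) (snd d (\<gamma> t))"
      by (rule smooth_near_cong[OF smooth_near_id]) (use ev in \<open>auto elim!: eventually_mono simp: is_chartD(6)[OF chart[OF d(1)]]\<close>)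
    have "\<forall>\<^sub>F x in nhds (snd d (\<gamma> t)). chart_inv d x \<in> fst d"
      using ev by (rule eventually_mono) (rule is_chartD(5)[OF chart[OF d(1)]])
    note a = action_smooth[OF smooth_near_const r d(1) this sm c(1)]
    have a1: "\<forall>\<^sub>F y in nhds (snd d (\<gamma> t)). m r (chart_inv d y) \<in> fst c"
      and a2: "smooth_near (\<lambda>y. snd c (m r (chart_inv d y))) (snd d (\<gamma> t))"
      using a inv c by auto
    have "smooth_near (\<lambda>y. h (chart_inv c (snd c (m r (chart_inv d y))))) (snd d (\<gamma> t))"
      by (rule smooth_near_compose[OF frame_Basis _ a2, of "\<lambda>x. h (chart_inv c x)"])
        (use h smooth_fun_at_iff[OF c] inv in auto)
    then have "smooth_near (\<lambda>y. h (m r (chart_inv d y))) (snd d (\<gamma> t))"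
      by (rule smooth_near_cong) (use a1 in \<open>auto elim!: eventually_mono simp: is_chartD(4)[OF chart[OF c(1)]]\<close>)
    then show ?thesis by (simp add: smooth_fun_at_iff[OF d(1) p])
  qed
  show ?thesis
  proof
    fix h
    show "push \<A> (m r) (\<gamma> t) (velocity \<A> \<gamma> t) h = velocity \<A> (\<lambda>s. m r (\<gamma> s)) t h"
      using *[of h] by (simp add: push_def velocity_def)
  qed
qed

definition gen_coord :: "('a, 'e) chart \<Rightarrow> 'a \<Rightarrow> 'e" where
  "gen_coord c p = fd (\<lambda>t. snd c (m (exp t) p)) 0 1"

lemma orbit_smooth:
  assumes c: "c \<in> \<A>" "p \<in> fst c"
  shows "\<forall>\<^sub>F t in nhds 0. m (exp t) p \<in> fst c" "smooth_near (\<lambda>t. snd c (m (exp t) p)) 0"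
proof -
  have "m (exp 0) p \<in> fst c" using m_1[OF chart_in_M[OF c]] c by simp
  then show "\<forall>\<^sub>F t in nhds 0. m (exp t) p \<in> fst c" "smooth_near (\<lambda>t. snd c (m (exp t) p)) 0"
    using action_smooth[of exp 0 c "\<lambda>_. p" c] c smooth_near_exp smooth_near_const by auto
qed

lemma generator_eq:
  assumes c: "c \<in> \<A>" "p \<in> fst c"
  shows "generator \<A> m p = tvec \<A> c p (gen_coord c p)" "generator \<A> m p f = \<alpha> * f p"
    "smooth_curve_at \<A> 0 (\<lambda>t. m (exp t) p)"
proof -
  show sc: "smooth_curve_at \<A> 0 (\<lambda>t. m (exp t) p)"
    by (rule smooth_curve_atI[OF c(1) orbit_smooth[OF c]])
  have 1: "m 1 p = p" by (rule m_1[OF chart_in_M[OF c]])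
  show "generator \<A> m p = tvec \<A> c p (gen_coord c p)"
    using velocity_eq_tvec[OF sc c(1)] c(2) 1 by (simp add: generator_def gen_coord_def)
  \<comment> \<open>Euler's identity for homogeneous functions: along the orbit, f is
    \<open>exp (\<alpha> * t) * f p\<close>.\<close>
  have "((\<lambda>t. f (m (exp t) p)) has_real_derivative \<alpha> * f p) (at 0)"
  proof -
    have "((\<lambda>t. exp (\<alpha> * t) * f p) has_real_derivative \<alpha> * f p) (at 0)"
      by (auto intro!: derivative_eq_intros)
    moreover have "f (m (exp t) p) = exp (\<alpha> * t) * f p" for t
      using f_m[of "exp t" p] chart_in_M[OF c] by (simp add: powr_def)
    ultimately show ?thesis by simp
  qed
  then show "generator \<A> m p f = \<alpha> * f p"
    using f_smooth[OF chart_in_M[OF c]] 1 by (simp add: generator_def velocity_def DERIV_imp_deriv)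
qed

definition loc_f :: "('a, 'e) chart \<Rightarrow> 'e \<Rightarrow> real" where "loc_f c x = f (chart_inv c x)"

lemma tvec_f:
  assumes c: "c \<in> \<A>" "p \<in> fst c"
  shows "tvec \<A> c p u f = fd (loc_f c) (snd c p) u" "smooth_near (loc_f c) (snd c p)"
  using f_smooth[OF chart_in_M[OF c]] smooth_fun_at_iff[OF c, of f]
  by (simp_all add: tvec_def loc_f_def[abs_def])

text \<open>The two parts combine to g(P,P) = \<alpha> f, the source of the constant \<alpha> l in
  the flow box metric.\<close>

lemma gen_metric:
  assumes c: "c \<in> \<A>" "p \<in> fst c"
  shows "local_metric \<A> g c (snd c p) (gen_coord c p) u = fd (loc_f c) (snd c p) u"
    and "fd (loc_f c) (snd c p) (gen_coord c p) = \<alpha> * f p"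
proof -
  have p: "snd c p \<in> snd c ` fst c" "chart_inv c (snd c p) = p"
    using c is_chartD(4)[OF chart[OF c(1)]] by auto
  show "local_metric \<A> g c (snd c p) (gen_coord c p) u = fd (loc_f c) (snd c p) u"
    unfolding local_metric_eq[OF c(1) p(1)] p(2) generator_eq(1)[OF c, symmetric]
    using g_generator[OF chart_in_M[OF c], of "tvec \<A> c p u"] tangent_space_eq[OF c] tvec_f[OF c] by auto
  show "fd (loc_f c) (snd c p) (gen_coord c p) = \<alpha> * f p"
    using tvec_f(1)[OF c, of "gen_coord c p"] generator_eq(1,2)[OF c] by simp
qed

end

section \<open>Warped products\<close>

lemma EL_cong:
  assumes "\<forall>\<^sub>F y in nhds x. \<forall>u v. G y u v = G' y u v"
  shows "EL G x v a w = EL G' x v a w"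
proof -
  have "fd (\<lambda>y. G y p q) x = fd (\<lambda>y. G' y p q) x" for p q
    by (rule fd_cong_eventually) (use assms in \<open>auto elim!: eventually_mono\<close>)
  then show ?thesis using eventually_nhds_x_imp_x[OF assms] by (simp add: EL_def)
qed

text \<open>Here p and q are the first two derivatives of a change of parameter, so that p v and q v
  + p^2 a are the new velocity and acceleration. The metric derivatives are quadratic in the
  velocity and scale by p^2; the tangential acceleration leaves the last term.\<close>

lemma EL_reparametrise:
  fixes G :: "'e::real_inner \<Rightarrow> 'e \<Rightarrow> 'e \<Rightarrow> real"
  assumes G: "metric_on S G" and x: "x \<in> S"
  shows "EL G x (p *\<^sub>R v) (q *\<^sub>R v + p\<^sup>2 *\<^sub>R a) w = p\<^sup>2 * EL G x v a w + 2 * q * G x v w"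
proof -
  note l = fd_metric_linear[OF G x]
  note m = metric_onD[OF G x]
  have 1: "fd (\<lambda>y. G y (p *\<^sub>R v) w) x (p *\<^sub>R v) = p\<^sup>2 * fd (\<lambda>y. G y v w) x v" for w
    unfolding l(3)[of "p *\<^sub>R v"] linear_scale[OF l(1)] linear_scale[OF l(2)] l(3)[of w]
    by (simp add: power2_eq_square)
  have 2: "fd (\<lambda>y. G y (p *\<^sub>R v) (p *\<^sub>R v)) x w = p\<^sup>2 * fd (\<lambda>y. G y v v) x w"
    unfolding linear_scale[OF l(1)] l(3)[of "p *\<^sub>R v"] by (simp add: power2_eq_square)
  show ?thesis
    unfolding EL_def 1 2 bilinear_ladd[OF m(1)] bilinear_lmul[OF m(1)] by (simp add: algebra_simps)
qed

text \<open>The test vector splits into a level component v and a scale component b. Their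
  coefficients become the equations for \<sigma> and for s.\<close>

lemma EL_warped:
  fixes G :: "'f::real_inner \<Rightarrow> 'f \<Rightarrow> 'f \<Rightarrow> real" and e k C s s' s'' b :: real
  assumes G: "metric_on S G" and w: "w \<in> S"
  shows "EL (\<lambda>z U V. C * exp (k * snd z) * (G (fst z) (fst U) (fst V) + e * snd U * snd V)) (w, s) (w', s') (w'', s'') (v, b)
    = C * exp (k * s) * (EL G w w' w'' v + 2 * k * s' * G w w' v
        + b * (2 * e * s'' + 2 * k * e * s'\<^sup>2 - k * G w w' w' - k * e * s'\<^sup>2))"
proof -
  \<comment> \<open>The constant r stands for the scale part \<open>e * snd U * snd V\<close>, which
    does not depend on the position.\<close>
  have 1: "fd (\<lambda>z. C * exp (k * snd z) * (G (fst z) u v + r)) (w, s) (x, a)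
      = C * exp (k * s) * (k * a * (G w u v + r) + fd (\<lambda>y. G y u v) w x)" for u v r x a
  proof -
    have "((\<lambda>y. G y u v) has_derivative fd (\<lambda>y. G y u v) w) (at (fst (w, s)))"
      using smooth_near_has_derivative[OF metric_onD(4)[OF G w]] by simp
    from has_derivative_compose[OF has_derivative_fst[OF has_derivative_ident] this]
    have "((\<lambda>z. G (fst z) u v) has_derivative (\<lambda>U. fd (\<lambda>y. G y u v) w (fst U))) (at (w, s))" .
    moreover have "((\<lambda>z::'f \<times> real. exp (k * snd z)) has_derivative (\<lambda>U. exp (k * s) * (k * snd U))) (at (w, s))"
      by (auto intro!: derivative_eq_intros)
    ultimately have "((\<lambda>z. C * exp (k * snd z) * (G (fst z) u v + r)) has_derivative
        (\<lambda>U. C * exp (k * s) * (fd (\<lambda>y. G y u v) w (fst U)) + C * (exp (k * s) * (k * snd U)) * (G w u v + r))) (at (w, s))"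
      by (auto intro!: derivative_eq_intros)
    from fd_eqI[OF this] show ?thesis by (simp add: algebra_simps)
  qed
  show ?thesis
    unfolding EL_def fst_conv snd_conv 1 by (simp add: algebra_simps power2_eq_square)
qed

lemma independent_prod:
  fixes D :: "'f::real_vector set"
  assumes D: "finite D" "independent D"
  shows "independent ((\<lambda>b. (b, 0::real)) ` D \<union> {(0, 1)})" "card ((\<lambda>b. (b, 0::real)) ` D \<union> {(0, 1)}) = card D + 1"
proof -
  have lin: "linear (\<lambda>b::'f. (b, 0::real))" by (rule linearI) auto
  have inj: "inj (\<lambda>b::'f. (b, 0::real))" by (simp add: inj_def)
  have "independent ((\<lambda>b. (b, 0::real)) ` D)"
    by (rule linear_independent_injective_image[OF lin D(2)]) (rule inj_on_subset[OF inj], simp)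
  moreover have "(0, 1) \<notin> span ((\<lambda>b. (b, 0::real)) ` D)"
    unfolding linear_span_image[OF lin] by auto
  ultimately show "independent ((\<lambda>b. (b, 0::real)) ` D \<union> {(0, 1)})"
    by (simp add: independent_insert)
  have "(0, 1) \<notin> (\<lambda>b. (b, 0::real)) ` D" by auto
  then show "card ((\<lambda>b. (b, 0::real)) ` D \<union> {(0, 1)}) = card D + 1"
    using D(1) by (simp add: card_image inj_on_def)
qed

section \<open>The induced metric of a level set\<close>

context homogeneous begin

abbreviation g_sub :: "'a metric_tensor" where "g_sub \<equiv> pullback \<A> id g"
abbreviation loc_sub :: "('a, 'f) chart \<Rightarrow> 'f \<Rightarrow> 'f \<Rightarrow> 'f \<Rightarrow> real" where
  "loc_sub \<equiv> local_metric sub_atlas g_sub"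

lemma sub_atlasD:
  assumes "d \<in> sub_atlas"
  shows "smooth_param M\<^sub>l d" "is_chart M\<^sub>l d" "\<And>p. p \<in> fst d \<Longrightarrow> inj_on (push \<A> id p) (tangent_space {d} p)"
  using assms by (auto simp: sub_atlas_def submanifold_atlas_def smooth_param_def)

lemma sub_point:
  assumes d: "d \<in> sub_atlas" and w: "w \<in> snd d ` fst d"
  shows "chart_inv d w \<in> M" "f (chart_inv d w) = l"
  using is_chartD(2)[OF sub_atlasD(2)[OF d]] is_chartD(5)[OF sub_atlasD(2)[OF d] w] by (auto simp: M\<^sub>l_def)

lemma surj_prod:
  fixes L :: "'f \<times> real \<Rightarrow> 'e"
  assumes "linear L" "inj L" shows "surj L"
  using linear_injective_card_surj[OF assms independent_prod(1)[OF D(1,2)], of Basis] independent_prod(2)[OF D(1,2)] D(4)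
  by simp

context
  fixes d :: "('a, 'f) chart" and w :: 'f
  assumes d: "d \<in> sub_atlas" and w: "w \<in> snd d ` fst d"
begin

lemma sub_local:
  assumes c: "c \<in> \<A>" "chart_inv d w \<in> fst c"
  shows "\<forall>\<^sub>F y in nhds w. chart_inv d y \<in> fst c" "smooth_near (\<lambda>y. snd c (chart_inv d y)) w"
    "inj (fd (\<lambda>y. snd c (chart_inv d y)) w)" "linear (fd (\<lambda>y. snd c (chart_inv d y)) w)"
    "\<forall>\<^sub>F y in nhds w. y \<in> snd d ` fst d"
proof -
  note s = sub_atlasD[OF d]
  show "\<forall>\<^sub>F y in nhds w. chart_inv d y \<in> fst c" and sm: "smooth_near (\<lambda>y. snd c (chart_inv d y)) w"
    using smooth_paramD[OF s(1) w c] by blast+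
  show "inj (fd (\<lambda>y. snd c (chart_inv d y)) w)" by (rule immersion_inj[OF frm s(1,3) w c])
  show "linear (fd (\<lambda>y. snd c (chart_inv d y)) w)" by (rule smooth_near_linear_fd[OF sm])
  show "\<forall>\<^sub>F y in nhds w. y \<in> snd d ` fst d"
    using is_chartD(1)[OF s(2)] w by (rule eventually_nhds_in_open)
qed

lemma loc_sub_eq:
  assumes c: "c \<in> \<A>" "chart_inv d w \<in> fst c"
  shows "loc_sub d w u v = local_metric \<A> g c (snd c (chart_inv d w))
    (fd (\<lambda>y. snd c (chart_inv d y)) w u) (fd (\<lambda>y. snd c (chart_inv d y)) w v)"
proof -
  have x: "snd c (chart_inv d w) \<in> snd c ` fst c" using c by simp
  show ?thesis
    unfolding local_metric_eq[OF c(1) x] is_chartD(4)[OF chart[OF c(1)] c(2)]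
    unfolding local_metric_def pullback_def push_coord_vec[OF frm sub_atlasD(1)[OF d] d w c] by simp
qed

lemma level_fd:
  assumes c: "c \<in> \<A>" "chart_inv d w \<in> fst c"
  shows "fd (loc_f c) (snd c (chart_inv d w)) (fd (\<lambda>y. snd c (chart_inv d y)) w u) = 0"
proof -
  note sl = sub_local[OF c]
  have ev: "\<forall>\<^sub>F y in nhds w. loc_f c (snd c (chart_inv d y)) = l"
    using sl(1,5) by eventually_elim (simp add: loc_f_def is_chartD(4)[OF chart[OF c(1)]] sub_point[OF d])
  have "fd (\<lambda>y. loc_f c (snd c (chart_inv d y))) w u = 0"
    unfolding fd_cong_eventually[OF ev] by simp
  then show ?thesis using fd_compose[of "loc_f c" "\<lambda>y. snd c (chart_inv d y)" w u] tvec_f(2)[OF c] sl(2) by simp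
qed

text \<open>The differential of f kills vectors tangent to the level set and takes the nonzero value
  \<alpha> l on P. So the sum map is injective, and equality of dimensions makes it onto.\<close>

lemma splitting:
  assumes c: "c \<in> \<A>" "chart_inv d w \<in> fst c"
  obtains u a where "x = fd (\<lambda>y. snd c (chart_inv d y)) w u + a *\<^sub>R gen_coord c (chart_inv d w)"
    "fd (loc_f c) (snd c (chart_inv d w)) x = a * (\<alpha> * l)"
proof -
  let ?p = "chart_inv d w" and ?D = "fd (\<lambda>y. snd c (chart_inv d y)) w"
  let ?F = "fd (loc_f c) (snd c ?p)"
  define N where "N = (\<lambda>U. ?D (fst U) + snd U *\<^sub>R gen_coord c ?p)"
  note sl = sub_local[OF c]
  have F: "linear ?F" by (rule smooth_near_linear_fd[OF tvec_f(2)[OF c]])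
  have FN: "?F (N (u, a)) = a * (\<alpha> * l)" for u a
    by (simp add: N_def linear_add[OF F] linear_scale[OF F] level_fd[OF c] gen_metric(2)[OF c] sub_point[OF d w])
  have lin: "linear N"
    by (rule linearI) (simp_all add: N_def linear_add[OF sl(4)] linear_scale[OF sl(4)] algebra_simps)
  have "U = 0" if "N U = 0" for U
  proof -
    have "snd U * (\<alpha> * l) = 0" using FN[of "fst U" "snd U"] that linear_0[OF F] by simp
    then have "snd U = 0" using \<alpha> l by simp
    with that have "?D (fst U) = ?D 0" by (simp add: N_def linear_0[OF sl(4)])
    then have "fst U = 0" by (rule injD[OF sl(3)])
    with \<open>snd U = 0\<close> show "U = 0" by (simp add: prod_eq_iff)
  qed
  then have "surj N" using lin by (intro surj_prod) (auto simp: linear_injective_0)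
  then obtain U where "x = N U" by (metis surjD)
  then show thesis using that[of "fst U" "snd U"] FN[of "fst U" "snd U"] by (simp add: N_def)
qed

end

text \<open>Nondegeneracy, the point at issue for an indefinite g: g(P,X) = df(X) = 0 for tangent X,
  so a vector in the radical of the restriction is orthogonal to both summands of
  \<open>splitting\<close>, hence in the radical of g.\<close>

lemma metric_on_sub:
  assumes d: "d \<in> sub_atlas"
  shows "metric_on (snd d ` fst d) (loc_sub d)"
  unfolding metric_on_def
proof (intro conjI ballI allI impI)
  note s = sub_atlasD[OF d]
  show "open (snd d ` fst d)" by (rule is_chartD(1)[OF s(2)])
  show "smooth_on (snd d ` fst d) (\<lambda>y. loc_sub d y u v)" for u v
  proof (rule smooth_onI_near)
    fix w assume w: "w \<in> snd d ` fst d"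
    obtain c where c: "c \<in> \<A>" "chart_inv d w \<in> fst c" using chart_exists sub_point(1)[OF d w] by metis
    note sl = sub_local[OF d w c]
    let ?\<phi> = "\<lambda>y. snd c (chart_inv d y)"
    have x: "?\<phi> w \<in> snd c ` fst c" using c by simp
    have "smooth_near (\<lambda>y. local_metric \<A> g c (?\<phi> y) (fd ?\<phi> y u) (fd ?\<phi> y v)) w"
      by (rule fd_metric_along(2)[OF frame_Basis metric_on_chart[OF g c(1)] x sl(2)]) (intro smooth_near_fd sl)+
    moreover have "\<forall>\<^sub>F y in nhds w. local_metric \<A> g c (?\<phi> y) (fd ?\<phi> y u) (fd ?\<phi> y v) = loc_sub d y u v"
      using sl(1,5) by eventually_elim (simp add: loc_sub_eq[OF d _ c(1)])
    ultimately show "smooth_near (\<lambda>y. loc_sub d y u v) w" by (rule smooth_near_cong)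
  qed
  fix w assume w: "w \<in> snd d ` fst d"
  obtain c where c: "c \<in> \<A>" "chart_inv d w \<in> fst c" using chart_exists sub_point(1)[OF d w] by metis
  note sl = sub_local[OF d w c] and eq = loc_sub_eq[OF d w c]
  have x: "snd c (chart_inv d w) \<in> snd c ` fst c" using c by simp
  note mm = metric_onD[OF metric_on_chart[OF g c(1)] x]
  show "loc_sub d w u v = loc_sub d w v u" for u v unfolding eq by (rule mm(2))
  show "bilinear (loc_sub d w)"
    unfolding bilinear_def eq
    by (intro conjI allI linear_compose[OF sl(4) bilinear_linear(1)[OF mm(1)], unfolded o_def]
        linear_compose[OF sl(4) bilinear_linear(2)[OF mm(1)], unfolded o_def])
  show "u = 0" if 0: "\<forall>v. loc_sub d w u v = 0" for u
  proof -
    let ?D = "fd (\<lambda>y. snd c (chart_inv d y)) w"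
    have "local_metric \<A> g c (snd c (chart_inv d w)) (?D u) x = 0" for x
    proof -
      obtain v a where "x = ?D v + a *\<^sub>R gen_coord c (chart_inv d w)" using splitting[OF d w c] by metis
      then show ?thesis
        using 0 level_fd[OF d w c, of u] gen_metric(1)[OF c, of "?D u"] mm(2)[of "?D u" "gen_coord c (chart_inv d w)"]
        by (simp add: bilinear_radd[OF mm(1)] bilinear_rmul[OF mm(1)] eq[symmetric])
    qed
    then have "?D u = ?D 0" using mm(3) linear_0[OF sl(4)] by metis
    then show "u = 0" by (rule injD[OF sl(3)])
  qed
qed

section \<open>The flow box\<close>

definition \<Phi> :: "('a, 'f) chart \<Rightarrow> 'f \<times> real \<Rightarrow> 'a" where
  "\<Phi> d z = m (exp (snd z)) (chart_inv d (fst z))"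

context
  fixes d :: "('a, 'f) chart" and w :: 'f
  assumes d: "d \<in> sub_atlas" and w: "w \<in> snd d ` fst d"
begin

lemma \<Phi>_smooth:
  assumes c: "c \<in> \<A>" "\<Phi> d (w, s) \<in> fst c"
  shows "\<forall>\<^sub>F z in nhds (w, s). \<Phi> d z \<in> fst c" "smooth_near (\<lambda>z. snd c (\<Phi> d z)) (w, s)"
proof -
  obtain c0 where c0: "c0 \<in> \<A>" "chart_inv d w \<in> fst c0" using chart_exists sub_point(1)[OF d w] by metis
  note sl = sub_local[OF d w c0]
  have "smooth_near fst (w, s)" by (rule smooth_near_fst[OF smooth_near_id])
  then have 1: "\<forall>\<^sub>F z in nhds (w, s). chart_inv d (fst z) \<in> fst c0"
    by (intro eventually_nhds_compose[where f = fst and x = "(w, s)", OF smooth_near_isCont]) (use sl(1) in simp_all)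
  have 2: "smooth_near (\<lambda>z. snd c0 (chart_inv d (fst z))) (w, s)"
    by (rule smooth_near_compose[OF frm _ smooth_near_fst[OF smooth_near_id], of "\<lambda>y. snd c0 (chart_inv d y)"])
      (use sl(2) in simp)
  have 3: "smooth_near (\<lambda>z. exp (snd z)) (w, s)"
    by (rule smooth_near_compose[OF frame_Basis smooth_near_exp smooth_near_snd[OF smooth_near_id]])
  show "\<forall>\<^sub>F z in nhds (w, s). \<Phi> d z \<in> fst c" "smooth_near (\<lambda>z. snd c (\<Phi> d z)) (w, s)"
    using action_smooth[OF 3 _ c0(1) 1 2 c(1)] c(2) by (simp_all add: \<Phi>_def)
qed

lemma \<Phi>_velocity:
  assumes c: "c \<in> \<A>" "\<Phi> d (w, s) \<in> fst c"
  shows "smooth_curve_at \<A> 0 (\<lambda>\<tau>. \<Phi> d (w + \<tau> *\<^sub>R u, s + \<tau> * a))"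
    "velocity \<A> (\<lambda>\<tau>. \<Phi> d (w + \<tau> *\<^sub>R u, s + \<tau> * a)) 0 = tvec \<A> c (\<Phi> d (w, s)) (fd (\<lambda>z. snd c (\<Phi> d z)) (w, s) (u, a))"
proof -
  let ?z = "\<lambda>\<tau>::real. (w + \<tau> *\<^sub>R u, s + \<tau> * a)"
  have z: "smooth_near ?z 0"
    by (intro smooth_near_Pair smooth_near_add smooth_near_scaleR smooth_near_mult smooth_near_const smooth_near_id)
  have "(?z has_derivative (\<lambda>\<tau>. (\<tau> *\<^sub>R u, \<tau> * a))) (at 0)"
    by (auto intro!: derivative_eq_intros)
  then have z': "fd ?z 0 1 = (u, a)" by (simp add: fd_eqI)
  have z0: "?z 0 = (w, s)" by simp
  note ph = \<Phi>_smooth[OF c, folded z0]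
  have ev: "\<forall>\<^sub>F \<tau> in nhds 0. snd c (\<Phi> d (?z \<tau>)) = snd c (\<Phi> d (?z \<tau>))" by simp
  note cc = curve_compose(1,2)[OF frame_times_real[OF frm] ph(2) z ev]
  show sc: "smooth_curve_at \<A> 0 (\<lambda>\<tau>. \<Phi> d (?z \<tau>))"
    by (rule smooth_curve_atI[OF c(1) eventually_nhds_compose[OF smooth_near_isCont[OF z] ph(1)] cc(1)])
  show "velocity \<A> (\<lambda>\<tau>. \<Phi> d (?z \<tau>)) 0 = tvec \<A> c (\<Phi> d (w, s)) (fd (\<lambda>z. snd c (\<Phi> d z)) (w, s) (u, a))"
    using velocity_eq_tvec[OF sc c(1)] c(2) cc(2) z' by simp
qed

lemma \<Phi>_0: "z = (y, 0) \<Longrightarrow> y \<in> snd d ` fst d \<Longrightarrow> \<Phi> d z = chart_inv d y"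
  using m_1 sub_point(1)[OF d] by (simp add: \<Phi>_def)

text \<open>The differential is computed along the two axes, where the flow box restricts to the
  inclusion of the level set and to an orbit.\<close>

lemma \<Phi>_fd_0:
  assumes c: "c \<in> \<A>" "chart_inv d w \<in> fst c"
  shows "fd (\<lambda>z. snd c (\<Phi> d z)) (w, 0) (u, a)
    = fd (\<lambda>y. snd c (chart_inv d y)) w u + a *\<^sub>R gen_coord c (chart_inv d w)"
proof -
  let ?\<phi> = "\<lambda>z. snd c (\<Phi> d z)"
  have c': "\<Phi> d (w, 0) \<in> fst c" using \<Phi>_0[OF refl w] c by simp
  note ph = \<Phi>_smooth[OF c(1) c']
  have l: "linear (fd ?\<phi> (w, 0))" by (rule smooth_near_linear_fd[OF ph(2)])
  have i1: "smooth_near (\<lambda>y. (y, 0::real)) w" by (intro smooth_near_Pair smooth_near_const smooth_near_id)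
  have "((\<lambda>y. (y, 0::real)) has_derivative (\<lambda>u. (u, 0))) (at w)" by (auto intro!: derivative_eq_intros)
  then have f1: "fd (\<lambda>y. (y, 0::real)) w u = (u, 0)" by (simp add: fd_eqI)
  have ev: "\<forall>\<^sub>F y in nhds w. ?\<phi> (y, 0) = snd c (chart_inv d y)"
    using sub_local(5)[OF d w c] by (rule eventually_mono) (simp add: \<Phi>_0)
  have 1: "fd ?\<phi> (w, 0) (u, 0) = fd (\<lambda>y. snd c (chart_inv d y)) w u"
    using fd_compose[of ?\<phi> "\<lambda>y. (y, 0)" w u, OF ph(2) i1] f1 fd_cong_eventually[OF ev] by simp
  have i2: "smooth_near (\<lambda>t::real. (w, t)) 0" by (intro smooth_near_Pair smooth_near_const smooth_near_id)
  have "((\<lambda>t::real. (w, t)) has_derivative (\<lambda>t. (0, t))) (at 0)" by (auto intro!: derivative_eq_intros)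
  then have f2: "fd (\<lambda>t::real. (w, t)) 0 1 = (0, 1)" by (simp add: fd_eqI)
  have 2: "fd ?\<phi> (w, 0) (0, 1) = gen_coord c (chart_inv d w)"
    using fd_compose[of ?\<phi> "\<lambda>t. (w, t)" 0 1, OF ph(2) i2] f2 by (simp add: gen_coord_def \<Phi>_def)
  have "(u, a) = (u, 0) + a *\<^sub>R (0, 1)" by simp
  then have "fd ?\<phi> (w, 0) (u, a) = fd ?\<phi> (w, 0) (u, 0) + a *\<^sub>R fd ?\<phi> (w, 0) (0, 1)"
    using linear_add[OF l] linear_scale[OF l] by metis
  then show ?thesis unfolding 1 2 .
qed

text \<open>At s = 0 the cross terms vanish because P is orthogonal to the level set, and g(P,P) =
  \<alpha> l. Translation by s is the action of exp s, under which homogeneity of g multiplies by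
  exp (\<alpha> s).\<close>

lemma \<Phi>_metric:
  assumes c: "c \<in> \<A>" "\<Phi> d (w, s) \<in> fst c"
  shows "local_metric \<A> g c (snd c (\<Phi> d (w, s))) (fd (\<lambda>z. snd c (\<Phi> d z)) (w, s) U) (fd (\<lambda>z. snd c (\<Phi> d z)) (w, s) V)
    = exp (\<alpha> * s) * (loc_sub d w (fst U) (fst V) + \<alpha> * l * snd U * snd V)"
proof -
  let ?p = "chart_inv d w"
  obtain c0 where c0: "c0 \<in> \<A>" "?p \<in> fst c0" using chart_exists sub_point(1)[OF d w] by metis
  have c0': "\<Phi> d (w, 0) \<in> fst c0" using \<Phi>_0[OF refl w] c0 by simp
  have pM: "?p \<in> M" by (rule sub_point(1)[OF d w])
  define Y where "Y = (\<lambda>U::'f \<times> real. \<lambda>\<tau>::real. \<Phi> d (w + \<tau> *\<^sub>R fst U, 0 + \<tau> * snd U))"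
  have Y0: "Y U 0 = ?p" for U by (simp add: Y_def \<Phi>_0[OF refl w])
  have Ysc: "smooth_curve_at \<A> 0 (Y U)" for U
    using \<Phi>_velocity(1)[OF c0(1) c0', of "fst U" "snd U"] by (simp add: Y_def)
  have Yvel: "velocity \<A> (Y U) 0 = tvec \<A> c0 ?p (fd (\<lambda>y. snd c0 (chart_inv d y)) w (fst U) + snd U *\<^sub>R gen_coord c0 ?p)" for U
    using \<Phi>_velocity(2)[OF c0(1) c0', of "fst U" "snd U"] \<Phi>_fd_0[OF c0, of "fst U" "snd U"] \<Phi>_0[OF refl w]
    by (simp add: Y_def)
  \<comment> \<open>The coordinate line through (w, s) is the image under \<open>m (exp s)\<close>
    of the one through (w, 0), so its velocity is a push.\<close>
  have X: "tvec \<A> c (\<Phi> d (w, s)) (fd (\<lambda>z. snd c (\<Phi> d z)) (w, s) U) = push \<A> (m (exp s)) ?p (velocity \<A> (Y U) 0)" for U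
  proof -
    have ev: "\<forall>\<^sub>F \<tau> in nhds 0. \<Phi> d (w + \<tau> *\<^sub>R fst U, s + \<tau> * snd U) = m (exp s) (Y U \<tau>)"
    proof -
      have "isCont (\<lambda>\<tau>::real. w + \<tau> *\<^sub>R fst U) 0" by (intro continuous_intros)
      then have "\<forall>\<^sub>F \<tau> in nhds (0::real). w + \<tau> *\<^sub>R fst U \<in> snd d ` fst d"
        using eventually_nhds_compose[where f = "\<lambda>\<tau>::real. w + \<tau> *\<^sub>R fst U" and x = 0] sub_local(5)[OF d w c0] by simp
      then show ?thesis
        by (rule eventually_mono) (simp add: Y_def \<Phi>_def exp_add m_mult sub_point(1)[OF d])
    qed
    have "tvec \<A> c (\<Phi> d (w, s)) (fd (\<lambda>z. snd c (\<Phi> d z)) (w, s) U)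
        = velocity \<A> (\<lambda>\<tau>. \<Phi> d (w + \<tau> *\<^sub>R fst U, s + \<tau> * snd U)) 0"
      using \<Phi>_velocity(2)[OF c, of "fst U" "snd U"] by simp
    also have "\<dots> = velocity \<A> (\<lambda>\<tau>. m (exp s) (Y U \<tau>)) 0" by (rule velocity_cong[OF ev])
    also have "\<dots> = push \<A> (m (exp s)) ?p (velocity \<A> (Y U) 0)"
      using push_action_velocity[OF _ Ysc, of "exp s" U] Y0 by simp
    finally show ?thesis .
  qed
  have ts: "velocity \<A> (Y U) 0 \<in> tangent_space \<A> ?p" for U
    using velocity_in_tangent_space[OF Ysc c0(1), of U] c0(2) Y0 by simp
  have xc: "snd c (\<Phi> d (w, s)) \<in> snd c ` fst c" using c by simp
  have ic: "chart_inv c (snd c (\<Phi> d (w, s))) = \<Phi> d (w, s)" by (rule is_chartD(4)[OF chart[OF c(1)] c(2)])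
  have x0: "snd c0 ?p \<in> snd c0 ` fst c0" using c0 by simp
  have ic0: "chart_inv c0 (snd c0 ?p) = ?p" by (rule is_chartD(4)[OF chart[OF c0(1)] c0(2)])
  note mm = metric_onD[OF metric_on_chart[OF g c0(1)] x0]
  let ?E = "fd (\<lambda>y. snd c0 (chart_inv d y)) w" and ?P = "gen_coord c0 ?p" and ?L = "local_metric \<A> g c0 (snd c0 ?p)"
  have F: "linear (fd (loc_f c0) (snd c0 ?p))" by (rule smooth_near_linear_fd[OF tvec_f(2)[OF c0]])
  have \<Phi>s: "\<Phi> d (w, s) = m (exp s) ?p" by (simp add: \<Phi>_def)
  have "local_metric \<A> g c (snd c (\<Phi> d (w, s))) (fd (\<lambda>z. snd c (\<Phi> d z)) (w, s) U) (fd (\<lambda>z. snd c (\<Phi> d z)) (w, s) V)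
    = g (m (exp s) ?p) (push \<A> (m (exp s)) ?p (velocity \<A> (Y U) 0)) (push \<A> (m (exp s)) ?p (velocity \<A> (Y V) 0))"
    unfolding local_metric_eq[OF c(1) xc] ic X by (simp add: \<Phi>s)
  also have "\<dots> = exp s powr \<alpha> * g ?p (velocity \<A> (Y U) 0) (velocity \<A> (Y V) 0)"
    by (rule g_m[OF _ pM ts ts]) simp
  also have "g ?p (velocity \<A> (Y U) 0) (velocity \<A> (Y V) 0)
      = ?L (?E (fst U) + snd U *\<^sub>R ?P) (?E (fst V) + snd V *\<^sub>R ?P)"
    unfolding Yvel local_metric_eq[OF c0(1) x0] ic0 ..
  also have "\<dots> = loc_sub d w (fst U) (fst V) + \<alpha> * l * snd U * snd V"
    using gen_metric[OF c0] level_fd[OF d w c0] mm(2)[of _ ?P] sub_point(2)[OF d w]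
    by (simp add: bilinear_radd[OF mm(1)] bilinear_rmul[OF mm(1)] bilinear_ladd[OF mm(1)] bilinear_lmul[OF mm(1)]
        loc_sub_eq[OF d w c0] linear_add[OF F] linear_scale[OF F])
  finally show ?thesis by (simp add: powr_def)
qed

text \<open>A vector in the kernel lies in the radical of the pulled-back metric, which is
  nondegenerate by \<open>\<Phi>_metric\<close>. The dimensions agree, so injectivity gives
  surjectivity.\<close>

lemma \<Phi>_fd_surj:
  assumes c: "c \<in> \<A>" "\<Phi> d (w, s) \<in> fst c"
  shows "surj (fd (\<lambda>z. snd c (\<Phi> d z)) (w, s))"
proof -
  let ?L = "fd (\<lambda>z. snd c (\<Phi> d z)) (w, s)"
  have lin: "linear ?L" by (rule smooth_near_linear_fd[OF \<Phi>_smooth(2)[OF c]])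
  have xc: "snd c (\<Phi> d (w, s)) \<in> snd c ` fst c" using c by simp
  note mm = metric_onD[OF metric_on_chart[OF g c(1)] xc]
  note ms = metric_onD[OF metric_on_sub[OF d] w]
  have "U = 0" if "?L U = 0" for U
  proof -
    have 0: "loc_sub d w (fst U) (fst V) + \<alpha> * l * snd U * snd V = 0" for V
      using \<Phi>_metric[OF c, of U V] that bilinear_lzero[OF mm(1)] by simp
    have "fst U = 0" using ms(3)[of "fst U"] 0[of "(_, 0)"] by simp
    moreover have "snd U = 0" using 0[of "(0, 1)"] bilinear_rzero[OF ms(1)] \<alpha> l by simp
    ultimately show ?thesis by (simp add: prod_eq_iff)
  qed
  then show ?thesis using lin by (intro surj_prod) (auto simp: linear_injective_0)
qed

end

end

section \<open>Geodesics of the conformal metrics\<close>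

lemma fd_real_eqI: "(h has_real_derivative D) (at t) \<Longrightarrow> fd h t 1 = D"
  using fd_eqI[of h "(*) D" t] by (simp add: has_field_derivative_def)

lemma curve_scale:
  fixes W :: "real \<Rightarrow> 'f::real_normed_vector" and \<sigma> :: "real \<Rightarrow> real"
  assumes W: "smooth_near W (\<sigma> t)" and \<sigma>: "smooth_near \<sigma> t"
  shows "smooth_near (\<lambda>r. W (\<sigma> r)) t" "fd (\<lambda>r. W (\<sigma> r)) t 1 = fd \<sigma> t 1 *\<^sub>R fd W (\<sigma> t) 1"
    "fd (\<lambda>r. fd (\<lambda>r. W (\<sigma> r)) r 1) t 1
      = fd (\<lambda>r. fd \<sigma> r 1) t 1 *\<^sub>R fd W (\<sigma> t) 1 + (fd \<sigma> t 1)\<^sup>2 *\<^sub>R fd (\<lambda>r. fd W r 1) (\<sigma> t) 1"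
proof -
  have lin: "fd W y v = v *\<^sub>R fd W y 1" if "smooth_near W y" for y v
    using linear_scale[OF smooth_near_linear_fd[OF that], of v 1] by simp
  have ev: "\<forall>\<^sub>F r in nhds t. W (\<sigma> r) = W (\<sigma> r)" by simp
  note c = curve_compose[OF frame_Basis W \<sigma> ev]
  show "smooth_near (\<lambda>r. W (\<sigma> r)) t" by (rule c(1))
  show "fd (\<lambda>r. W (\<sigma> r)) t 1 = fd \<sigma> t 1 *\<^sub>R fd W (\<sigma> t) 1"
    unfolding c(2) by (rule lin[OF W])
  have "\<forall>\<^sub>F y in nhds (\<sigma> t). fd W y (fd \<sigma> t 1) = fd \<sigma> t 1 *\<^sub>R fd W y 1"
    using smooth_near_eventually[OF W] by (rule eventually_mono) (rule lin)
  then have "fd (\<lambda>y. fd W y (fd \<sigma> t 1)) (\<sigma> t) = fd (\<lambda>y. fd \<sigma> t 1 *\<^sub>R fd W y 1) (\<sigma> t)"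
    by (rule fd_cong_eventually)
  also have "\<dots> = (\<lambda>h. fd \<sigma> t 1 *\<^sub>R fd (\<lambda>y. fd W y 1) (\<sigma> t) h)"
    by (intro fd_eqI has_derivative_scaleR_right smooth_near_has_derivative smooth_near_fd W)
  finally have 1: "fd (\<lambda>y. fd W y (fd \<sigma> t 1)) (\<sigma> t) (fd \<sigma> t 1)
      = fd \<sigma> t 1 *\<^sub>R fd (\<lambda>y. fd W y 1) (\<sigma> t) (fd \<sigma> t 1)" by simp
  have 2: "fd (\<lambda>y. fd W y 1) (\<sigma> t) (fd \<sigma> t 1) = fd \<sigma> t 1 *\<^sub>R fd (\<lambda>y. fd W y 1) (\<sigma> t) 1"
    using linear_scale[OF smooth_near_linear_fd[OF smooth_near_fd[OF W]], of 1 "fd \<sigma> t 1" 1] by simp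
  show "fd (\<lambda>r. fd (\<lambda>r. W (\<sigma> r)) r 1) t 1
      = fd (\<lambda>r. fd \<sigma> r 1) t 1 *\<^sub>R fd W (\<sigma> t) 1 + (fd \<sigma> t 1)\<^sup>2 *\<^sub>R fd (\<lambda>r. fd W r 1) (\<sigma> t) 1"
    unfolding c(3) 1 2 lin[OF W, of "fd (\<lambda>r. fd \<sigma> r 1) t 1"] by (simp add: power2_eq_square)
qed

lemma fd_Pair:
  assumes "smooth_near a t" "smooth_near b t"
  shows "fd (\<lambda>r. (a r, b r)) t v = (fd a t v, fd b t v)"
  using fd_eqI[OF has_derivative_Pair[OF assms[THEN smooth_near_has_derivative]]] by simp

lemma curve_Pair:
  fixes a :: "real \<Rightarrow> 'a::real_normed_vector" and b :: "real \<Rightarrow> 'b::real_normed_vector"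
  assumes a: "smooth_near a t" and b: "smooth_near b t"
  shows "fd (\<lambda>r. fd (\<lambda>r. (a r, b r)) r 1) t 1 = (fd (\<lambda>r. fd a r 1) t 1, fd (\<lambda>r. fd b r 1) t 1)"
proof -
  have "\<forall>\<^sub>F r in nhds t. fd (\<lambda>r. (a r, b r)) r 1 = (fd a r 1, fd b r 1)"
    using smooth_near_eventually[OF a] smooth_near_eventually[OF b] by eventually_elim (rule fd_Pair)
  then show ?thesis by (simp add: fd_cong_eventually fd_Pair smooth_near_fd a b)
qed

section \<open>Energy of geodesics of the level set and the conformal metric\<close>

context homogeneous begin

lemma sub_curve:
  assumes "smooth_curve_at sub_atlas \<tau> y"
  obtains d where "d \<in> sub_atlas" "\<forall>\<^sub>F r in nhds \<tau>. y r \<in> fst d" "smooth_near (\<lambda>r. snd d (y r)) \<tau>"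
  using smooth_curve_atE[OF assms] by metis

lemma sub_energy:
  assumes d: "d \<in> sub_atlas" and y: "\<forall>\<^sub>F r in nhds \<tau>. y r \<in> fst d" "smooth_near (\<lambda>r. snd d (y r)) \<tau>"
  shows "g (y \<tau>) (velocity \<A> y \<tau>) (velocity \<A> y \<tau>)
    = loc_sub d (snd d (y \<tau>)) (fd (\<lambda>r. snd d (y r)) \<tau> 1) (fd (\<lambda>r. snd d (y r)) \<tau> 1)"
proof -
  have p: "y \<tau> \<in> fst d" by (rule eventually_nhds_x_imp_x[OF y(1)])
  have inv: "chart_inv d (snd d (y \<tau>)) = y \<tau>" by (rule is_chartD(4)[OF sub_atlasD(2)[OF d] p])
  have w: "snd d (y \<tau>) \<in> snd d ` fst d" using p by simp
  obtain c where c: "c \<in> \<A>" "y \<tau> \<in> fst c" using chart_exists sub_point(1)[OF d w] inv by metis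
  have c': "chart_inv d (snd d (y \<tau>)) \<in> fst c" using c inv by simp
  have x: "snd c (y \<tau>) \<in> snd c ` fst c" using c by simp
  note sc = smooth_curve_param[OF frm sub_atlasD(1)[OF d] y]
  show ?thesis
    unfolding velocity_eq_tvec[OF sc(1) c] sc(2)[OF c] loc_sub_eq[OF d w c(1) c'] inv
      local_metric_eq[OF c(1) x] is_chartD(4)[OF chart[OF c(1)] c(2)] ..
qed

lemma sub_geodesic_EL:
  assumes y: "geodesic sub_atlas g_sub J y" and \<tau>: "\<tau> \<in> J"
    and d: "d \<in> sub_atlas" and yd: "y \<tau> \<in> fst d" "smooth_near (\<lambda>r. snd d (y r)) \<tau>"
  shows "EL (loc_sub d) (snd d (y \<tau>)) (fd (\<lambda>r. snd d (y r)) \<tau> 1) (fd (\<lambda>r. fd (\<lambda>r. snd d (y r)) r 1) \<tau> 1) v = 0"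
proof -
  have "(let x = (\<lambda>s. snd d (y s)); x' = (\<lambda>s. vector_derivative x (at s)) in
             vector_derivative x' (at \<tau>) + christoffel sub_atlas g_sub d (x \<tau>) (x' \<tau>) (x' \<tau>) = 0)"
    using y \<tau> d yd(1) unfolding geodesic_def by blast
  then show ?thesis
    using geodesic_equation_chart[OF frm metric_on_sub[OF d] _ yd(2)] yd(1) by blast
qed

text \<open>The derivative of G(W', W') along the curve is the Euler-Lagrange expression paired with
  W' itself, which vanishes for a geodesic.\<close>

lemma sub_energy_constant:
  assumes J: "open J" "is_interval J" and y: "geodesic sub_atlas g_sub J y" and \<tau>: "\<tau> \<in> J" "\<tau>' \<in> J"
  shows "g (y \<tau>) (velocity \<A> y \<tau>) (velocity \<A> y \<tau>) = g (y \<tau>') (velocity \<A> y \<tau>') (velocity \<A> y \<tau>')"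
proof (rule has_derivative_zero_unique_connected[OF J(1) is_interval_connected[OF J(2)] _ \<tau>])
  fix t assume t: "t \<in> J"
  then obtain d where d: "d \<in> sub_atlas" "\<forall>\<^sub>F r in nhds t. y r \<in> fst d" "smooth_near (\<lambda>r. snd d (y r)) t"
    using y sub_curve unfolding geodesic_def by metis
  let ?W = "\<lambda>r. snd d (y r)"
  let ?k = "\<lambda>r. loc_sub d (?W r) (fd ?W r 1) (fd ?W r 1)"
  have yt: "y t \<in> fst d" by (rule eventually_nhds_x_imp_x[OF d(2)])
  have w: "?W t \<in> snd d ` fst d" using yt by simp
  note mo = metric_on_sub[OF d(1)]
  note mm = metric_onD[OF mo w]
  note W' = smooth_near_fd[OF d(3), of 1]
  note der = fd_metric_along[OF frm mo w d(3) W' W']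
  have "fd ?k t 1 = EL (loc_sub d) (?W t) (fd ?W t 1) (fd (\<lambda>r. fd ?W r 1) t 1) (fd ?W t 1)"
    unfolding der(1) EL_def using mm(2)[of "fd ?W t 1" "fd (\<lambda>r. fd ?W r 1) t 1"] by simp
  also have "\<dots> = 0" by (rule sub_geodesic_EL[OF y t d(1) yt d(3)])
  finally have k1: "fd ?k t 1 = 0" .
  have "fd ?k t = (\<lambda>h. 0)"
  proof
    fix h :: real
    have "fd ?k t (h *\<^sub>R 1) = h *\<^sub>R fd ?k t 1" by (rule linear_scale[OF smooth_near_linear_fd[OF der(2)]])
    then show "fd ?k t h = 0" by (simp add: k1)
  qed
  then have k: "(?k has_derivative (\<lambda>h. 0)) (at t)"
    using smooth_near_has_derivative[OF der(2)] by simp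
  have "\<forall>\<^sub>F r in nhds t. \<forall>\<^sub>F r in nhds r. y r \<in> fst d" using d(2) by (simp add: eventually_eventually)
  with smooth_near_eventually[OF d(3)]
  have "\<forall>\<^sub>F r in nhds t. ?k r = g (y r) (velocity \<A> y r) (velocity \<A> y r)"
    by eventually_elim (simp add: sub_energy[OF d(1)])
  then obtain S where "open S" "t \<in> S" "\<And>r. r \<in> S \<Longrightarrow> ?k r = g (y r) (velocity \<A> y r) (velocity \<A> y r)"
    unfolding eventually_nhds by blast
  then show "((\<lambda>t. g (y t) (velocity \<A> y t) (velocity \<A> y t)) has_derivative (\<lambda>h. 0)) (at t)"
    by (rule has_derivative_transform_within_open[OF k])
qed

definition g_conf :: "real \<Rightarrow> 'a metric_tensor" where
  "g_conf \<beta> = (\<lambda>p X Y. f p powr \<beta> * g p X Y)"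

lemma g_conf_local: "local_metric \<A> (g_conf \<beta>) c x u v = loc_f c x powr \<beta> * local_metric \<A> g c x u v"
  by (simp add: local_metric_def g_conf_def loc_f_def)

lemma g_conf: "pseudo_riemannian M \<A> (g_conf \<beta>)"
proof -
  have pos: "f p powr \<beta> \<noteq> 0" if "p \<in> M" for p using f_pos[OF that] by simp
  have "smooth_on (snd c ` fst c) (\<lambda>x. local_metric \<A> (g_conf \<beta>) c x u v)" if c: "c \<in> \<A>" for c u v
  proof (rule smooth_onI_near)
    fix x assume x: "x \<in> snd c ` fst c"
    then obtain p where p: "p \<in> fst c" "x = snd c p" by auto
    have "loc_f c x > 0" using f_pos[OF chart_in_M[OF c p(1)]] is_chartD(4)[OF chart[OF c] p(1)] p(2)
      by (simp add: loc_f_def)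
    then show "smooth_near (\<lambda>x. local_metric \<A> (g_conf \<beta>) c x u v) x"
      unfolding g_conf_local
      by (intro smooth_near_mult metric_onD(4)[OF metric_on_chart[OF g c] x]
          smooth_near_compose[OF frame_Basis smooth_near_powr]) (use tvec_f(2)[OF c p(1)] p(2) in auto)
  qed
  moreover have "pseudo_riemannian M \<A> g" by (rule g)
  ultimately show ?thesis
    unfolding pseudo_riemannian_def using pos by (simp add: g_conf_def algebra_simps)
qed

section \<open>Curves lifted from the level set\<close>

context
  fixes d :: "('a, 'f) chart" and y :: "real \<Rightarrow> 'a" and \<sigma> s :: "real \<Rightarrow> real" and t :: real
  assumes d: "d \<in> sub_atlas" "\<forall>\<^sub>F r in nhds (\<sigma> t). y r \<in> fst d" "smooth_near (\<lambda>r. snd d (y r)) (\<sigma> t)"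
    and \<sigma>: "smooth_near \<sigma> t" and s: "smooth_near s t"
begin

abbreviation (input) "lift_W \<equiv> \<lambda>r. snd d (y r)"
abbreviation (input) "lift_z \<equiv> \<lambda>r. (snd d (y (\<sigma> r)), s r)"

lemma lift_facts:
  shows "smooth_near lift_z t" "\<forall>\<^sub>F r in nhds t. m (exp (s r)) (y (\<sigma> r)) = \<Phi> d (lift_z r)"
    "snd d (y (\<sigma> t)) \<in> snd d ` fst d"
    "fd lift_z t 1 = (fd \<sigma> t 1 *\<^sub>R fd lift_W (\<sigma> t) 1, fd s t 1)"
    "fd (\<lambda>r. fd lift_z r 1) t 1 = (fd (\<lambda>r. fd \<sigma> r 1) t 1 *\<^sub>R fd lift_W (\<sigma> t) 1
        + (fd \<sigma> t 1)\<^sup>2 *\<^sub>R fd (\<lambda>r. fd lift_W r 1) (\<sigma> t) 1, fd (\<lambda>r. fd s r 1) t 1)"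
proof -
  note cs = curve_scale[of lift_W \<sigma> t, OF d(3) \<sigma>]
  show "smooth_near lift_z t" by (rule smooth_near_Pair[OF cs(1) s])
  have "\<forall>\<^sub>F r in nhds t. y (\<sigma> r) \<in> fst d"
    by (rule eventually_nhds_compose[OF smooth_near_isCont[OF \<sigma>] d(2)])
  then show "\<forall>\<^sub>F r in nhds t. m (exp (s r)) (y (\<sigma> r)) = \<Phi> d (lift_z r)"
    by (rule eventually_mono) (simp add: \<Phi>_def is_chartD(4)[OF sub_atlasD(2)[OF d(1)]])
  show "snd d (y (\<sigma> t)) \<in> snd d ` fst d" using eventually_nhds_x_imp_x[OF d(2)] by simp
  show "fd lift_z t 1 = (fd \<sigma> t 1 *\<^sub>R fd lift_W (\<sigma> t) 1, fd s t 1)"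
    unfolding fd_Pair[OF cs(1) s] cs(2) ..
  show "fd (\<lambda>r. fd lift_z r 1) t 1 = (fd (\<lambda>r. fd \<sigma> r 1) t 1 *\<^sub>R fd lift_W (\<sigma> t) 1
        + (fd \<sigma> t 1)\<^sup>2 *\<^sub>R fd (\<lambda>r. fd lift_W r 1) (\<sigma> t) 1, fd (\<lambda>r. fd s r 1) t 1)"
    unfolding curve_Pair[OF cs(1) s] cs(3) ..
qed

lemma lift_chart:
  assumes c: "c \<in> \<A>" "m (exp (s t)) (y (\<sigma> t)) \<in> fst c"
  shows "\<Phi> d (lift_z t) \<in> fst c"
    "\<forall>\<^sub>F r in nhds t. m (exp (s r)) (y (\<sigma> r)) \<in> fst c"
    "smooth_near (\<lambda>r. snd c (m (exp (s r)) (y (\<sigma> r)))) t"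
    "fd (\<lambda>r. snd c (m (exp (s r)) (y (\<sigma> r)))) t 1 = fd (\<lambda>z. snd c (\<Phi> d z)) (lift_z t) (fd lift_z t 1)"
    "fd (\<lambda>r. fd (\<lambda>r. snd c (m (exp (s r)) (y (\<sigma> r)))) r 1) t 1
      = fd (\<lambda>z. snd c (\<Phi> d z)) (lift_z t) (fd (\<lambda>r. fd lift_z r 1) t 1)
        + fd (\<lambda>z'. fd (\<lambda>z. snd c (\<Phi> d z)) z' (fd lift_z t 1)) (lift_z t) (fd lift_z t 1)"
proof -
  note lf = lift_facts
  show c': "\<Phi> d (lift_z t) \<in> fst c" using c eventually_nhds_x_imp_x[OF lf(2)] by simp
  note ph = \<Phi>_smooth[OF d(1) lf(3) c(1) c']
  have "\<forall>\<^sub>F r in nhds t. \<Phi> d (lift_z r) \<in> fst c"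
    by (rule eventually_nhds_compose[OF smooth_near_isCont[OF lf(1)] ph(1)])
  with lf(2) show "\<forall>\<^sub>F r in nhds t. m (exp (s r)) (y (\<sigma> r)) \<in> fst c" by eventually_elim simp
  have ev: "\<forall>\<^sub>F r in nhds t. snd c (m (exp (s r)) (y (\<sigma> r))) = snd c (\<Phi> d (lift_z r))"
    using lf(2) by (rule eventually_mono) simp
  note cc = curve_compose[OF frame_times_real[OF frm] ph(2) lf(1) ev]
  show "smooth_near (\<lambda>r. snd c (m (exp (s r)) (y (\<sigma> r)))) t" by (rule cc(1))
  show "fd (\<lambda>r. snd c (m (exp (s r)) (y (\<sigma> r)))) t 1 = fd (\<lambda>z. snd c (\<Phi> d z)) (lift_z t) (fd lift_z t 1)"
    by (rule cc(2))
  show "fd (\<lambda>r. fd (\<lambda>r. snd c (m (exp (s r)) (y (\<sigma> r)))) r 1) t 1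
      = fd (\<lambda>z. snd c (\<Phi> d z)) (lift_z t) (fd (\<lambda>r. fd lift_z r 1) t 1)
        + fd (\<lambda>z'. fd (\<lambda>z. snd c (\<Phi> d z)) z' (fd lift_z t 1)) (lift_z t) (fd lift_z t 1)"
    by (rule cc(3))
qed

lemma lift_smooth: "smooth_curve_at \<A> t (\<lambda>r. m (exp (s r)) (y (\<sigma> r)))"
proof -
  have "y (\<sigma> t) \<in> M" using sub_point(1)[OF d(1) lift_facts(3)] eventually_nhds_x_imp_x[OF d(2)]
    by (simp add: is_chartD(4)[OF sub_atlasD(2)[OF d(1)]])
  then have "m (exp (s t)) (y (\<sigma> t)) \<in> M" by (intro m_in) auto
  then obtain c where c: "c \<in> \<A>" "m (exp (s t)) (y (\<sigma> t)) \<in> fst c" using chart_exists by metis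
  show ?thesis by (rule smooth_curve_atI[OF c(1) lift_chart(2,3)[OF c]])
qed

lemma lift_velocity:
  assumes "s t = 0" "\<sigma> t = t" "fd \<sigma> t 1 = 1"
  shows "velocity \<A> (\<lambda>r. m (exp (s r)) (y (\<sigma> r))) t
    = (\<lambda>h. velocity \<A> y t h + fd s t 1 * generator \<A> m (y t) h)"
proof -
  have yt: "y t \<in> fst d" using eventually_nhds_x_imp_x[OF d(2)] assms by simp
  have w: "snd d (y t) \<in> snd d ` fst d" using yt by simp
  have inv: "chart_inv d (snd d (y t)) = y t" by (rule is_chartD(4)[OF sub_atlasD(2)[OF d(1)] yt])
  have yM: "y t \<in> M" using sub_point(1)[OF d(1) w] inv by simp
  then obtain c where c: "c \<in> \<A>" "y t \<in> fst c" using chart_exists by metis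
  have m1: "m (exp (s t)) (y (\<sigma> t)) = y t" using assms m_1[OF yM] by simp
  have c': "m (exp (s t)) (y (\<sigma> t)) \<in> fst c" using m1 c by simp
  have c'': "chart_inv d (snd d (y t)) \<in> fst c" using inv c by simp
  note sc = smooth_curve_param[OF frm sub_atlasD(1)[OF d(1)] d(2,3)[unfolded assms(2)]]
  have "velocity \<A> (\<lambda>r. m (exp (s r)) (y (\<sigma> r))) t = tvec \<A> c (y t) (fd (\<lambda>z. snd c (\<Phi> d z)) (lift_z t) (fd lift_z t 1))"
    using velocity_eq_tvec[OF lift_smooth c(1) c'] lift_chart(4)[OF c(1) c'] m1 by simp
  also have "fd (\<lambda>z. snd c (\<Phi> d z)) (lift_z t) (fd lift_z t 1)
      = 1 *\<^sub>R fd (\<lambda>r. snd c (y r)) t 1 + fd s t 1 *\<^sub>R gen_coord c (y t)"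
    unfolding lift_facts(4) using \<Phi>_fd_0[OF d(1) w c(1) c''] assms sc(2)[OF c] inv by simp
  also have "tvec \<A> c (y t) \<dots> = (\<lambda>h. velocity \<A> y t h + fd s t 1 * generator \<A> m (y t) h)"
    unfolding tvec_linear(1)[OF c] velocity_eq_tvec[OF sc(1) c] generator_eq(1)[OF c] by simp
  finally show ?thesis .
qed

end

text \<open>The energy K enters because the exponential factor is differentiated along the scale
  direction; its constancy is what reduces the system to ordinary equations for \<sigma> and s
  alone.\<close>

lemma geodesic_lift:
  assumes J: "open J" and y: "geodesic sub_atlas g_sub J y"
    and K: "\<And>\<tau>. \<tau> \<in> J \<Longrightarrow> g (y \<tau>) (velocity \<A> y \<tau>) (velocity \<A> y \<tau>) = K"
    and \<sigma>: "\<And>t. t \<in> I \<Longrightarrow> \<sigma> t \<in> J" "\<And>t. t \<in> I \<Longrightarrow> smooth_near \<sigma> t" and s: "\<And>t. t \<in> I \<Longrightarrow> smooth_near s t"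
    and k: "k = \<alpha> * (\<beta> + 1)"
    and e1: "\<And>t. t \<in> I \<Longrightarrow> fd (\<lambda>r. fd \<sigma> r 1) t 1 + k * fd s t 1 * fd \<sigma> t 1 = 0"
    and e2: "\<And>t. t \<in> I \<Longrightarrow> 2 * (\<alpha> * l) * fd (\<lambda>r. fd s r 1) t 1 + k * (\<alpha> * l) * (fd s t 1)\<^sup>2 - k * (fd \<sigma> t 1)\<^sup>2 * K = 0"
  shows "geodesic \<A> (g_conf \<beta>) I (\<lambda>t. m (exp (s t)) (y (\<sigma> t)))"
  unfolding geodesic_iff_EL[OF g_conf]
proof (intro ballI conjI impI allI)
  fix t assume t: "t \<in> I"
  let ?\<gamma> = "\<lambda>t. m (exp (s t)) (y (\<sigma> t))"
  obtain d where d: "d \<in> sub_atlas" "\<forall>\<^sub>F r in nhds (\<sigma> t). y r \<in> fst d" "smooth_near (\<lambda>r. snd d (y r)) (\<sigma> t)"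
    using y \<sigma>(1)[OF t] sub_curve unfolding geodesic_def by metis
  show "smooth_curve_at \<A> t ?\<gamma>" by (rule lift_smooth[OF d \<sigma>(2)[OF t] s[OF t]])
  fix c \<omega> assume c: "c \<in> \<A>" "?\<gamma> t \<in> fst c"
  note lf = lift_facts[OF d \<sigma>(2)[OF t] s[OF t]] and lc = lift_chart[OF d \<sigma>(2)[OF t] s[OF t] c]
  let ?W = "\<lambda>r. snd d (y r)" and ?\<phi> = "\<lambda>z. snd c (\<Phi> d z)"
  let ?w = "snd d (y (\<sigma> t))"
  let ?z = "(?w, s t)"
  let ?G = "local_metric \<A> (g_conf \<beta>) c"
  let ?H = "\<lambda>z U V. l powr \<beta> * exp (k * snd z) * (loc_sub d (fst z) (fst U) (fst V) + (\<alpha> * l) * snd U * snd V)"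
  note ph = \<Phi>_smooth[OF d(1) lf(3) c(1) lc(1)]
  have x: "?\<phi> ?z \<in> snd c ` fst c" using lc(1) by simp
  \<comment> \<open>On the flow box f is l exp (\<alpha> s), so its power \<beta> contributes
    l^\<beta> exp (\<alpha> \<beta> s); together with the factor exp (\<alpha> s) of g this gives
    the exponent k s.\<close>
  have pull: "?G (?\<phi> z) (fd ?\<phi> z U) (fd ?\<phi> z V) = ?H z U V"
    if z: "fst z \<in> snd d ` fst d" "\<Phi> d z \<in> fst c" for z U V
  proof -
    have "\<Phi> d (fst z, snd z) \<in> fst c" using z by simp
    note pm = \<Phi>_metric[OF d(1) z(1) c(1) this, of U V]
    have "loc_f c (?\<phi> z) = exp (\<alpha> * snd z) * l"
      using f_m[of "exp (snd z)"] sub_point[OF d(1) z(1)]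
      by (simp add: loc_f_def is_chartD(4)[OF chart[OF c(1)] z(2)]) (simp add: \<Phi>_def powr_def)
    then show ?thesis
      using pm l by (simp add: g_conf_local k powr_mult exp_powr_real exp_add[symmetric] algebra_simps)
  qed
  have "\<forall>\<^sub>F z in nhds ?z. fst z \<in> snd d ` fst d"
    using sub_atlasD(2)[OF d(1)] lf(3)
    by (intro topological_tendstoD[OF isCont_tendsto_nhds]) (auto intro: is_chartD(1) continuous_intros)
  with ph(1) have ev: "\<forall>\<^sub>F z in nhds ?z. \<forall>U V. ?G (?\<phi> z) (fd ?\<phi> z U) (fd ?\<phi> z V) = ?H z U V"
    by eventually_elim (simp only: pull simp_thms)
  \<comment> \<open>Every test vector of the chart comes from the flow box, so testing there is
    enough.\<close>
  obtain \<Omega> where \<Omega>: "\<omega> = fd ?\<phi> ?z \<Omega>" using \<Phi>_fd_surj[OF d(1) lf(3) c(1) lc(1)] by (metis surjD)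
  obtain v b where \<Omega>': "\<Omega> = (v, b)" by (cases \<Omega>)
  have \<sigma>J: "\<sigma> t \<in> J" by (rule \<sigma>(1)[OF t])
  have yd: "y (\<sigma> t) \<in> fst d" by (rule eventually_nhds_x_imp_x[OF d(2)])
  note mo = metric_on_sub[OF d(1)]
  note mm = metric_onD[OF mo lf(3)]
  let ?W1 = "fd ?W (\<sigma> t) 1" and ?W2 = "fd (\<lambda>r. fd ?W r 1) (\<sigma> t) 1"
  let ?s1 = "fd s t 1" and ?s2 = "fd (\<lambda>r. fd s r 1) t 1" and ?\<sigma>1 = "fd \<sigma> t 1" and ?\<sigma>2 = "fd (\<lambda>r. fd \<sigma> r 1) t 1"
  have KW: "loc_sub d ?w ?W1 ?W1 = K" using sub_energy[OF d] K[OF \<sigma>J] by simp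
  \<comment> \<open>In the chart the acceleration carries the Hessian of the flow box map, the form
    in which naturality applies.\<close>
  have "EL ?G (snd c (?\<gamma> t)) (fd (\<lambda>s. snd c (?\<gamma> s)) t 1) (fd (\<lambda>r. fd (\<lambda>s. snd c (?\<gamma> s)) r 1) t 1) \<omega>
    = EL ?G (?\<phi> ?z) (fd ?\<phi> ?z (fd (\<lambda>r. (snd d (y (\<sigma> r)), s r)) t 1))
       (fd ?\<phi> ?z (fd (\<lambda>r. fd (\<lambda>r. (snd d (y (\<sigma> r)), s r)) r 1) t 1)
        + fd (\<lambda>z'. fd ?\<phi> z' (fd (\<lambda>r. (snd d (y (\<sigma> r)), s r)) t 1)) ?z (fd (\<lambda>r. (snd d (y (\<sigma> r)), s r)) t 1)) (fd ?\<phi> ?z \<Omega>)"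
    unfolding lc(4,5) \<Omega> using eventually_nhds_x_imp_x[OF lf(2)] by simp
  also have "\<dots> = EL (\<lambda>z U V. ?G (?\<phi> z) (fd ?\<phi> z U) (fd ?\<phi> z V)) ?z (fd (\<lambda>r. (snd d (y (\<sigma> r)), s r)) t 1)
       (fd (\<lambda>r. fd (\<lambda>r. (snd d (y (\<sigma> r)), s r)) r 1) t 1) \<Omega>"
    by (rule EL_natural[OF metric_on_chart[OF g_conf c(1)] x ph(2), symmetric])
  also have "\<dots> = EL ?H ?z (fd (\<lambda>r. (snd d (y (\<sigma> r)), s r)) t 1) (fd (\<lambda>r. fd (\<lambda>r. (snd d (y (\<sigma> r)), s r)) r 1) t 1) \<Omega>"
    by (rule EL_cong[OF ev])
  also have "\<dots> = l powr \<beta> * exp (k * s t) *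
      (EL (loc_sub d) ?w (?\<sigma>1 *\<^sub>R ?W1) (?\<sigma>2 *\<^sub>R ?W1 + ?\<sigma>1\<^sup>2 *\<^sub>R ?W2) v + 2 * k * ?s1 * loc_sub d ?w (?\<sigma>1 *\<^sub>R ?W1) v
        + b * (2 * (\<alpha> * l) * ?s2 + 2 * k * (\<alpha> * l) * ?s1\<^sup>2 - k * loc_sub d ?w (?\<sigma>1 *\<^sub>R ?W1) (?\<sigma>1 *\<^sub>R ?W1) - k * (\<alpha> * l) * ?s1\<^sup>2))"
    unfolding lf(4,5) \<Omega>' by (rule EL_warped[OF mo lf(3)])
  \<comment> \<open>Reparametrisation leaves a multiple of the equation of y, which vanishes; what
    remains is \<open>e1\<close> in the v part and \<open>e2\<close> in the b part.\<close>
  also have "\<dots> = l powr \<beta> * exp (k * s t) *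
      (2 * (?\<sigma>2 + k * ?s1 * ?\<sigma>1) * loc_sub d ?w ?W1 v
        + b * (2 * (\<alpha> * l) * ?s2 + k * (\<alpha> * l) * ?s1\<^sup>2 - k * ?\<sigma>1\<^sup>2 * K))"
    unfolding EL_reparametrise[OF mo lf(3)] sub_geodesic_EL[OF y \<sigma>J d(1) yd d(3)]
      bilinear_lmul[OF mm(1)] bilinear_rmul[OF mm(1)] KW
    by (simp add: algebra_simps power2_eq_square)
  also have "\<dots> = 0" unfolding e1[OF t] e2[OF t] by simp
  finally show "EL ?G (snd c (?\<gamma> t)) (fd (\<lambda>s. snd c (?\<gamma> s)) t 1) (fd (\<lambda>r. fd (\<lambda>s. snd c (?\<gamma> s)) r 1) t 1) \<omega> = 0" .
qed

end

section \<open>The tangent space of a level set\<close>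

context homogeneous begin

text \<open>The implicit function theorem for f, with a chart modelled on \<open>'f\<close>. The
  function f is nonsingular since df(P) = \<alpha> l, and a linear isomorphism from
  \<open>'f\<close> onto the kernel of df transfers the straightened level set to the model
  space.\<close>

lemma sub_chart_exists:
  assumes x0: "x0 \<in> M\<^sub>l"
  obtains d where "d \<in> sub_atlas" "x0 \<in> fst d"
proof -
  have x0M: "x0 \<in> M" "f x0 = l" using x0 by (auto simp: M\<^sub>l_def)
  obtain c where c: "c \<in> \<A>" "x0 \<in> fst c" using chart_exists[OF x0M(1)] .
  note cd = is_chartD[OF chart[OF c(1)]]
  let ?U = "snd c ` fst c"
  define \<xi>0 where "\<xi>0 = snd c x0"
  define F where "F = fd (loc_f c) \<xi>0"
  \<comment> \<open>The generator, scaled so that df takes the value 1 on it, serves as the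
    direction transversal to the level set.\<close>
  define n where "n = gen_coord c x0 /\<^sub>R (\<alpha> * l)"
  have F: "linear F" unfolding F_def \<xi>0_def by (rule smooth_near_linear_fd[OF tvec_f(2)[OF c]])
  have Fn: "F n = 1"
    using gen_metric(2)[OF c] x0M \<alpha> l unfolding n_def linear_scale[OF F] by (simp add: F_def \<xi>0_def field_simps)
  define H where "H = {\<xi>. F \<xi> = 0}"
  define \<nu> where "\<nu> = (\<Sum>b\<in>Basis. F b *\<^sub>R b)"
  have \<nu>: "\<nu> \<bullet> \<xi> = F \<xi>" for \<xi> unfolding \<nu>_def by (rule frame_inner[OF frame_Basis F])
  have "\<nu> \<noteq> 0" using \<nu>[of n] Fn by auto
  \<comment> \<open>The kernel of a nonzero functional has codimension one, so it has a basis in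
    bijection with D; this is where the dimension of the model space is used.\<close>
  then have "dim H = card D" using dim_hyperplane[of \<nu>] D(4) by (simp add: H_def \<nu>)
  then obtain E where E: "E \<subseteq> H" "independent E" "H \<subseteq> span E" "card E = card D"
    using basis_exists[of H] by metis
  have "finite E" using independent_imp_finite[OF E(2)] .
  then obtain j where j: "bij_betw j D E" using finite_same_card_bij[OF D(1)] E(4) by metis
  obtain L :: "'f \<Rightarrow> 'e" where L: "linear L" "\<And>b. b \<in> D \<Longrightarrow> L b = j b"
    using linear_independent_extend[OF D(2), of j] by metis
  obtain R :: "'e \<Rightarrow> 'f" where R: "linear R" "\<And>b. b \<in> E \<Longrightarrow> R b = inv_into D j b"
    using linear_independent_extend[OF E(2), of "inv_into D j"] by metis
  have RL: "R (L w) = w" for w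
  proof -
    have "(R \<circ> L) w = id w"
    proof (rule linear_eq_on[OF linear_compose[OF L(1) R(1)] linear_id])
      show "w \<in> span D" using D(3) by simp
      show "(R \<circ> L) b = id b" if "b \<in> D" for b
        using that L(2) R(2) j by (simp add: bij_betwE bij_betw_inv_into_left)
    qed
    then show ?thesis by simp
  qed
  have LR: "L (R \<xi>) = \<xi>" if "\<xi> \<in> H" for \<xi>
  proof -
    have "(L \<circ> R) \<xi> = id \<xi>"
    proof (rule linear_eq_on[OF linear_compose[OF R(1) L(1)] linear_id])
      show "\<xi> \<in> span E" using E(3) that by auto
      show "(L \<circ> R) b = id b" if "b \<in> E" for b
        using that L(2)[of "inv_into D j b"] R(2) j
        by (metis bij_betw_apply bij_betw_inv_into bij_betw_inv_into_right comp_apply id_apply)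
    qed
    then show ?thesis by simp
  qed
  have LH: "F (L w) = 0" for w
  proof -
    have "(F \<circ> L) w = 0"
    proof (rule linear_eq_on[OF linear_compose[OF L(1) F] linear_zero])
      show "w \<in> span D" using D(3) by simp
      show "(F \<circ> L) b = 0" if "b \<in> D" for b
        using that L(2) bij_betwE[OF j] E(1) by (auto simp: H_def)
    qed
    then show ?thesis by simp
  qed
  have bL: "bounded_linear L" by (rule frame_linear_bounded[OF frm L(1)])
  have bR: "bounded_linear R" by (rule frame_linear_bounded[OF frame_Basis R(1)])
  have bF: "bounded_linear F" by (rule frame_linear_bounded[OF frame_Basis F])
  \<comment> \<open>Replaces the linear coordinate F along n by the function f - l and changes
    nothing else. Level points go into the kernel of F, and the differential at
    \<open>\<xi>0\<close> is the identity because F is the differential of f there.\<close>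
  define \<Theta> where "\<Theta> = (\<lambda>\<xi>. \<xi> - F \<xi> *\<^sub>R n + (loc_f c \<xi> - l) *\<^sub>R n)"
  have F\<Theta>: "F (\<Theta> \<xi>) = loc_f c \<xi> - l" for \<xi>
    by (simp add: \<Theta>_def linear_add[OF F] linear_diff[OF F] linear_scale[OF F] Fn)
  have sm\<Theta>: "smooth_near \<Theta> \<xi>" if "\<xi> \<in> ?U" for \<xi>
    unfolding \<Theta>_def using that tvec_f(2)[OF c(1)]
    by (intro smooth_near_add smooth_near_diff smooth_near_scaleR smooth_near_id smooth_near_const
        smooth_near_linear[OF bF]) auto
  have fd\<Theta>: "fd \<Theta> \<xi>0 = (\<lambda>v. v)"
  proof -
    have "(\<Theta> has_derivative (\<lambda>v. v - F v *\<^sub>R n + (F v - 0) *\<^sub>R n)) (at \<xi>0)"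
      unfolding \<Theta>_def
      by (intro has_derivative_add has_derivative_diff has_derivative_scaleR_left has_derivative_ident
          has_derivative_const bounded_linear_imp_has_derivative[OF bF])
        (use smooth_near_has_derivative[OF tvec_f(2)[OF c]] in \<open>simp add: F_def \<xi>0_def\<close>)
    from fd_eqI[OF this] show ?thesis by simp
  qed
  have "\<xi>0 \<in> ?U" using c by (simp add: \<xi>0_def)
  then obtain U V G where UV: "open U" "U \<subseteq> ?U" "\<xi>0 \<in> U" "open V" "\<Theta> \<xi>0 \<in> V"
    "homeomorphism U V \<Theta> G" "smooth_on V G"
    using smooth_inverse_function[OF cd(1) smooth_onI_near[OF sm\<Theta>] _ fd\<Theta>] by metis
  have G\<Theta>: "\<Theta> \<xi> \<in> V" "G (\<Theta> \<xi>) = \<xi>" if "\<xi> \<in> U" for \<xi>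
    using UV(6) that by (auto simp: homeomorphism_def)
  have \<Theta>G: "G v \<in> U" "\<Theta> (G v) = v" if "v \<in> V" for v
    using UV(6) that by (auto simp: homeomorphism_def)
  \<comment> \<open>R is a left inverse of L on all of \<open>'f\<close> and a right inverse on the
    kernel of F, so the inverse of this chart is L followed by G and the inverse of c.\<close>
  define d where "d = ({q \<in> fst c. snd c q \<in> U \<and> f q = l}, \<lambda>q. R (\<Theta> (snd c q)))"
  have fst_d: "q \<in> fst d \<longleftrightarrow> q \<in> fst c \<and> snd c q \<in> U \<and> f q = l" for q by (simp add: d_def)
  have snd_d: "snd d q = R (\<Theta> (snd c q))" for q by (simp add: d_def)
  have Ld: "L (snd d q) = \<Theta> (snd c q)" if "q \<in> fst d" for q
    using that LR[of "\<Theta> (snd c q)"] F\<Theta>[of "snd c q"]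
    by (simp add: fst_d snd_d H_def loc_f_def cd(4))
  have bck: "chart_inv c (G (L w)) \<in> fst d" "snd d (chart_inv c (G (L w))) = w" if "L w \<in> V" for w
  proof -
    have GU: "G (L w) \<in> U" "G (L w) \<in> ?U" using \<Theta>G(1)[OF that] UV(2) by auto
    have "loc_f c (G (L w)) = l" using F\<Theta>[of "G (L w)"] \<Theta>G(2)[OF that] LH[of w] by simp
    then show "chart_inv c (G (L w)) \<in> fst d"
      using GU by (simp add: fst_d cd(5,6) loc_f_def)
    show "snd d (chart_inv c (G (L w))) = w"
      using GU by (simp add: snd_d cd(6) \<Theta>G(2)[OF that] RL)
  qed
  have fwd: "chart_inv c (G (L (snd d q))) = q" if "q \<in> fst d" for q
    using that Ld[OF that] by (simp add: fst_d G\<Theta>(2) cd(4))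
  have img: "snd d ` fst d = L -` V"
  proof (intro equalityI subsetI)
    fix w assume "w \<in> snd d ` fst d"
    then show "w \<in> L -` V" using Ld G\<Theta>(1) by (auto simp: fst_d)
  next
    fix w assume "w \<in> L -` V"
    then have "L w \<in> V" by simp
    from bck[OF this] show "w \<in> snd d ` fst d" by (metis imageI)
  qed
  have inj_d: "inj_on (snd d) (fst d)" using fwd by (rule inj_on_inverseI)
  have inv_d: "chart_inv d w = chart_inv c (G (L w))" if "w \<in> snd d ` fst d" for w
    using that bck unfolding img by (intro inv_into_f_eq[OF inj_d]) auto
  have contc: "continuous_on (fst c) (snd c)" "continuous_on ?U (chart_inv c)"
    using chart[OF c(1)] by (auto simp: is_chart_def homeomorphism_def)
  have ch: "is_chart M\<^sub>l d"
    unfolding is_chart_def homeomorphism_def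
  proof (intro conjI ballI)
    have "openin (top_of_set (fst c)) (fst c \<inter> snd c -` U)"
      by (rule continuous_openin_preimage_gen[OF contc(1) UV(1)])
    then have "openin (top_of_set M) (fst c \<inter> snd c -` U)" using cd(3) by (rule openin_trans)
    then obtain T where T: "open T" "fst c \<inter> snd c -` U = M \<inter> T" by (auto simp: openin_open)
    have "fst d = M\<^sub>l \<inter> T" using T(2) cd(2) by (auto simp: fst_d M\<^sub>l_def)
    then show "openin (top_of_set M\<^sub>l) (fst d)" using T(1) by (auto simp: openin_open)
    show "open (snd d ` fst d)"
      unfolding img using bL UV(4) by (intro open_vimage) (auto simp: linear_continuous_on)
    show "chart_inv d (snd d q) = q" if "q \<in> fst d" for q using inv_into_f_f[OF inj_d that] .
    show "snd d (chart_inv d w) = w" if "w \<in> snd d ` fst d" for w using that by (rule f_inv_into_f)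
    show "chart_inv d ` snd d ` fst d = fst d" using inj_d by (simp add: inv_into_image_cancel)
    show "snd d ` fst d = snd d ` fst d" ..
    have "continuous_on U \<Theta>" using UV(6) by (simp add: homeomorphism_def)
    then have "continuous_on (fst d) (\<lambda>q. \<Theta> (snd c q))"
      by (rule continuous_on_compose2[OF _ continuous_on_subset[OF contc(1)]]) (auto simp: fst_d)
    then show "continuous_on (fst d) (snd d)"
      unfolding d_def snd_conv by (rule bounded_linear.continuous_on[OF bR])
    have "continuous_on V G" using UV(6) by (simp add: homeomorphism_def)
    then have "continuous_on (L -` V) (\<lambda>w. G (L w))"
      by (rule continuous_on_compose2[OF _ linear_continuous_on[OF bL]]) auto
    then have "continuous_on (L -` V) (\<lambda>w. chart_inv c (G (L w)))"
      by (rule continuous_on_compose2[OF contc(2)]) (use \<Theta>G(1) UV(2) in auto)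
    then show "continuous_on (snd d ` fst d) (chart_inv d)"
      by (rule continuous_on_cong[THEN iffD1, rotated 2]) (simp_all add: img[symmetric] inv_d)
  qed
  note dd = is_chartD[OF ch]
  have sp: "smooth_param M\<^sub>l d"
    unfolding smooth_param_def
  proof (intro conjI ballI ch)
    fix p assume p: "p \<in> fst d"
    have ev: "\<forall>\<^sub>F w in nhds (snd d p). w \<in> snd d ` fst d" by (rule chart_eventually_in[OF ch p])
    show "smooth_map_at {d} \<A> p id"
    proof (rule smooth_map_atI[OF _ c(1) ch p])
      show "\<forall>\<^sub>F w in nhds (snd d p). id (chart_inv d w) \<in> fst c"
        using ev by (rule eventually_mono) (use dd(5) fst_d in auto)
      have "smooth_near (\<lambda>w. G (L w)) (snd d p)"
      proof (rule smooth_near_compose[OF frame_Basis, where f = G and g = L])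
        show "smooth_near G (L (snd d p))"
          using Ld[OF p] G\<Theta>(1)[of "snd c p"] p by (intro smooth_nearI[OF UV(7,4)]) (simp add: fst_d)
        show "smooth_near L (snd d p)" by (rule smooth_near_linear[OF bL smooth_near_id])
      qed
      moreover have "\<forall>\<^sub>F w in nhds (snd d p). G (L w) = snd c (id (chart_inv d w))"
        using ev
      proof (rule eventually_mono)
        fix w assume w: "w \<in> snd d ` fst d"
        then have "G (L w) \<in> ?U" using \<Theta>G(1) UV(2) unfolding img by auto
        then show "G (L w) = snd c (id (chart_inv d w))" using inv_d[OF w] cd(6) by simp
      qed
      ultimately show "smooth_near (\<lambda>w. snd c (id (chart_inv d w))) (snd d p)" by (rule smooth_near_cong)
    qed simp
  qed
  have "inj_on (push \<A> id p) (tangent_space {d} p)" if p: "p \<in> fst d" for p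
  proof (rule inj_onI)
    have pc: "p \<in> fst c" using p by (simp add: fst_d)
    \<comment> \<open>The map R after the differential of \<Theta> recovers the d-velocity of a
      curve from its ambient c-velocity, a left inverse that makes the push injective.\<close>
    have key: "\<exists>\<gamma>. X = velocity {d} \<gamma> 0 \<and> (\<forall>\<^sub>F s in nhds 0. \<gamma> s \<in> fst d) \<and> \<gamma> 0 = p
        \<and> smooth_near (\<lambda>s. snd d (\<gamma> s)) 0 \<and> push \<A> id p X = tvec \<A> c p (fd (\<lambda>s. snd c (\<gamma> s)) 0 1)
        \<and> fd (\<lambda>s. snd d (\<gamma> s)) 0 1 = R (fd \<Theta> (snd c p) (fd (\<lambda>s. snd c (\<gamma> s)) 0 1))"
      if X: "X \<in> tangent_space {d} p" for X
    proof -
      obtain \<gamma> where \<gamma>: "X = velocity {d} \<gamma> 0" "smooth_curve_at {d} 0 \<gamma>" "\<gamma> 0 = p"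
        using X by (auto simp: tangent_space_def)
      have \<gamma>d: "\<forall>\<^sub>F s in nhds 0. \<gamma> s \<in> fst d" "smooth_near (\<lambda>s. snd d (\<gamma> s)) 0"
        using smooth_curve_atE[OF \<gamma>(2)] by (metis singletonD)+
      have \<gamma>p: "\<gamma> 0 \<in> fst d" "\<gamma> 0 \<in> fst c" using \<gamma>(3) p pc by auto
      have sc: "smooth_curve_at \<A> 0 \<gamma>" by (rule smooth_curve_param(1)[OF frm sp \<gamma>d])
      note sc' = smooth_curve_atD[OF sc c(1) \<gamma>p(2)]
      have \<Theta>p: "smooth_near \<Theta> (snd c (\<gamma> 0))" using sm\<Theta> pc \<gamma>(3) by auto
      have "((\<lambda>s. R (\<Theta> (snd c (\<gamma> s)))) has_derivative (\<lambda>v. R (fd \<Theta> (snd c (\<gamma> 0)) (fd (\<lambda>s. snd c (\<gamma> s)) 0 v)))) (at 0)"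
        by (rule bounded_linear.has_derivative[OF bR has_derivative_compose[OF
              smooth_near_has_derivative[OF sc'(2)] smooth_near_has_derivative[OF \<Theta>p]]])
      then have 1: "fd (\<lambda>s. snd d (\<gamma> s)) 0 1 = R (fd \<Theta> (snd c p) (fd (\<lambda>s. snd c (\<gamma> s)) 0 1))"
        unfolding snd_d using \<gamma>(3) by (simp add: fd_eqI)
      have 2: "push \<A> id p X = tvec \<A> c p (fd (\<lambda>s. snd c (\<gamma> s)) 0 1)"
        using push_velocity[where t = 0 and \<gamma> = \<gamma> and \<C> = "{d}", OF sp _ \<gamma>p(1)] velocity_eq_tvec[OF sc c(1) \<gamma>p(2)] \<gamma>(1,3) by simp
      show ?thesis using \<gamma> \<gamma>d 1 2 by blast
    qed
    fix X Y assume XY: "X \<in> tangent_space {d} p" "Y \<in> tangent_space {d} p" "push \<A> id p X = push \<A> id p Y"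
    obtain \<gamma>1 where \<gamma>1: "X = velocity {d} \<gamma>1 0" "\<forall>\<^sub>F s in nhds 0. \<gamma>1 s \<in> fst d" "\<gamma>1 0 = p"
        "smooth_near (\<lambda>s. snd d (\<gamma>1 s)) 0" "push \<A> id p X = tvec \<A> c p (fd (\<lambda>s. snd c (\<gamma>1 s)) 0 1)"
        "fd (\<lambda>s. snd d (\<gamma>1 s)) 0 1 = R (fd \<Theta> (snd c p) (fd (\<lambda>s. snd c (\<gamma>1 s)) 0 1))"
      using key[OF XY(1)] by metis
    obtain \<gamma>2 where \<gamma>2: "Y = velocity {d} \<gamma>2 0" "\<forall>\<^sub>F s in nhds 0. \<gamma>2 s \<in> fst d" "\<gamma>2 0 = p"
        "smooth_near (\<lambda>s. snd d (\<gamma>2 s)) 0" "push \<A> id p Y = tvec \<A> c p (fd (\<lambda>s. snd c (\<gamma>2 s)) 0 1)"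
        "fd (\<lambda>s. snd d (\<gamma>2 s)) 0 1 = R (fd \<Theta> (snd c p) (fd (\<lambda>s. snd c (\<gamma>2 s)) 0 1))"
      using key[OF XY(2)] by metis
    have eq: "fd (\<lambda>s. snd d (\<gamma>1 s)) 0 1 = fd (\<lambda>s. snd d (\<gamma>2 s)) 0 1"
      using tvec_inj[OF c(1) pc] XY(3) \<gamma>1(5,6) \<gamma>2(5,6) by metis
    show "X = Y"
    proof
      fix h
      show "X h = Y h"
      proof (cases "smooth_fun_at {d} p h")
        case True
        then have "smooth_near (\<lambda>x. h (chart_inv d x)) (snd d p)"
          by (rule smooth_fun_atE) simp
        then show ?thesis
          unfolding \<gamma>1(1) \<gamma>2(1)
          using velocity_chart[where \<A> = "{d}" and h = h, OF _ ch \<gamma>1(2,4)]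
            velocity_chart[where \<A> = "{d}" and h = h, OF _ ch \<gamma>2(2,4)] eq \<gamma>1(3) \<gamma>2(3)
          by simp
      next
        \<comment> \<open>On a function that is not smooth both vectors take the default value
          0.\<close>
        case False
        then show ?thesis using \<gamma>1(1,3) \<gamma>2(1,3) by (simp add: velocity_def)
      qed
    qed
  qed
  then have "d \<in> sub_atlas"
    using ch sp by (auto simp: sub_atlas_def submanifold_atlas_def smooth_param_def)
  moreover have "x0 \<in> fst d" using c x0M UV(3) by (simp add: fst_d \<xi>0_def)
  ultimately show thesis using that by blast
qed

text \<open>Curves in the level set keep f constant. Conversely, the P-component of X in
  \<open>splitting\<close> is a multiple of df(X), so it vanishes and X comes from a coordinate
  vector of the level set.\<close>

lemma tangent_level:
  assumes x0: "x0 \<in> M\<^sub>l"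
  shows "push \<A> id x0 ` tangent_space sub_atlas x0 = {X \<in> tangent_space \<A> x0. X f = 0}"
proof (intro equalityI subsetI)
  fix X assume "X \<in> push \<A> id x0 ` tangent_space sub_atlas x0"
  then obtain \<gamma> where \<gamma>: "smooth_curve_at sub_atlas 0 \<gamma>" "\<gamma> 0 = x0" "X = push \<A> id x0 (velocity sub_atlas \<gamma> 0)"
    by (auto simp: tangent_space_def)
  obtain d where d: "d \<in> sub_atlas" "\<forall>\<^sub>F r in nhds 0. \<gamma> r \<in> fst d" "smooth_near (\<lambda>r. snd d (\<gamma> r)) 0"
    using sub_curve[OF \<gamma>(1)] by metis
  have p: "\<gamma> 0 \<in> fst d" by (rule eventually_nhds_x_imp_x[OF d(2)])
  have X: "X = velocity \<A> \<gamma> 0" using push_velocity[where t = 0 and \<gamma> = \<gamma>, OF sub_atlasD(1)[OF d(1)] d(1) p] \<gamma> by simp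
  have sc: "smooth_curve_at \<A> 0 \<gamma>" by (rule smooth_curve_param(1)[OF frm sub_atlasD(1)[OF d(1)] d(2,3)])
  have "\<forall>\<^sub>F r in nhds 0. f (\<gamma> r) = l"
    using d(2) by (rule eventually_mono) (use is_chartD(2)[OF sub_atlasD(2)[OF d(1)]] in \<open>auto simp: M\<^sub>l_def\<close>)
  then have "deriv (\<lambda>r. f (\<gamma> r)) 0 = deriv (\<lambda>r. l) 0" by (intro deriv_cong_ev) auto
  then have "X f = 0" by (simp add: X velocity_def)
  moreover have "X \<in> tangent_space \<A> x0" using sc \<gamma>(2) X by (auto simp: tangent_space_def)
  ultimately show "X \<in> {X \<in> tangent_space \<A> x0. X f = 0}" by simp
next
  fix X assume X: "X \<in> {X \<in> tangent_space \<A> x0. X f = 0}"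
  obtain d where d: "d \<in> sub_atlas" "x0 \<in> fst d" using sub_chart_exists[OF x0] by metis
  obtain c where c: "c \<in> \<A>" "x0 \<in> fst c" using chart_exists x0 by (auto simp: M\<^sub>l_def)
  note ch = sub_atlasD(2)[OF d(1)]
  let ?w = "snd d x0"
  have w: "?w \<in> snd d ` fst d" and inv: "chart_inv d ?w = x0" using d is_chartD(4)[OF ch] by auto
  have c': "chart_inv d ?w \<in> fst c" using c inv by simp
  obtain \<xi> where \<xi>: "X = tvec \<A> c x0 \<xi>" using X tangent_space_eq[OF c] by auto
  obtain u a where ua: "\<xi> = fd (\<lambda>y. snd c (chart_inv d y)) ?w u + a *\<^sub>R gen_coord c (chart_inv d ?w)"
    "fd (loc_f c) (snd c (chart_inv d ?w)) \<xi> = a * (\<alpha> * l)"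
    using splitting[OF d(1) w c(1) c'] by metis
  have "a * (\<alpha> * l) = 0" using ua(2) X tvec_f(1)[OF c, of \<xi>] \<xi> inv by simp
  then have "\<xi> = fd (\<lambda>y. snd c (chart_inv d y)) ?w u" using ua(1) \<alpha> l by simp
  then have "X = push \<A> id x0 (coord_vec sub_atlas d ?w u)"
    using push_coord_vec[OF frm sub_atlasD(1)[OF d(1)] d(1) w c(1) c', of u] \<xi> inv by simp
  moreover have "coord_vec sub_atlas d ?w u \<in> tangent_space sub_atlas x0"
    using smooth_curve_atI[OF d(1) chart_line(1,2)[OF ch w, of u]] inv
    unfolding coord_vec_def tangent_space_def by force
  ultimately show "X \<in> push \<A> id x0 ` tangent_space sub_atlas x0" by blast
qed

end

section \<open>The geodesic formula\<close>

lemma LBINT_derivative: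
  fixes \<phi> :: "real \<Rightarrow> real"
  assumes cont: "\<And>r. r \<in> {-\<epsilon><..<\<epsilon>} \<Longrightarrow> isCont \<phi> r" and t: "t \<in> {-\<epsilon><..<\<epsilon>}"
  shows "((\<lambda>t. LBINT \<tau>=0..t. \<phi> \<tau>) has_real_derivative \<phi> t) (at t)"
proof -
  \<comment> \<open>A compact interval around t inside the open one, as the fundamental theorem of
    calculus requires.\<close>
  define r where "r = (\<bar>t\<bar> + \<epsilon>) / 2"
  have r: "\<bar>t\<bar> < r" "r < \<epsilon>" using t by (auto simp: r_def)
  have "((\<lambda>u. LBINT \<tau>=(0::real)..u. \<phi> \<tau>) has_vector_derivative \<phi> t) (at t within {-r..r})"
  proof (rule interval_integral_FTC2)
    show "continuous_on {-r..r} \<phi>"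
      using r cont by (intro continuous_at_imp_continuous_on) auto
  qed (use r in auto)
  moreover have "at t within {-r..r} = at t" using r by (intro at_within_Icc_at) auto
  ultimately show ?thesis by (simp add: has_real_derivative_iff_has_vector_derivative zero_ereal_def)
qed

context homogeneous begin

text \<open>Since P f = \<alpha> l and the tangent vectors of the level set are those annihilating
  f, the coefficient of P in Z can only be Z f / (\<alpha> l); this gives the inverse map.\<close>

lemma splitting_bij:
  assumes x0: "x0 \<in> M\<^sub>l"
  defines "T \<equiv> push \<A> id x0 ` tangent_space sub_atlas x0"
  shows "A \<in> tangent_space \<A> x0 \<Longrightarrow> (\<lambda>h. A h - A f / (\<alpha> * l) * generator \<A> m x0 h) \<in> T"
    and "bij_betw (\<lambda>(X, s) h. X h + s * generator \<A> m x0 h) (T \<times> UNIV) (tangent_space \<A> x0)"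
proof -
  obtain c where c: "c \<in> \<A>" "x0 \<in> fst c" using chart_exists x0 by (auto simp: M\<^sub>l_def)
  have T: "T = {X \<in> tangent_space \<A> x0. X f = 0}" unfolding T_def by (rule tangent_level[OF x0])
  have Pf: "generator \<A> m x0 f = \<alpha> * l" using generator_eq(2)[OF c] x0 by (simp add: M\<^sub>l_def)
  have comb: "(\<lambda>h. X h + s * generator \<A> m x0 h) \<in> tangent_space \<A> x0" if "X \<in> tangent_space \<A> x0" for X s
  proof -
    obtain u where "X = tvec \<A> c x0 u" using \<open>X \<in> tangent_space \<A> x0\<close> tangent_space_eq[OF c] by auto
    then have "(\<lambda>h. X h + s * generator \<A> m x0 h) = tvec \<A> c x0 (1 *\<^sub>R u + s *\<^sub>R gen_coord c x0)"
      unfolding generator_eq(1)[OF c] tvec_linear(1)[OF c] by simp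
    then show ?thesis using tangent_space_eq[OF c] by simp
  qed
  show proj: "(\<lambda>h. A h - A f / (\<alpha> * l) * generator \<A> m x0 h) \<in> T" if "A \<in> tangent_space \<A> x0" for A
    unfolding T using comb[OF that, of "- (A f / (\<alpha> * l))"] \<alpha> l by (simp add: Pf)
  show "bij_betw (\<lambda>(X, s) h. X h + s * generator \<A> m x0 h) (T \<times> UNIV) (tangent_space \<A> x0)"
  proof (rule bij_betw_byWitness[where f' = "\<lambda>Z. (\<lambda>h. Z h - Z f / (\<alpha> * l) * generator \<A> m x0 h, Z f / (\<alpha> * l))"])
    show "\<forall>a\<in>T \<times> UNIV. (\<lambda>Z. (\<lambda>h. Z h - Z f / (\<alpha> * l) * generator \<A> m x0 h, Z f / (\<alpha> * l)))
        ((\<lambda>(X, s) h. X h + s * generator \<A> m x0 h) a) = a"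
      using \<alpha> l by (auto simp: T Pf)
    show "(\<lambda>(X, s) h. X h + s * generator \<A> m x0 h) ` (T \<times> UNIV) \<subseteq> tangent_space \<A> x0"
      using comb by (auto simp: T)
    show "(\<lambda>Z. (\<lambda>h. Z h - Z f / (\<alpha> * l) * generator \<A> m x0 h, Z f / (\<alpha> * l))) ` tangent_space \<A> x0 \<subseteq> T \<times> UNIV"
      using proj by auto
  qed auto
qed

section \<open>The lifted curve through given initial data\<close>

context
  fixes x0 :: 'a and A :: "'a tangent" and J :: "real set" and y :: "real \<Rightarrow> 'a"
  assumes x0: "x0 \<in> M\<^sub>l" and A: "A \<in> tangent_space \<A> x0"
    and J: "open J" "is_interval J" "0 \<in> J" and y: "geodesic sub_atlas g_sub J y" "y 0 = x0"
    and V: "push \<A> id x0 (velocity sub_atlas y 0) = (\<lambda>h. A h - A f / (\<alpha> * l) * generator \<A> m x0 h)"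
begin

lemma velocity_y: "velocity \<A> y 0 = (\<lambda>h. A h - A f / (\<alpha> * l) * generator \<A> m x0 h)"
proof -
  obtain d where d: "d \<in> sub_atlas" "\<forall>\<^sub>F r in nhds 0. y r \<in> fst d"
    using y J(3) sub_curve unfolding geodesic_def by metis
  have "y 0 \<in> fst d" by (rule eventually_nhds_x_imp_x[OF d(2)])
  then show ?thesis
    using push_velocity[where t = 0 and \<gamma> = y, OF sub_atlasD(1)[OF d(1)] d(1)] V y(2) by simp
qed

text \<open>Energy is constant, so it may be computed at 0. There g(A,P) = A f and g(P,P) = \<alpha>
  l, and removing the P-component from A lowers g(A,A) by (A f)^2 / (\<alpha> l).\<close>

lemma energy_y:
  assumes "\<tau> \<in> J"
  shows "g (y \<tau>) (velocity \<A> y \<tau>) (velocity \<A> y \<tau>) = g x0 A A - (A f)\<^sup>2 / (\<alpha> * l)"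
proof -
  obtain c where c: "c \<in> \<A>" "x0 \<in> fst c" using chart_exists x0 by (auto simp: M\<^sub>l_def)
  have fx: "f x0 = l" using x0 by (simp add: M\<^sub>l_def)
  obtain u where u: "A = tvec \<A> c x0 u" using A tangent_space_eq[OF c] by auto
  let ?a = "A f / (\<alpha> * l)" and ?P = "gen_coord c x0"
  have xc: "snd c x0 \<in> snd c ` fst c" and inv: "chart_inv c (snd c x0) = x0"
    using c is_chartD(4)[OF chart[OF c(1)]] by auto
  note mm = metric_onD[OF metric_on_chart[OF g c(1)] xc]
  note lm = local_metric_eq[OF c(1) xc, of g, unfolded inv]
  have v: "velocity \<A> y 0 = tvec \<A> c x0 (u - ?a *\<^sub>R ?P)"
    using tvec_linear(1)[OF c, of 1 u "- ?a" ?P] unfolding velocity_y generator_eq(1)[OF c] u by simp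
  have "g (y \<tau>) (velocity \<A> y \<tau>) (velocity \<A> y \<tau>) = g x0 (velocity \<A> y 0) (velocity \<A> y 0)"
    using sub_energy_constant[OF J(1,2) y(1) assms J(3)] y(2) by simp
  also have "\<dots> = local_metric \<A> g c (snd c x0) (u - ?a *\<^sub>R ?P) (u - ?a *\<^sub>R ?P)"
    unfolding v lm ..
  also have "\<dots> = g x0 A A - 2 * ?a * fd (loc_f c) (snd c x0) u + ?a\<^sup>2 * (\<alpha> * l)"
    using gen_metric[OF c] mm(2)[of u ?P] fx
    by (simp add: bilinear_lsub[OF mm(1)] bilinear_rsub[OF mm(1)] bilinear_lmul[OF mm(1)] bilinear_rmul[OF mm(1)]
        lm[of u u, folded u] algebra_simps power2_eq_square)
  also have "fd (loc_f c) (snd c x0) u = A f" using tvec_f(1)[OF c, of u] u by simp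
  finally show ?thesis using \<alpha> l by (simp add: power2_eq_square field_simps)
qed

text \<open>Forward, uniqueness compares \<open>\<gamma>\<close> with the lifted curve. Backward,
  \<open>\<gamma>\<close> is arbitrary outside the interval, but derivatives at points of an open
  interval see only the values in it.\<close>

lemma geodesic_iff_formula:
  assumes \<epsilon>: "\<epsilon> > 0" and \<sigma>J: "\<And>t. t \<in> {-\<epsilon><..<\<epsilon>} \<Longrightarrow> \<sigma> t \<in> J"
    and sm: "\<And>t. t \<in> {-\<epsilon><..<\<epsilon>} \<Longrightarrow> smooth_near \<sigma> t" "\<And>t. t \<in> {-\<epsilon><..<\<epsilon>} \<Longrightarrow> smooth_near s t"
    and init: "\<sigma> 0 = 0" "s 0 = 0" "fd \<sigma> 0 1 = 1" "fd s 0 1 = A f / (\<alpha> * l)"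
    and k: "k = \<alpha> * (\<beta> + 1)"
    and e1: "\<And>t. t \<in> {-\<epsilon><..<\<epsilon>} \<Longrightarrow> fd (\<lambda>r. fd \<sigma> r 1) t 1 + k * fd s t 1 * fd \<sigma> t 1 = 0"
    and e2: "\<And>t. t \<in> {-\<epsilon><..<\<epsilon>} \<Longrightarrow> 2 * (\<alpha> * l) * fd (\<lambda>r. fd s r 1) t 1 + k * (\<alpha> * l) * (fd s t 1)\<^sup>2
        - k * (fd \<sigma> t 1)\<^sup>2 * (g x0 A A - (A f)\<^sup>2 / (\<alpha> * l)) = 0"
  shows "geodesic \<A> (g_conf \<beta>) {-\<epsilon><..<\<epsilon>} \<gamma> \<and> \<gamma> 0 = x0 \<and> velocity \<A> \<gamma> 0 = A
    \<longleftrightarrow> (\<forall>t\<in>{-\<epsilon><..<\<epsilon>}. \<gamma> t = m (exp (s t)) (y (\<sigma> t)))"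
proof -
  let ?I = "{-\<epsilon><..<\<epsilon>}" and ?\<gamma> = "\<lambda>t. m (exp (s t)) (y (\<sigma> t))"
  have I: "open ?I" "connected ?I" "0 \<in> ?I" using \<epsilon> by auto
  have geo: "geodesic \<A> (g_conf \<beta>) ?I ?\<gamma>"
    by (rule geodesic_lift[OF J(1) y(1) energy_y \<sigma>J sm k e1 e2])
  have 0: "?\<gamma> 0 = x0" using init m_1 x0 y(2) by (simp add: M\<^sub>l_def)
  obtain d where d: "d \<in> sub_atlas" "\<forall>\<^sub>F r in nhds (\<sigma> 0). y r \<in> fst d" "smooth_near (\<lambda>r. snd d (y r)) (\<sigma> 0)"
    using y J(3) sub_curve init(1) unfolding geodesic_def by metis
  have vel: "velocity \<A> ?\<gamma> 0 = A"
    unfolding lift_velocity[OF d sm(1)[OF I(3)] sm(2)[OF I(3)] init(2,1,3)] init(4) velocity_y y(2) by simp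
  show ?thesis
  proof (intro iffI ballI)
    fix t assume "geodesic \<A> (g_conf \<beta>) ?I \<gamma> \<and> \<gamma> 0 = x0 \<and> velocity \<A> \<gamma> 0 = A" and t: "t \<in> ?I"
    then show "\<gamma> t = ?\<gamma> t"
      using geodesic_unique[OF g_conf I(1,2,3) t _ geo, of \<gamma>] 0 vel by simp
  next
    assume eq: "\<forall>t\<in>?I. \<gamma> t = ?\<gamma> t"
    have "geodesic \<A> (g_conf \<beta>) ?I \<gamma>"
      by (rule geodesic_cong[OF g_conf I(1) _ geo]) (use eq in auto)
    moreover have "\<forall>\<^sub>F t in nhds 0. \<gamma> t = ?\<gamma> t"
      using eventually_nhds_in_open[OF I(1,3)] by (rule eventually_mono) (use eq in auto)
    then have "velocity \<A> \<gamma> 0 = A" using velocity_cong vel by metis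
    moreover have "\<gamma> 0 = x0" using eq I(3) 0 by metis
    ultimately show "geodesic \<A> (g_conf \<beta>) ?I \<gamma> \<and> \<gamma> 0 = x0 \<and> velocity \<A> \<gamma> 0 = A" by blast
  qed
qed

text \<open>With k = 0 the two equations say that \<sigma> and s have vanishing second derivatives,
  and the initial data select t and a multiple of t.\<close>

lemma geodesic_iff_exp:
  assumes \<beta>: "\<beta> = -1" and \<epsilon>: "\<epsilon> > 0" and sub: "{-\<epsilon><..<\<epsilon>} \<subseteq> J"
  shows "geodesic \<A> (g_conf \<beta>) {-\<epsilon><..<\<epsilon>} \<gamma> \<and> \<gamma> 0 = x0 \<and> velocity \<A> \<gamma> 0 = A
    \<longleftrightarrow> (\<forall>t\<in>{-\<epsilon><..<\<epsilon>}. \<gamma> t = m (exp (A f / (\<alpha> * l) * t)) (y t))"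
proof (rule geodesic_iff_formula[where \<sigma> = "\<lambda>t. t" and s = "\<lambda>t. A f / (\<alpha> * l) * t" and k = 0, OF \<epsilon>])
  have 1: "fd (\<lambda>t::real. t) t 1 = 1" for t by (rule fd_real_eqI) (auto intro!: derivative_eq_intros)
  have 2: "fd (\<lambda>t. A f / (\<alpha> * l) * t) t 1 = A f / (\<alpha> * l)" for t
    by (rule fd_real_eqI) (rule DERIV_cmult_Id)
  show "fd (\<lambda>t::real. t) 0 1 = 1" by (rule 1)
  show "fd (\<lambda>t. A f / (\<alpha> * l) * t) 0 1 = A f / (\<alpha> * l)" by (rule 2)
  show "fd (\<lambda>r. fd (\<lambda>t::real. t) r 1) t 1 + 0 * fd (\<lambda>t. A f / (\<alpha> * l) * t) t 1 * fd (\<lambda>t::real. t) t 1 = 0" for t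
    unfolding 1 by simp
  show "2 * (\<alpha> * l) * fd (\<lambda>r. fd (\<lambda>t. A f / (\<alpha> * l) * t) r 1) t 1 + 0 * (\<alpha> * l) * (fd (\<lambda>t. A f / (\<alpha> * l) * t) t 1)\<^sup>2
        - 0 * (fd (\<lambda>t::real. t) t 1)\<^sup>2 * (g x0 A A - (A f)\<^sup>2 / (\<alpha> * l)) = 0" for t
    unfolding 2 by simp
  show "smooth_near (\<lambda>t. A f / (\<alpha> * l) * t) t" for t
    by (intro smooth_near_mult smooth_near_const smooth_near_id)
  show "smooth_near (\<lambda>t::real. t) t" for t by (rule smooth_near_id)
  show "t \<in> J" if "t \<in> {-\<epsilon><..<\<epsilon>}" for t using that sub by blast
  show "0 = \<alpha> * (\<beta> + 1)" using \<beta> by simp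
  show "A f / (\<alpha> * l) * 0 = 0" by simp
qed simp_all

lemma geodesic_iff_powr:
  assumes \<beta>: "\<beta> \<noteq> -1" and \<epsilon>: "\<epsilon> > 0"
  defines "\<mu> \<equiv> \<lambda>t. 1 + A f / l * (\<beta> + 1) * t + \<alpha> / (4 * l) * g x0 A A * (\<beta> + 1)\<^sup>2 * t\<^sup>2"
  assumes pos: "\<And>t. t \<in> {-\<epsilon><..<\<epsilon>} \<Longrightarrow> \<mu> t > 0" and inJ: "\<And>t. t \<in> {-\<epsilon><..<\<epsilon>} \<Longrightarrow> (LBINT \<tau>=0..t. 1 / \<mu> \<tau>) \<in> J"
  shows "geodesic \<A> (g_conf \<beta>) {-\<epsilon><..<\<epsilon>} \<gamma> \<and> \<gamma> 0 = x0 \<and> velocity \<A> \<gamma> 0 = A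
    \<longleftrightarrow> (\<forall>t\<in>{-\<epsilon><..<\<epsilon>}. \<gamma> t = m (\<mu> t powr (1 / (\<alpha> * (\<beta> + 1)))) (y (LBINT \<tau>=0..t. 1 / \<mu> \<tau>)))"
proof -
  define k where "k = \<alpha> * (\<beta> + 1)"
  have k: "k \<noteq> 0" using \<alpha> \<beta> by (simp add: k_def)
  define p where "p = A f / l * (\<beta> + 1)"
  define q where "q = \<alpha> / (4 * l) * g x0 A A * (\<beta> + 1)\<^sup>2"
  have \<mu>: "\<mu> = (\<lambda>t. 1 + p * t + q * t\<^sup>2)" by (simp add: \<mu>_def p_def q_def)
  define \<sigma> where "\<sigma> = (\<lambda>t::real. LBINT \<tau>=0..t. 1 / \<mu> \<tau>)"
  define s where "s = (\<lambda>t. ln (\<mu> t) / k)"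
  let ?I = "{-\<epsilon><..<\<epsilon>}"
  have I: "open ?I" "0 \<in> ?I" using \<epsilon> by auto
  have smooth_\<mu>: "smooth_near \<mu> t" for t
    unfolding \<mu> power2_eq_square by (intro smooth_near_add smooth_near_mult smooth_near_const smooth_near_id)
  have d\<mu>: "(\<mu> has_real_derivative p + 2 * q * t) (at t)" for t
    unfolding \<mu> by (auto intro!: derivative_eq_intros)
  have \<mu>0: "\<mu> 0 = 1" by (simp add: \<mu>)
  have ev: "\<forall>\<^sub>F r in nhds t. r \<in> ?I" if "t \<in> ?I" for t using I(1) that by (rule eventually_nhds_in_open)
  have d\<sigma>: "(\<sigma> has_real_derivative 1 / \<mu> t) (at t)" if "t \<in> ?I" for t
    unfolding \<sigma>_def
  proof (rule LBINT_derivative[OF _ that])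
    show "isCont (\<lambda>\<tau>. 1 / \<mu> \<tau>) r" if "r \<in> ?I" for r
      using smooth_near_isCont[OF smooth_\<mu>] pos[OF that] by (intro continuous_intros) auto
  qed
  have sm_inv: "smooth_near (\<lambda>t. 1 / \<mu> t) t" if "t \<in> ?I" for t
  proof -
    have "smooth_near (\<lambda>t. \<mu> t powr -1) t"
      by (rule smooth_near_compose[OF frame_Basis smooth_near_powr[OF pos[OF that]] smooth_\<mu>])
    moreover have "\<forall>\<^sub>F r in nhds t. \<mu> r powr -1 = 1 / \<mu> r"
      using ev[OF that] by (rule eventually_mono) (use pos in \<open>auto simp: powr_minus divide_inverse less_imp_le\<close>)
    ultimately show ?thesis by (rule smooth_near_cong)
  qed
  have sm_\<sigma>: "smooth_near \<sigma> t" if "t \<in> ?I" for t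
    by (rule smooth_near_antiderivative[OF I(1) that d\<sigma> sm_inv[OF that]])
  have sm_s: "smooth_near s t" if "t \<in> ?I" for t
    unfolding s_def divide_inverse
    by (intro smooth_near_mult smooth_near_const smooth_near_compose[OF frame_Basis smooth_near_ln[OF pos[OF that]] smooth_\<mu>])
  have \<sigma>1: "fd \<sigma> t 1 = 1 / \<mu> t" if "t \<in> ?I" for t by (rule fd_real_eqI[OF d\<sigma>[OF that]])
  have s1: "fd s t 1 = (p + 2 * q * t) / (k * \<mu> t)" if "t \<in> ?I" for t
  proof (rule fd_real_eqI)
    show "(s has_real_derivative (p + 2 * q * t) / (k * \<mu> t)) (at t)"
      unfolding s_def using pos[OF that] k by (auto intro!: derivative_eq_intros d\<mu> simp: field_simps)
  qed
  have \<sigma>2: "fd (\<lambda>r. fd \<sigma> r 1) t 1 = - (p + 2 * q * t) / (\<mu> t)\<^sup>2" if "t \<in> ?I" for t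
  proof -
    have "fd (\<lambda>r. fd \<sigma> r 1) t = fd (\<lambda>r. 1 / \<mu> r) t"
      by (rule fd_cong_eventually) (use ev[OF that] in \<open>auto elim!: eventually_mono simp: \<sigma>1\<close>)
    moreover have "((\<lambda>r. 1 / \<mu> r) has_real_derivative - (p + 2 * q * t) / (\<mu> t)\<^sup>2) (at t)"
      using pos[OF that] by (auto intro!: derivative_eq_intros d\<mu> simp: power2_eq_square field_simps)
    ultimately show ?thesis by (simp add: fd_real_eqI)
  qed
  have s2: "fd (\<lambda>r. fd s r 1) t 1 = (2 * q * \<mu> t - (p + 2 * q * t)\<^sup>2) / (k * (\<mu> t)\<^sup>2)" if "t \<in> ?I" for t
  proof -
    have "fd (\<lambda>r. fd s r 1) t = fd (\<lambda>r. (p + 2 * q * r) / (k * \<mu> r)) t"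
      by (rule fd_cong_eventually) (use ev[OF that] in \<open>auto elim!: eventually_mono simp: s1\<close>)
    moreover have "((\<lambda>r. (p + 2 * q * r) / (k * \<mu> r)) has_real_derivative
        (2 * q * \<mu> t - (p + 2 * q * t)\<^sup>2) / (k * (\<mu> t)\<^sup>2)) (at t)"
      using pos[OF that] k by (auto intro!: derivative_eq_intros d\<mu> simp: power2_eq_square field_simps)
    ultimately show ?thesis by (simp add: fd_real_eqI)
  qed
  let ?K = "g x0 A A - (A f)\<^sup>2 / (\<alpha> * l)"
  \<comment> \<open>For a quadratic polynomial the quantity 2 \<mu> \<mu>'' - \<mu>'^2 is constant,
    the negative of its discriminant. The coefficient q is the one for which it matches the
    energy.\<close>
  have disc: "4 * q * \<mu> t - (p + 2 * q * t)\<^sup>2 = k\<^sup>2 * ?K / (\<alpha> * l)" for t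
  proof -
    have "4 * q * \<mu> t - (p + 2 * q * t)\<^sup>2 = 4 * q - p\<^sup>2" by (simp add: \<mu> power2_eq_square algebra_simps)
    also have "\<dots> = k\<^sup>2 * ?K / (\<alpha> * l)"
      using \<alpha> l by (simp add: p_def q_def k_def power2_eq_square field_simps)
    finally show ?thesis .
  qed
  have "geodesic \<A> (g_conf \<beta>) ?I \<gamma> \<and> \<gamma> 0 = x0 \<and> velocity \<A> \<gamma> 0 = A
    \<longleftrightarrow> (\<forall>t\<in>?I. \<gamma> t = m (exp (s t)) (y (\<sigma> t)))"
  proof (rule geodesic_iff_formula[OF \<epsilon> _ sm_\<sigma> sm_s _ _ _ _ k_def])
    show "\<sigma> t \<in> J" if "t \<in> ?I" for t using inJ[OF that] by (simp add: \<sigma>_def)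
    show "\<sigma> 0 = 0" by (simp add: \<sigma>_def interval_integral_endpoints_same zero_ereal_def)
    show "s 0 = 0" by (simp add: s_def \<mu>0)
    show "fd \<sigma> 0 1 = 1" using \<sigma>1[OF I(2)] \<mu>0 by simp
    show "fd s 0 1 = A f / (\<alpha> * l)" using s1[OF I(2)] \<mu>0 \<beta> by (simp add: p_def k_def add_eq_0_iff2)
    fix t assume t: "t \<in> ?I"
    note nz = pos[OF t, THEN less_imp_neq, symmetric]
    show "fd (\<lambda>r. fd \<sigma> r 1) t 1 + k * fd s t 1 * fd \<sigma> t 1 = 0"
      unfolding \<sigma>1[OF t] \<sigma>2[OF t] s1[OF t] using nz k by (simp add: power2_eq_square field_simps)
    \<comment> \<open>After substitution the equation for s is a multiple of the identity
      \<open>disc\<close>.\<close>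
    have "2 * (\<alpha> * l) * fd (\<lambda>r. fd s r 1) t 1 + k * (\<alpha> * l) * (fd s t 1)\<^sup>2 - k * (fd \<sigma> t 1)\<^sup>2 * ?K
      = (\<alpha> * l) / (k * (\<mu> t)\<^sup>2) * ((4 * q * \<mu> t - (p + 2 * q * t)\<^sup>2) - k\<^sup>2 * ?K / (\<alpha> * l))"
      unfolding \<sigma>1[OF t] s1[OF t] s2[OF t] using nz k \<alpha> l
      by (simp add: divide_simps) (simp add: power2_eq_square algebra_simps)
    then show "2 * (\<alpha> * l) * fd (\<lambda>r. fd s r 1) t 1 + k * (\<alpha> * l) * (fd s t 1)\<^sup>2 - k * (fd \<sigma> t 1)\<^sup>2 * ?K = 0"
      unfolding disc by simp
  qed
  also have "\<dots> \<longleftrightarrow> (\<forall>t\<in>?I. \<gamma> t = m (\<mu> t powr (1 / (\<alpha> * (\<beta> + 1)))) (y (LBINT \<tau>=0..t. 1 / \<mu> \<tau>)))"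
  proof (rule ball_cong[OF refl])
    fix t assume t: "t \<in> ?I"
    have "exp (s t) = \<mu> t powr (1 / (\<alpha> * (\<beta> + 1)))"
      using pos[OF t] by (simp add: s_def powr_def k_def)
    then show "\<gamma> t = m (exp (s t)) (y (\<sigma> t)) \<longleftrightarrow>
        \<gamma> t = m (\<mu> t powr (1 / (\<alpha> * (\<beta> + 1)))) (y (LBINT \<tau>=0..t. 1 / \<mu> \<tau>))"
      by (simp add: \<sigma>_def)
  qed
  finally show ?thesis .
qed

end

end

theorem proposition3p21:
  fixes M :: "'a::{t2_space,second_countable_topology} set"
    and \<A> :: "('a, 'e::euclidean_space) chart set"
    and m :: "real \<Rightarrow> 'a \<Rightarrow> 'a"
    and g :: "'a metric_tensor" and f :: "'a \<Rightarrow> real"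
    and \<alpha> \<beta> l :: real
    and D :: "'f::real_inner set"
    and x\<^sub>0 :: 'a and A :: "'a tangent"
  defines "P \<equiv> generator \<A> m x\<^sub>0"
    and "M\<^sub>l \<equiv> {x \<in> M. f x = l}"
  defines "\<B> \<equiv> (submanifold_atlas \<A> M\<^sub>l :: ('a, 'f) chart set)"
    and "g\<^sub>l \<equiv> pullback \<A> id g"
    and "V \<equiv> (\<lambda>h. A h - A f / (\<alpha> * l) * P h)"
    and "\<mu> \<equiv> (\<lambda>t. 1 + A f / l * (\<beta> + 1) * t + \<alpha> / (4 * l) * g x\<^sub>0 A A * (\<beta> + 1)\<^sup>2 * t\<^sup>2)"
  defines "T\<^sub>l \<equiv> push \<A> id x\<^sub>0 ` tangent_space \<B> x\<^sub>0"
  assumes manifold: "smooth_manifold M \<A>"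
    and action: "free_smooth_action M \<A> m"
    and pair: "homogeneous_pair M \<A> m g f \<alpha>"
    and model_dim: "finite D" "independent D" "span D = UNIV" "card D + 1 = DIM('e)"
    and "l > 0" and "x\<^sub>0 \<in> M\<^sub>l" and "A \<in> tangent_space \<A> x\<^sub>0"
  shows "V \<in> T\<^sub>l \<and>
    bij_betw (\<lambda>(X, s) h. X h + s * P h) (T\<^sub>l \<times> UNIV) (tangent_space \<A> x\<^sub>0) \<and>
    (\<forall>J y \<epsilon>.
       open J \<and> is_interval J \<and> 0 \<in> J \<and> geodesic \<B> g\<^sub>l J y \<and>
       y 0 = x\<^sub>0 \<and> push \<A> id x\<^sub>0 (velocity \<B> y 0) = V \<and> \<epsilon> > 0 \<longrightarrow>
       (\<beta> \<noteq> -1 \<longrightarrow>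
          (\<forall>t\<in>{-\<epsilon><..<\<epsilon>}. \<mu> t > 0 \<and> (LBINT \<tau>=0..t. 1 / \<mu> \<tau>) \<in> J) \<longrightarrow>
          (\<forall>\<gamma>. geodesic \<A> (\<lambda>p X Y. f p powr \<beta> * g p X Y) {-\<epsilon><..<\<epsilon>} \<gamma> \<and>
                 \<gamma> 0 = x\<^sub>0 \<and> velocity \<A> \<gamma> 0 = A
             \<longleftrightarrow> (\<forall>t\<in>{-\<epsilon><..<\<epsilon>}.
                   \<gamma> t = m (\<mu> t powr (1 / (\<alpha> * (\<beta> + 1)))) (y (LBINT \<tau>=0..t. 1 / \<mu> \<tau>))))) \<and>
       (\<beta> = -1 \<longrightarrow>
          {-\<epsilon><..<\<epsilon>} \<subseteq> J \<longrightarrow>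
          (\<forall>\<gamma>. geodesic \<A> (\<lambda>p X Y. f p powr \<beta> * g p X Y) {-\<epsilon><..<\<epsilon>} \<gamma> \<and>
                 \<gamma> 0 = x\<^sub>0 \<and> velocity \<A> \<gamma> 0 = A
             \<longleftrightarrow> (\<forall>t\<in>{-\<epsilon><..<\<epsilon>}. \<gamma> t = m (exp (A f / (\<alpha> * l) * t)) (y t)))))"
proof -
  interpret h: homogeneous M \<A> m g f \<alpha> l D
    by unfold_locales (rule manifold action pair \<open>l > 0\<close> model_dim)+
  have M: "M\<^sub>l = h.M\<^sub>l" by (simp add: M\<^sub>l_def h.M\<^sub>l_def)
  have B: "\<B> = h.sub_atlas" by (simp add: \<B>_def h.sub_atlas_def M)
  have x0: "x\<^sub>0 \<in> h.M\<^sub>l" using \<open>x\<^sub>0 \<in> M\<^sub>l\<close> M by simp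
  have conf: "(\<lambda>p X Y. f p powr \<beta> * g p X Y) = h.g_conf \<beta>" by (simp add: h.g_conf_def)
  note A = \<open>A \<in> tangent_space \<A> x\<^sub>0\<close>
  show ?thesis
    unfolding conf
  proof (intro conjI allI impI)
    show "V \<in> T\<^sub>l"
      using h.splitting_bij(1)[OF x0 A] by (simp add: V_def T\<^sub>l_def B P_def)
    show "bij_betw (\<lambda>(X, s) h. X h + s * P h) (T\<^sub>l \<times> UNIV) (tangent_space \<A> x\<^sub>0)"
      using h.splitting_bij(2)[OF x0] by (simp add: T\<^sub>l_def B P_def)
  next
    fix J y \<epsilon> \<gamma>
    assume *: "open J \<and> is_interval J \<and> 0 \<in> J \<and> geodesic \<B> g\<^sub>l J y \<and>
       y 0 = x\<^sub>0 \<and> push \<A> id x\<^sub>0 (velocity \<B> y 0) = V \<and> \<epsilon> > 0"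
      and "\<beta> \<noteq> -1" "\<forall>t\<in>{-\<epsilon><..<\<epsilon>}. \<mu> t > 0 \<and> (LBINT \<tau>=0..t. 1 / \<mu> \<tau>) \<in> J"
    then show "geodesic \<A> (h.g_conf \<beta>) {-\<epsilon><..<\<epsilon>} \<gamma> \<and> \<gamma> 0 = x\<^sub>0 \<and> velocity \<A> \<gamma> 0 = A
      \<longleftrightarrow> (\<forall>t\<in>{-\<epsilon><..<\<epsilon>}. \<gamma> t = m (\<mu> t powr (1 / (\<alpha> * (\<beta> + 1)))) (y (LBINT \<tau>=0..t. 1 / \<mu> \<tau>)))"
      unfolding \<mu>_def by (intro h.geodesic_iff_powr[OF x0 A]) (auto simp: B g\<^sub>l_def V_def P_def)
  next
    fix J y \<epsilon> \<gamma>
    assume "open J \<and> is_interval J \<and> 0 \<in> J \<and> geodesic \<B> g\<^sub>l J y \<and>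
       y 0 = x\<^sub>0 \<and> push \<A> id x\<^sub>0 (velocity \<B> y 0) = V \<and> \<epsilon> > 0"
      and "\<beta> = -1" "{-\<epsilon><..<\<epsilon>} \<subseteq> J"
    then show "geodesic \<A> (h.g_conf \<beta>) {-\<epsilon><..<\<epsilon>} \<gamma> \<and> \<gamma> 0 = x\<^sub>0 \<and> velocity \<A> \<gamma> 0 = A
      \<longleftrightarrow> (\<forall>t\<in>{-\<epsilon><..<\<epsilon>}. \<gamma> t = m (exp (A f / (\<alpha> * l) * t)) (y t))"
      by (intro h.geodesic_iff_exp[OF x0 A]) (auto simp: B g\<^sub>l_def V_def P_def)
  qed
qed

end
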